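(* Assume in addition that $\mu$ has a finite exponential moment, i.e. $\sum_{i\ge0}e^{\lambda i}\mu(i)<\infty$ for some $\lambda>0$. Then there exists $\kappa>0$ such that for every function $\varphi:\mathbb Z^d\to[0,\infty)$ satisfying $\sup_{x\in\mathbb Z^d}\sum_{y\in\mathbb Z^d}G(x,y)\varphi(y)\le\kappa$, $$\mathbb E\Big[\exp\Big(\sum_{u\in\mathcal T}\varphi(S_u)\Big)\Big]\le 2,$$ where $(S_u)_{u\in\mathcal T}$ is the random walk indexed by the infinite tree $\mathcal T$ started at $0$.
   Context: Fix $d\ge 5$. Let $\mu$ be a probability distribution on $\{0,1,2,\dots\}$ with mean $1$ and finite variance $\sigma^2>0$. Trees are rooted ordered (plane) trees. For a (possibly random) such tree $T$ and $x\in\mathbb Z^d$, the random walk indexed by $T$ started at $x$ is the family $(S^x_u)_{u\in T}$ with $S^x_{\mathrm{root}}=x$ such that, conditionally on $T$, the increments $S^x_u-S^x_{u^-}$ ($u^-$ the parent of $u$) are i.i.d. uniform on the $2d$ neighbours of $0$; $S_u=S^0_u$. The infinite tree $\mathcal T$ is built as follows: the root has $i$ children with probability $\mu(i-1)$ ($i\ge1$), its first child is special and the others are normal; each special vertex has $i$ children with probability $i\mu(i)$, exactly one of which, chosen uniformly, is special, the others being normal; normal vertices have offspring law $\mu$; everything independent. The root and the special vertices form the spine. Vertices of $\mathcal T$ are labelled by $\mathbb Z$: the root gets label $0$, the vertices on the side of the spine reached clockwise from the root get positive labels in depth-first order from the root, and all other vertices (including all spine vertices other than the root) get negative labels in depth-first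 order from infinity. $\mathcal T_-$ is the set of vertices with negative labels. $G(x,y)=\mathbb E\big[\sum_{u\in\mathcal T_-}\mathbf 1(S^x_u=y)\big]$. *)

theory Defs
  imports "HOL-Analysis.Analysis" "HOL-Probability.Probability"
begin

definition nbrs :: "(int ^ 'd) set" where
  "nbrs = {v. \<exists>i. v = axis i 1 \<or> v = axis i (-1)}"

definition step_pmf :: "(int ^ 'd) pmf" where
  "step_pmf = pmf_of_set nbrs"

text \<open>Size-biased law i * mu(i) (a probability law since mu has mean 1).\<close>
definition size_biased :: "nat pmf \<Rightarrow> nat pmf" where
  "size_biased \<mu> = embed_pmf (\<lambda>i. real i * pmf \<mu> i)"

text \<open>Offspring data of a special vertex: number of children k (size-biased),
  index of the special child, uniform in {0..<k}.\<close>
definition spec_pmf :: "nat pmf \<Rightarrow> (nat \<times> nat) pmf" where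
  "spec_pmf \<mu> = bind_pmf (size_biased \<mu>) (\<lambda>k. map_pmf (\<lambda>j. (k, j)) (pmf_of_set {..<k}))"

text \<open>Independent data attached to every Ulam-Harris label v: a mu-distributed
  number N (offspring if v is normal; root has N+1 children), a pair (K,J) used if v is a
  special vertex, and a uniform step X (increment from the parent of v to v).\<close>
type_synonym ('d) vdata = "(nat \<times> (nat \<times> nat)) \<times> (int ^ 'd)"

definition vdata_pmf :: "nat pmf \<Rightarrow> ('d::finite) vdata pmf" where
  "vdata_pmf \<mu> = pair_pmf (pair_pmf \<mu> (spec_pmf \<mu>)) step_pmf"

definition Omega :: "nat pmf \<Rightarrow> (nat list \<Rightarrow> ('d::finite) vdata) measure" where
  "Omega \<mu> = PiM UNIV (\<lambda>_. measure_pmf (vdata_pmf \<mu>))"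

definition Nof :: "(nat list \<Rightarrow> 'd vdata) \<Rightarrow> nat list \<Rightarrow> nat" where
  "Nof \<omega> v = fst (fst (\<omega> v))"
definition Kof :: "(nat list \<Rightarrow> 'd vdata) \<Rightarrow> nat list \<Rightarrow> nat" where
  "Kof \<omega> v = fst (snd (fst (\<omega> v)))"
definition Jof :: "(nat list \<Rightarrow> 'd vdata) \<Rightarrow> nat list \<Rightarrow> nat" where
  "Jof \<omega> v = snd (snd (fst (\<omega> v)))"
definition Xof :: "(nat list \<Rightarrow> 'd vdata) \<Rightarrow> nat list \<Rightarrow> int ^ 'd" where
  "Xof \<omega> v = snd (\<omega> v)"

fun spine :: "(nat list \<Rightarrow> 'd vdata) \<Rightarrow> nat \<Rightarrow> nat list" where
  "spine \<omega> 0 = []"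
| "spine \<omega> (Suc 0) = [0]"
| "spine \<omega> (Suc (Suc n)) = spine \<omega> (Suc n) @ [Jof \<omega> (spine \<omega> (Suc n))]"

definition special :: "(nat list \<Rightarrow> 'd vdata) \<Rightarrow> nat list \<Rightarrow> bool" where
  "special \<omega> v \<longleftrightarrow> (\<exists>n\<ge>1. v = spine \<omega> n)"

definition nch :: "(nat list \<Rightarrow> 'd vdata) \<Rightarrow> nat list \<Rightarrow> nat" where
  "nch \<omega> v = (if v = [] then Suc (Nof \<omega> v) else if special \<omega> v then Kof \<omega> v else Nof \<omega> v)"

definition sidx :: "(nat list \<Rightarrow> 'd vdata) \<Rightarrow> nat list \<Rightarrow> nat" where
  "sidx \<omega> v = (if v = [] then 0 else Jof \<omega> v)"

inductive_set tree :: "(nat list \<Rightarrow> 'd vdata) \<Rightarrow> nat list set" for \<omega> where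
  root: "[] \<in> tree \<omega>"
| child: "v \<in> tree \<omega> \<Longrightarrow> i < nch \<omega> v \<Longrightarrow> v @ [i] \<in> tree \<omega>"

text \<open>Vertices with negative labels: spine vertices other than the root, and the
  subtrees hanging off the spine on the left (children of a spine vertex with index
  smaller than that of the special child).\<close>
definition Tminus :: "(nat list \<Rightarrow> 'd vdata) \<Rightarrow> nat list set" where
  "Tminus \<omega> = tree \<omega> \<inter>
     ({v. special \<omega> v} \<union> {u. \<exists>n i w. i < sidx \<omega> (spine \<omega> n) \<and> u = spine \<omega> n @ [i] @ w})"

definition S :: "(nat list \<Rightarrow> 'd vdata) \<Rightarrow> int ^ 'd \<Rightarrow> nat list \<Rightarrow> int ^ 'd" where
  "S \<omega> x u = x + (\<Sum>k\<in>{1..length u}. Xof \<omega> (take k u))"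

definition G :: "nat pmf \<Rightarrow> int ^ ('d::finite) \<Rightarrow> int ^ 'd \<Rightarrow> ennreal" where
  "G \<mu> x y = (\<integral>\<^sup>+ \<omega>. (\<integral>\<^sup>+ u. indicator (Tminus \<omega>) u * indicator {y} (S \<omega> x u)
      \<partial>count_space UNIV) \<partial>Omega \<mu>)"

definition exp_ennreal :: "ennreal \<Rightarrow> ennreal" where
  "exp_ennreal t = (if t = \<infinity> then \<infinity> else ennreal (exp (enn2real t)))"

end

(*
  Write P for the step operator, g = sum_n P^n for the Green operator and phi for the potential.
  Counting only the subtrees to the left of the spine, G phi >= e P P g g phi with e > 0, because
  the variance is positive; hence g g phi is uniformly small.

  Replace g by the explicit kernel k(x) = (c + |x|^2)^(-(d-2)/2). For large c it is strictly
  superharmonic with m = k - P k of order |x|^(-d-2), hence summable, and k <= g m; so k * k * phi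
  is uniformly small as well. Since 1/k is a quasi-metric, k satisfies the three-point inequality
  k(a) k(b) <= C k(a+b) (k(a) + k(b)), and therefore k * psi^2 is a small multiple of psi = k * phi.

  The exponential functional of a critical tree started at x solves 1 + h = e^phi F(1 + P h), F the
  generating function of the offspring law. By the exponential moment F(1+s) <= 1 + s + M s^2 for
  small s, and a psi + b k * psi^2 is a supersolution. Each spine vertex then costs a factor
  1 + O(psi), and 1 + A k * psi is a supersolution of the recursion along the spine. Induction on
  the depth of truncation bounds the expectation by the product of the two supersolutions.
*)
theory Submission
  imports Defs "HOL-Real_Asymp.Real_Asymp"
begin

section \<open>A strictly superharmonic kernel\<close>

text \<open>Criticality is the obstacle. The mean offspring number is 1, so the linear terms of the
  recursion cancel exactly and leave no slack proportional to the unknown that could absorb the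
  quadratic error of the generating function. The slack has to come from a source term of size
  \<open>psi^2\<close>, whose potential must again be comparable to \<open>psi\<close>; this is what
  the three-point inequality is for. For the Green kernel itself that inequality would rest on its
  two-sided asymptotics; for an explicit power of \<open>c + |x|^2\<close> it is a comparison of
  norms, and superharmonicity is a Taylor expansion. The bound by a Green potential is the only link
  back to the walk. The hypothesis sees one side of the spine, the expectation both. One side
  already carries two Green operators, one along the spine and one inside the side trees, and
  two-sided costs are estimated by the same double potential. All potentials take values in
  \<open>ennreal\<close>; finiteness is read off afterwards from the smallness of
  \<open>k * k * phi\<close>. The numerical target is that either supersolution factor is at most
  7/5, since 49/25 is below 2.\<close>

lemma powr_second_difference_bound:
  fixes a :: real
  shows "\<exists>C\<ge>0. \<exists>r>0. r \<le> 1/2 \<and> (\<forall>z. \<bar>z\<bar> \<le> r \<longrightarrow>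
    \<bar>(1+z) powr a + (1-z) powr a - 2 - a*(a-1)*z^2\<bar> \<le> C * z^4)"
proof -
  have "(\<lambda>z::real. (1+z) powr a + (1-z) powr a - 2 - a*(a-1)*z^2) \<in> O[at_right 0](\<lambda>z. z^4)"
    by real_asymp
  then obtain C where C: "C > 0" and
    ev: "\<forall>\<^sub>F z in at_right 0. norm ((1+z) powr a + (1-z) powr a - 2 - a*(a-1)*z^2) \<le> C * norm (z^4)"
    by (auto elim: landau_o.bigE)
  from ev obtain b where b: "b > 0" and
    bound: "\<And>z. 0 < z \<Longrightarrow> z < b \<Longrightarrow> \<bar>(1+z) powr a + (1-z) powr a - 2 - a*(a-1)*z^2\<bar> \<le> C * z^4"
    unfolding eventually_at_right_field by (auto simp: abs_mult)
  define r where "r = min (b/2) (1/2)"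
  \<comment> \<open>The expression is even in \<open>z\<close>, so the expansion to the right of 0
    also covers negative \<open>z\<close>. For the same reason the error is of order 4: the cubic
    terms cancel.\<close>
  have "\<bar>(1+z) powr a + (1-z) powr a - 2 - a*(a-1)*z^2\<bar> \<le> C * z^4" if "\<bar>z\<bar> \<le> r" for z
  proof -
    have zb: "\<bar>z\<bar> < b" using that b by (auto simp: r_def)
    consider "z = 0" | "z > 0" | "z < 0" by linarith
    then show ?thesis
    proof cases
      case 3
      then show ?thesis using bound[of "-z"] zb by (simp add: add.commute algebra_simps)
    qed (use bound zb in auto)
  qed
  moreover have "r > 0" "r \<le> 1/2" using b by (auto simp: r_def)
  ultimately show ?thesis using C by (intro exI[of _ C] conjI exI[of _ r]) auto
qed

text \<open>One-sided, because it is applied at \<open>u = 1/T\<close> only, where it compares the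
  value at the centre with the common expansion point of the neighbours.\<close>

lemma powr_first_order_bound:
  fixes a :: real
  shows "\<exists>C\<ge>0. \<exists>r>0. r \<le> 1/2 \<and> (\<forall>u. 0 < u \<longrightarrow> u \<le> r \<longrightarrow>
    \<bar>(1-u) powr a - 1 + a*u\<bar> \<le> C * u^2)"
proof -
  have "(\<lambda>u::real. (1-u) powr a - 1 + a*u) \<in> O[at_right 0](\<lambda>u. u^2)"
    by real_asymp
  then obtain C where C: "C > 0" and
    ev: "\<forall>\<^sub>F u in at_right 0. norm ((1-u) powr a - 1 + a*u) \<le> C * norm (u^2)"
    by (auto elim: landau_o.bigE)
  from ev obtain b where b: "b > 0" and
    bound: "\<And>u. 0 < u \<Longrightarrow> u < b \<Longrightarrow> \<bar>(1-u) powr a - 1 + a*u\<bar> \<le> C * u^2"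
    unfolding eventually_at_right_field by (auto simp: abs_mult)
  define r where "r = min (b/2) (1/2)"
  have "r > 0" "r \<le> 1/2" "r < b" using b by (auto simp: r_def)
  then show ?thesis using C bound by (intro exI[of _ C] conjI exI[of _ r]) auto
qed

definition sqn :: "int ^ 'd::finite \<Rightarrow> real" where
  "sqn x = (\<Sum>i\<in>UNIV. (real_of_int (x $ i))\<^sup>2)"

definition step_avg :: "(int ^ 'd::finite \<Rightarrow> real) \<Rightarrow> int ^ 'd \<Rightarrow> real" where
  "step_avg f x = (\<Sum>i\<in>UNIV. f (x + axis i 1) + f (x + axis i (-1))) / (2 * real CARD('d))"

text \<open>With this exponent \<open>kern c x\<close> decays like |x|^(2-d), as the Green function
  of simple random walk does.\<close>

definition decay :: "'d::finite itself \<Rightarrow> real" where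
  "decay _ = (real CARD('d) - 2) / 2"

definition kern :: "real \<Rightarrow> int ^ 'd::finite \<Rightarrow> real" where
  "kern c x = (c + sqn x) powr (- decay TYPE('d))"

lemma sqn_nonneg: "sqn x \<ge> 0"
  by (simp add: sqn_def sum_nonneg)

lemma sqn_add_axis: "sqn (x + axis i e) = sqn x + 2 * real_of_int e * real_of_int (x $ i) + (real_of_int e)\<^sup>2"
proof -
  have "sqn (x + axis i e) = (\<Sum>j\<in>UNIV. (real_of_int (x $ j))\<^sup>2 +
      (if j = i then 2 * real_of_int e * real_of_int (x $ i) + (real_of_int e)\<^sup>2 else 0))"
    unfolding sqn_def by (intro sum.cong) (auto simp: axis_def power2_eq_square algebra_simps)
  also have "\<dots> = sqn x + (2 * real_of_int e * real_of_int (x $ i) + (real_of_int e)\<^sup>2)"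
    by (simp add: sum.distrib sqn_def)
  finally show ?thesis by simp
qed

lemma component_le_sqn: "(real_of_int (x $ i))\<^sup>2 \<le> sqn x"
  unfolding sqn_def by (rule member_le_sum) auto

lemma sum_squares_le_square_sum:
  fixes f :: "'a \<Rightarrow> real"
  assumes "finite A" "\<And>i. i \<in> A \<Longrightarrow> f i \<ge> 0"
  shows "(\<Sum>i\<in>A. (f i)\<^sup>2) \<le> (\<Sum>i\<in>A. f i)\<^sup>2"
proof -
  have "(\<Sum>i\<in>A. (f i)\<^sup>2) \<le> (\<Sum>i\<in>A. f i * (\<Sum>j\<in>A. f j))"
    unfolding power2_eq_square using assms by (intro sum_mono mult_left_mono member_le_sum) auto
  then show ?thesis by (simp add: power2_eq_square sum_distrib_right)
qed

text \<open>In the expansion around \<open>T = c + \<bar>x\<bar>\<^sup>2 + 1\<close> the second-order terms are those of the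
  Laplacian of \<open>\<bar>x\<bar>\<^sup>2\<^sup>-\<^sup>d\<close> and cancel up to \<open>\<alpha>(c + 1) / T\<^sup>2\<close>, so a large \<open>c\<close> beats the error.\<close>
lemma kern_superharmonic:
  assumes d3: "CARD('d::finite) \<ge> 3"
  shows "\<exists>c\<ge>1. \<exists>C\<ge>0. \<forall>x::int^'d.
    (c + 1 + sqn x) powr (- decay TYPE('d) - 2) \<le> kern c x - step_avg (kern c) x \<and>
    kern c x - step_avg (kern c) x \<le> C * (c + 1 + sqn x) powr (- decay TYPE('d) - 2)"
proof -
  define d where "d = real CARD('d)"
  define \<alpha> where "\<alpha> = decay TYPE('d)"
  have d: "d \<ge> 3" using d3 by (simp add: d_def)
  have \<alpha>: "\<alpha> > 0" and \<alpha>1: "\<alpha> + 1 = d / 2" using d by (auto simp: \<alpha>_def decay_def d_def field_simps)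
  obtain C1 r1 where C1: "C1 \<ge> 0" "r1 > 0" "r1 \<le> 1/2" and
    e1: "\<And>z. \<bar>z\<bar> \<le> r1 \<Longrightarrow> \<bar>(1+z) powr (-\<alpha>) + (1-z) powr (-\<alpha>) - 2 - (-\<alpha>)*(-\<alpha>-1)*z^2\<bar> \<le> C1 * z^4"
    using powr_second_difference_bound[of "-\<alpha>"] by blast
  obtain C2 r2 where C2: "C2 \<ge> 0" "r2 > 0" "r2 \<le> 1/2" and
    e2: "\<And>u. 0 < u \<Longrightarrow> u \<le> r2 \<Longrightarrow> \<bar>(1-u) powr (-\<alpha>) - 1 + (-\<alpha>)*u\<bar> \<le> C2 * u^2"
    using powr_first_order_bound[of "-\<alpha>"] by blast
  define D where "D = C2 + 8 * C1 / d"
  have D0: "D \<ge> 0" using C1 C2 d by (simp add: D_def)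
  \<comment> \<open>The entries give in turn: \<open>4 / r1^2\<close> keeps every \<open>z i\<close>
    within the range of \<open>e1\<close>, \<open>1 / r2\<close> keeps \<open>1/T\<close> within
    that of \<open>e2\<close>, and the last one lifts the leading coefficient
    \<open>\<alpha> * (c + 1)\<close> above the error constant by 1. There is no circularity, as
    \<open>D\<close> does not depend on \<open>c\<close>.\<close>
  define c where "c = max 1 (max (4 / r1\<^sup>2) (max (1 / r2) ((D + 1) / \<alpha>)))"
  have c: "c \<ge> 1" "c \<ge> 4 / r1\<^sup>2" "c \<ge> 1 / r2" "c \<ge> (D+1)/\<alpha>" by (auto simp: c_def)
  have cD: "\<alpha> * (c + 1) \<ge> D + 1" using c(4) \<alpha> by (simp add: field_simps)
  have main: "\<bar>(kern c x - step_avg (kern c) x) - (\<alpha> * (c+1)) * (c + 1 + sqn x) powr (-\<alpha>-2)\<bar>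
      \<le> D * (c + 1 + sqn x) powr (-\<alpha>-2)" for x :: "int^'d"
  proof -
    define s where "s = sqn x"
    \<comment> \<open>The neighbours of \<open>x\<close> satisfy c + |x +- e_i|^2 = T (1 +- z i),
      and \<open>x\<close> itself T (1 - 1/T), so that all the values of the kernel are expanded
      around the same \<open>T\<close>.\<close>
    define T where "T = c + 1 + s"
    define z where "z i = 2 * real_of_int (x $ i) / T" for i
    have s0: "s \<ge> 0" by (simp add: s_def sqn_nonneg)
    have T: "T \<ge> 2" "T > 0" using c s0 by (auto simp: T_def)
    have zsum: "(\<Sum>i\<in>UNIV. (z i)\<^sup>2) = 4 * s / T\<^sup>2"
      by (simp add: z_def s_def sqn_def power_divide power_mult_distrib sum_divide_distrib sum_distrib_left)
    have "s / T\<^sup>2 \<le> T / T\<^sup>2" using c by (intro divide_right_mono) (auto simp: T_def)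
    then have sT: "s / T\<^sup>2 \<le> 1 / T" using T by (simp add: power2_eq_square)
    have z_le: "\<bar>z i\<bar> \<le> r1" for i
    proof -
      have "(z i)\<^sup>2 \<le> (\<Sum>i\<in>UNIV. (z i)\<^sup>2)" by (rule member_le_sum) auto
      also have "\<dots> \<le> 4 / T" using zsum sT by simp
      also have "\<dots> \<le> 4 / c" using c s0 by (intro divide_left_mono) (auto simp: T_def)
      also have "\<dots> \<le> r1\<^sup>2" using c C1 by (simp add: field_simps)
      finally show ?thesis using C1 abs_le_square_iff[of "z i" r1] by simp
    qed
    have z4: "(\<Sum>i\<in>UNIV. (z i)^4) \<le> 16 / T\<^sup>2"
    proof -
      have "(\<Sum>i\<in>UNIV. (z i)^4) = (\<Sum>i\<in>UNIV. ((z i)\<^sup>2)\<^sup>2)" by simp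
      also have "\<dots> \<le> (4 * s / T\<^sup>2)\<^sup>2" unfolding zsum[symmetric] by (intro sum_squares_le_square_sum) auto
      also have "\<dots> = 16 * (s / T\<^sup>2)\<^sup>2" by (simp add: power_mult_distrib power_divide)
      also have "\<dots> \<le> 16 * (1 / T)\<^sup>2" using sT s0 T by (intro mult_left_mono power_mono) auto
      finally show ?thesis by (simp add: power_divide)
    qed
    define B where "B = (\<Sum>i\<in>UNIV. (1 + z i) powr (-\<alpha>) + (1 - z i) powr (-\<alpha>))"
    have B: "\<bar>B - (2 * d + \<alpha> * (\<alpha> + 1) * (4 * s / T\<^sup>2))\<bar> \<le> 16 * C1 / T\<^sup>2"
    proof -
      have "B - (2 * d + \<alpha> * (\<alpha> + 1) * (4 * s / T\<^sup>2)) =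
          (\<Sum>i\<in>UNIV. (1 + z i) powr (-\<alpha>) + (1 - z i) powr (-\<alpha>) - 2 - (-\<alpha>)*(-\<alpha>-1)*(z i)^2)"
        unfolding zsum[symmetric] B_def
        by (simp add: sum.distrib sum_subtractf d_def sum_distrib_left algebra_simps)
      also have "\<bar>\<dots>\<bar> \<le> (\<Sum>i\<in>UNIV. C1 * (z i)^4)"
        by (rule order.trans[OF sum_abs]) (intro sum_mono e1 z_le)
      also have "\<dots> = C1 * (\<Sum>i\<in>UNIV. (z i)^4)" by (simp add: sum_distrib_left)
      also have "\<dots> \<le> C1 * (16 / T\<^sup>2)" using z4 C1 by (intro mult_left_mono) auto
      finally show ?thesis by (simp add: mult.commute)
    qed
    have zi: "1 + z i \<ge> 0" "1 - z i \<ge> 0" for i using z_le[of i] C1 by auto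
    have plus: "kern c (x + axis i 1) = T powr (-\<alpha>) * (1 + z i) powr (-\<alpha>)" for i
    proof -
      have "c + sqn (x + axis i 1) = T * (1 + z i)"
        using T by (simp add: sqn_add_axis z_def T_def s_def field_simps)
      then show ?thesis using T zi by (simp add: kern_def \<alpha>_def[symmetric] powr_mult)
    qed
    have minus: "kern c (x + axis i (-1)) = T powr (-\<alpha>) * (1 - z i) powr (-\<alpha>)" for i
    proof -
      have "c + sqn (x + axis i (-1)) = T * (1 - z i)"
        using T by (simp add: sqn_add_axis z_def T_def s_def field_simps)
      then show ?thesis using T zi by (simp add: kern_def \<alpha>_def[symmetric] powr_mult)
    qed
    have avg: "step_avg (kern c) x = T powr (-\<alpha>) * (B / (2 * d))"
      unfolding step_avg_def plus minus B_def d_def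
      by (simp add: sum_distrib_left distrib_left)
    define A where "A = (1 - 1/T) powr (-\<alpha>)"
    have uT: "1 / T \<le> r2"
    proof -
      have "1 / T \<le> 1 / c" using c s0 by (intro divide_left_mono) (auto simp: T_def)
      also have "\<dots> \<le> r2" using c C2 by (simp add: field_simps)
      finally show ?thesis .
    qed
    have A: "\<bar>A - (1 + \<alpha> / T)\<bar> \<le> C2 / T\<^sup>2"
      using e2[of "1/T"] T uT unfolding A_def by (simp add: power_divide algebra_simps)
    have k: "kern c x = T powr (-\<alpha>) * A"
    proof -
      have "c + sqn x = T * (1 - 1/T)" using T by (simp add: T_def s_def field_simps)
      then show ?thesis using T by (simp add: kern_def \<alpha>_def[symmetric] powr_mult A_def)
    qed
    \<comment> \<open>The triangle inequality with all products and quotients abstracted to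
      variables, so that only linear arithmetic remains.\<close>
    have combine: "\<bar>A - (1 + p)\<bar> \<le> e1 \<Longrightarrow> y = q \<Longrightarrow> \<bar>B / (2 * d) - (1 + y)\<bar> \<le> e2 \<Longrightarrow> p - q = r
      \<Longrightarrow> E = e1 + e2 \<Longrightarrow> \<bar>(A - B / (2 * d)) - r\<bar> \<le> E" for p q y r E e1 e2
      by linarith
    \<comment> \<open>The choice of the exponent enters here: \<open>\<alpha> + 1 = d / 2\<close>
      cancels the dimension, and the second-order term becomes comparable with the first-order term
      \<open>\<alpha> / T\<close>.\<close>
    have "\<alpha> * (\<alpha> + 1) * (4 * s / T\<^sup>2) / (2 * d) = \<alpha> * s / T\<^sup>2"
      unfolding \<alpha>1 using d by simp
    moreover have "\<bar>B / (2 * d) - (1 + \<alpha> * (\<alpha> + 1) * (4 * s / T\<^sup>2) / (2 * d))\<bar> \<le> 8 * C1 / d / T\<^sup>2"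
    proof -
      have abs: "\<bar>Y / (2 * d)\<bar> \<le> E / (2 * d)" if "\<bar>Y\<bar> \<le> E" for Y E
        using that d by (simp add: divide_right_mono)
      have div: "B / (2 * d) - (1 + Y / (2 * d)) = (B - (2 * d + Y)) / (2 * d)" for Y
        using d by (simp add: field_simps)
      have "B / (2 * d) - (1 + \<alpha> * (\<alpha> + 1) * (4 * s / T\<^sup>2) / (2 * d)) =
          (B - (2 * d + \<alpha> * (\<alpha> + 1) * (4 * s / T\<^sup>2))) / (2 * d)"
        by (rule div)
      also have "\<bar>\<dots>\<bar> \<le> (16 * C1 / T\<^sup>2) / (2 * d)"
        by (rule abs[OF B])
      also have "\<dots> = 8 * C1 / d / T\<^sup>2" using d by (simp add: field_simps)
      finally show ?thesis .
    qed
    moreover have "\<alpha> / T - \<alpha> * s / T\<^sup>2 = \<alpha> * (c + 1) / T\<^sup>2"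
    proof -
      have "\<alpha> / T - \<alpha> * s / T\<^sup>2 = (\<alpha> * T - \<alpha> * s) / T\<^sup>2"
        using T by (simp add: diff_divide_distrib power2_eq_square)
      then show ?thesis by (simp add: T_def algebra_simps)
    qed
    moreover have "D / T\<^sup>2 = C2 / T\<^sup>2 + 8 * C1 / d / T\<^sup>2" by (simp add: D_def add_divide_distrib)
    ultimately have AB: "\<bar>(A - B / (2 * d)) - \<alpha> * (c + 1) / T\<^sup>2\<bar> \<le> D / T\<^sup>2"
      using combine[OF A] by blast
    have T2: "T powr (-\<alpha>-2) = T powr (-\<alpha>) / T\<^sup>2"
      using T by (simp add: powr_diff powr_realpow[symmetric] del: powr_numeral)
    have "(kern c x - step_avg (kern c) x) - (\<alpha> * (c+1)) * T powr (-\<alpha>-2)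
        = T powr (-\<alpha>) * ((A - B / (2 * d)) - \<alpha> * (c + 1) / T\<^sup>2)"
      unfolding avg k T2 by (simp add: algebra_simps)
    also have "\<bar>\<dots>\<bar> \<le> T powr (-\<alpha>) * (D / T\<^sup>2)" 
      unfolding abs_mult abs_of_nonneg[OF powr_ge_zero] by (intro mult_left_mono AB) simp
    also have "\<dots> = D * T powr (-\<alpha>-2)" by (simp add: T2)
    finally show ?thesis by (simp add: T_def s_def)
  qed
  have "(c + 1 + sqn x) powr (-\<alpha> - 2) \<le> kern c x - step_avg (kern c) x \<and>
    kern c x - step_avg (kern c) x \<le> (\<alpha> * (c + 1) + D) * (c + 1 + sqn x) powr (-\<alpha> - 2)" for x :: "int^'d"
  proof -
    define q where "q = (c + 1 + sqn x) powr (-\<alpha>-2)"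
    have q: "q \<ge> 0" by (simp add: q_def)
    have "(\<alpha> * (c + 1) - D) * q \<ge> 1 * q" using q cD by (intro mult_right_mono) auto
    then show ?thesis using main[of x] unfolding q_def[symmetric] by (simp add: algebra_simps abs_le_iff)
  qed
  moreover have "\<alpha> * (c + 1) + D \<ge> 0" using \<alpha> c D0 by simp
  ultimately show ?thesis using c(1) unfolding \<alpha>_def by blast
qed

section \<open>Three-point inequality and finiteness of the superlevel sets\<close>

lemma sqn_add_le: "sqn (a + b) \<le> 2 * sqn a + 2 * sqn b"
proof -
  have "sqn (a + b) \<le> (\<Sum>i\<in>UNIV. 2 * (real_of_int (a $ i))\<^sup>2 + 2 * (real_of_int (b $ i))\<^sup>2)"
    unfolding sqn_def
  proof (rule sum_mono)
    fix i
    have "0 \<le> (real_of_int (a $ i) - real_of_int (b $ i))\<^sup>2" by simp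
    then show "(real_of_int ((a + b) $ i))\<^sup>2 \<le> 2 * (real_of_int (a $ i))\<^sup>2 + 2 * (real_of_int (b $ i))\<^sup>2"
      by (simp add: power2_eq_square algebra_simps)
  qed
  then show ?thesis by (simp add: sqn_def sum.distrib sum_distrib_left)
qed

lemma kern_pos: "c \<ge> 1 \<Longrightarrow> kern c x > 0"
  using sqn_nonneg[of x] by (simp add: kern_def)

text \<open>The longer of the two vectors controls the sum: c + |a+b|^2 is at most 4 times its
  shifted squared norm, so the smaller of the two kernel values is at most a constant times
  \<open>kern c (a + b)\<close>. The remaining factor is bounded by the sum of both. For Green
  functions this is known as the 3G inequality.\<close>

lemma kern_three_point:
  assumes d3: "CARD('d::finite) \<ge> 3" and c: "c \<ge> 1"
  shows "kern c a * kern c b \<le> 4 powr decay TYPE('d) * kern c (a + b) * (kern c a + kern c (b::int^'d))"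
proof -
  define \<alpha> where "\<alpha> = decay TYPE('d)"
  have \<alpha>: "\<alpha> > 0" using d3 by (auto simp: \<alpha>_def decay_def)
  have *: "kern c b \<le> 4 powr \<alpha> * kern c (a + b)" if "sqn a \<le> sqn b" for a b :: "int^'d"
  proof -
    have "c + sqn (a + b) \<le> 4 * (c + sqn b)" using sqn_add_le[of a b] that c by simp
    then have "(4 * (c + sqn b)) powr (-\<alpha>) \<le> (c + sqn (a + b)) powr (-\<alpha>)"
      using \<alpha> c sqn_nonneg[of "a+b"] by (intro powr_mono2') auto
    then have "4 powr (-\<alpha>) * kern c b \<le> kern c (a + b)"
      using c sqn_nonneg[of b] by (subst (asm) powr_mult) (auto simp: kern_def \<alpha>_def)
    then have "4 powr \<alpha> * (4 powr (-\<alpha>) * kern c b) \<le> 4 powr \<alpha> * kern c (a + b)"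
      by (intro mult_left_mono) auto
    then show ?thesis by (simp add: powr_minus field_simps)
  qed
  have pos: "kern c a > 0" "kern c b > 0" "kern c (a+b) > 0" using kern_pos[OF c] by auto
  show ?thesis
  proof (cases "sqn a \<le> sqn b")
    case True
    have "kern c a * kern c b \<le> kern c a * (4 powr \<alpha> * kern c (a + b))"
      using *[OF True] pos by (intro mult_left_mono) auto
    also have "\<dots> \<le> 4 powr \<alpha> * kern c (a + b) * (kern c a + kern c b)"
      using pos by (simp add: algebra_simps)
    finally show ?thesis by (simp add: \<alpha>_def)
  next
    case False
    have "kern c a * kern c b \<le> (4 powr \<alpha> * kern c (a + b)) * kern c b"
      using *[of b a] False pos by (intro mult_right_mono) (auto simp: add.commute)
    also have "\<dots> \<le> 4 powr \<alpha> * kern c (a + b) * (kern c a + kern c b)"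
      using pos by (simp add: algebra_simps)
    finally show ?thesis by (simp add: \<alpha>_def)
  qed
qed

lemma finite_sqn_le: "finite {x::int^'d::finite. sqn x \<le> R}"
proof -
  define n where "n = \<lceil>max 1 R\<rceil>"
  have "{x::int^'d. sqn x \<le> R} \<subseteq> (\<lambda>f. \<chi> i. f i) ` (PiE UNIV (\<lambda>_. {-n..n}))"
  proof
    fix x :: "int^'d" assume x: "x \<in> {x. sqn x \<le> R}"
    have "x $ i \<in> {-n..n}" for i
    proof -
      have "(real_of_int (x $ i))\<^sup>2 \<le> max 1 R" using component_le_sqn[of x i] x by auto
      also have "\<dots> \<le> (max 1 R)\<^sup>2" by (simp add: power2_eq_square mult_le_cancel_right1)
      finally have "\<bar>real_of_int (x $ i)\<bar> \<le> max 1 R" using abs_le_square_iff[of "real_of_int (x $ i)" "max 1 R"] by auto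
      then have "\<bar>real_of_int (x $ i)\<bar> \<le> real_of_int n" unfolding n_def by linarith
      then show ?thesis by (simp add: abs_le_iff)
    qed
    then show "x \<in> (\<lambda>f. \<chi> i. f i) ` (PiE UNIV (\<lambda>_. {-n..n}))"
      by (intro image_eqI[of _ _ "\<lambda>i. x $ i"]) auto
  qed
  moreover have "finite ((\<lambda>f. \<chi> i. f i) ` (PiE (UNIV::'d set) (\<lambda>_. {-n..n})))"
    by (intro finite_imageI finite_PiE) auto
  ultimately show ?thesis by (rule finite_subset)
qed

text \<open>Decay at infinity in the form that the telescoping argument uses: outside a finite set
  the kernel is below any given level.\<close>

lemma finite_kern_ge:
  assumes d3: "CARD('d::finite) \<ge> 3" and "c \<ge> 1" "e > 0"
  shows "finite {x::int^'d. kern c x \<ge> e}"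
proof -
  define \<alpha> where "\<alpha> = decay TYPE('d)"
  have \<alpha>: "\<alpha> > 0" using d3 by (auto simp: \<alpha>_def decay_def)
  have "sqn x \<le> e powr (-1/\<alpha>)" if "kern c x \<ge> e" for x :: "int^'d"
  proof -
    have t: "c + sqn x > 0" using assms sqn_nonneg[of x] by simp
    have "kern c x powr (-1/\<alpha>) \<le> e powr (-1/\<alpha>)"
      using that assms \<alpha> by (intro powr_mono2') auto
    moreover have "kern c x powr (-1/\<alpha>) = c + sqn x"
      using \<alpha> t by (simp add: kern_def \<alpha>_def[symmetric] powr_powr)
    ultimately show ?thesis using assms by simp
  qed
  then show ?thesis by (intro finite_subset[OF _ finite_sqn_le[of "e powr (-1/\<alpha>)"]]) auto
qed

section \<open>Convolution and the Green operator\<close>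

text \<open>Values in \<open>ennreal\<close> allow sums to be exchanged without summability
  conditions; kernels are translation invariant and thus given by one function.\<close>

definition conv :: "('a::ab_group_add \<Rightarrow> ennreal) \<Rightarrow> ('a \<Rightarrow> ennreal) \<Rightarrow> 'a \<Rightarrow> ennreal" where
  "conv f h = (\<lambda>x. \<integral>\<^sup>+ y. f (x - y) * h y \<partial>count_space UNIV)"

lemma nn_integral_count_space_reindex:
  "bij g \<Longrightarrow> (\<integral>\<^sup>+ y. f y \<partial>count_space UNIV) = (\<integral>\<^sup>+ y. f (g y) \<partial>count_space UNIV)"
  by (rule nn_integral_bij_count_space[symmetric])

lemma nn_integral_count_space_swap:
  "(\<integral>\<^sup>+ x. \<integral>\<^sup>+ y. f x y \<partial>count_space UNIV \<partial>count_space UNIV) =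
   (\<integral>\<^sup>+ y. \<integral>\<^sup>+ x. f x y \<partial>count_space UNIV \<partial>count_space UNIV)"
  using nn_integral_fst_count_space[of "case_prod f"] nn_integral_snd_count_space[of "case_prod f"]
  by simp

lemma bij_diff_left: "bij (\<lambda>y. x - y :: 'a::ab_group_add)"
  by (rule bij_betw_byWitness[where f' = "\<lambda>y. x - y"]) auto

lemma bij_diff_right: "bij (\<lambda>y. y - x :: 'a::ab_group_add)"
  by (rule bij_betw_byWitness[where f' = "\<lambda>y. y + x"]) auto

lemma bij_add_left: "bij (\<lambda>y. x + y :: 'a::ab_group_add)"
  by (rule bij_betw_byWitness[where f' = "\<lambda>y. y - x"]) auto

lemma conv_commute: "conv f h = conv h f"
proof
  fix x
  show "conv f h x = conv h f x"
    unfolding conv_def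
    by (subst nn_integral_count_space_reindex[OF bij_diff_left[of x]]) (simp add: mult.commute)
qed

lemma conv_assoc: "conv f (conv g h) = conv (conv f g) h"
proof
  fix x
  have "conv f (conv g h) x = (\<integral>\<^sup>+ y. \<integral>\<^sup>+ z. f (x - y) * (g (y - z) * h z) \<partial>count_space UNIV \<partial>count_space UNIV)"
    by (simp add: conv_def nn_integral_cmult)
  also have "\<dots> = (\<integral>\<^sup>+ z. \<integral>\<^sup>+ y. f (x - y) * (g (y - z) * h z) \<partial>count_space UNIV \<partial>count_space UNIV)"
    by (rule nn_integral_count_space_swap)
  also have "\<dots> = (\<integral>\<^sup>+ z. (\<integral>\<^sup>+ y. f (x - y) * g (y - z) \<partial>count_space UNIV) * h z \<partial>count_space UNIV)"
    by (simp add: nn_integral_multc[symmetric] mult.assoc)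
  also have "(\<lambda>z. (\<integral>\<^sup>+ y. f (x - y) * g (y - z) \<partial>count_space UNIV) * h z) = (\<lambda>z. conv f g (x - z) * h z)"
  proof
    fix z
    show "(\<integral>\<^sup>+ y. f (x - y) * g (y - z) \<partial>count_space UNIV) * h z = conv f g (x - z) * h z"
      unfolding conv_def
      by (subst nn_integral_count_space_reindex[OF bij_diff_right[of z], of "\<lambda>y. f (x - z - y) * g y"])
        (simp add: algebra_simps)
  qed
  finally show "conv f (conv g h) x = conv (conv f g) h x" by (simp add: conv_def)
qed

lemma conv_left_commute: "conv f (conv g h) = conv g (conv f h)"
  by (metis conv_assoc conv_commute)

lemma conv_mono: "(\<And>x. f x \<le> f' x) \<Longrightarrow> (\<And>x. h x \<le> h' x) \<Longrightarrow> conv f h x \<le> conv f' h' x"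
  unfolding conv_def by (intro nn_integral_mono mult_mono) auto

lemma conv_mono_right: "(\<And>x. h x \<le> h' x) \<Longrightarrow> conv f h x \<le> conv f h' x"
  by (rule conv_mono) auto

lemma conv_mono_left: "(\<And>x. h x \<le> h' x) \<Longrightarrow> conv h f x \<le> conv h' f x"
  by (rule conv_mono) auto

lemma conv_add_right: "conv f (\<lambda>x. g x + h x) x = conv f g x + conv f h x"
  by (simp add: conv_def distrib_left nn_integral_add)

lemma conv_add_left: "conv (\<lambda>x. g x + h x) f x = conv g f x + conv h f x"
  by (simp add: conv_def distrib_right nn_integral_add)

lemma conv_cmult_right: "conv f (\<lambda>x. c * g x) x = c * conv f g x"
  by (simp add: conv_def nn_integral_cmult[symmetric] mult.left_commute)

lemma conv_cmult_left: "conv (\<lambda>x. c * g x) f x = c * conv g f x"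
  by (simp add: conv_def nn_integral_cmult[symmetric] mult.assoc)

lemma conv_suminf_right: "conv f (\<lambda>x. \<Sum>n. g n x) x = (\<Sum>n. conv f (g n) x)"
  unfolding conv_def by (simp add: nn_integral_suminf[symmetric])

lemma conv_delta: "conv (indicator {0}) h = h"
proof
  fix x
  have "conv (indicator {0}) h x = (\<integral>\<^sup>+ y. h x * indicator {x} y \<partial>count_space UNIV)"
    unfolding conv_def by (intro nn_integral_cong) (auto split: split_indicator)
  also have "\<dots> = h x" by (simp add: nn_integral_cmult_indicator)
  finally show "conv (indicator {0}) h x = h x" .
qed

text \<open>Young's inequality for a summable and a bounded function.\<close>

lemma conv_le_const:
  assumes "\<And>x. h x \<le> c"
  shows "conv f h x \<le> (\<integral>\<^sup>+ y. f y \<partial>count_space UNIV) * c"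
proof -
  have "conv f h x \<le> (\<integral>\<^sup>+ y. f (x - y) * c \<partial>count_space UNIV)"
    unfolding conv_def using assms by (intro nn_integral_mono mult_left_mono) auto
  also have "\<dots> = (\<integral>\<^sup>+ y. f (x - y) \<partial>count_space UNIV) * c" by (simp add: nn_integral_multc)
  also have "(\<integral>\<^sup>+ y. f (x - y) \<partial>count_space UNIV) = (\<integral>\<^sup>+ y. f y \<partial>count_space UNIV)"
    by (rule nn_integral_count_space_reindex[OF bij_diff_left[of x], symmetric])
  finally show ?thesis .
qed

section \<open>The step law of simple random walk and its Green operator\<close>

definition stepk :: "int ^ 'd::finite \<Rightarrow> ennreal" where
  "stepk x = ennreal (pmf step_pmf x)"

lemma nbrs_eq: "nbrs = (\<lambda>i. axis i (1::int)) ` UNIV \<union> (\<lambda>i. axis i (-1)) ` UNIV"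
  by (auto simp: nbrs_def)

lemma finite_nbrs: "finite (nbrs :: (int^'d::finite) set)"
  unfolding nbrs_eq by auto

lemma nbrs_nonempty: "(nbrs :: (int^'d::finite) set) \<noteq> {}"
  unfolding nbrs_eq by auto

lemma sum_nbrs:
  fixes f :: "int^'d::finite \<Rightarrow> 'b::comm_monoid_add"
  shows "(\<Sum>v\<in>nbrs. f v) = (\<Sum>i\<in>UNIV. f (axis i 1) + f (axis i (-1)))"
proof -
  have "range (\<lambda>i::'d. axis i (1::int)) \<inter> range (\<lambda>i. axis i (-1)) = {}"
    by (auto simp: axis_eq_axis)
  moreover have "inj (\<lambda>i::'d. axis i (1::int))" "inj (\<lambda>i::'d. axis i (-1::int))"
    by (auto simp: inj_on_def axis_eq_axis)
  ultimately show ?thesis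
    unfolding nbrs_eq by (subst sum.union_disjoint) (auto simp: sum.reindex sum.distrib)
qed

lemma card_nbrs: "card (nbrs :: (int^'d::finite) set) = 2 * CARD('d)"
  using sum_nbrs[of "\<lambda>_::int^'d. 1::nat"] by simp

lemma uminus_nbrs: "- v \<in> nbrs \<longleftrightarrow> v \<in> nbrs"
proof -
  have "axis i (-1) = - axis i (1::int)" for i :: 'a by (simp add: vec_eq_iff axis_def)
  then show ?thesis unfolding nbrs_def mem_Collect_eq by (metis minus_minus)
qed

lemma stepk_uminus: "stepk (- v) = stepk v"
  by (simp add: stepk_def step_pmf_def finite_nbrs nbrs_nonempty indicator_def uminus_nbrs)

text \<open>The step law is symmetric, so the convolution averages over \<open>x + e\<close> just as
  well as over \<open>x - e\<close>. This ties the operator to the walk.\<close>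

lemma conv_stepk: "conv stepk f x = (\<integral>\<^sup>+ e. f (x + e) \<partial>measure_pmf step_pmf)"
proof -
  have "conv stepk f x = (\<integral>\<^sup>+ e. stepk (x - (x + e)) * f (x + e) \<partial>count_space UNIV)"
    unfolding conv_def by (rule nn_integral_count_space_reindex[OF bij_add_left])
  also have "\<dots> = (\<integral>\<^sup>+ e. stepk e * f (x + e) \<partial>count_space UNIV)"
    by (simp add: stepk_uminus)
  finally show ?thesis by (simp add: nn_integral_measure_pmf stepk_def)
qed

lemma conv_stepk_ennreal:
  assumes "\<And>x. f x \<ge> 0"
  shows "conv stepk (\<lambda>x. ennreal (f x)) x = ennreal (step_avg f x)"
proof -
  have "conv stepk (\<lambda>x. ennreal (f x)) x = (\<Sum>v\<in>nbrs. ennreal (f (x + v))) / card (nbrs :: (int^'a) set)"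
    unfolding conv_stepk step_pmf_def by (rule nn_integral_pmf_of_set) (auto simp: finite_nbrs nbrs_nonempty)
  also have "(\<Sum>v\<in>nbrs. ennreal (f (x + v))) = ennreal (\<Sum>v\<in>nbrs. f (x + v))"
    using assms by (simp add: sum_ennreal)
  also have "\<dots> / card (nbrs :: (int^'a) set) = ennreal ((\<Sum>v\<in>nbrs. f (x + v)) / card (nbrs :: (int^'a) set))"
    unfolding ennreal_of_nat_eq_real_of_nat
    using assms by (intro divide_ennreal sum_nonneg) (auto simp: card_nbrs)
  finally show ?thesis by (simp add: step_avg_def sum_nbrs card_nbrs)
qed

lemma conv_stepk_const: "conv stepk (\<lambda>_. c) x = c"
  by (simp add: conv_stepk measure_pmf.emeasure_space_1)

lemma conv_stepk_one_plus: "conv stepk (\<lambda>x. 1 + f x) x = 1 + conv stepk f x"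
  using conv_add_right[of stepk "\<lambda>_. 1" f x] by (simp add: conv_stepk_const)

text \<open>The walk may retrace its first step, so it is back after two steps with probability
  1/(2d). The lemma removes the two surplus step operators from the lower bound on
  \<open>G\<close>.\<close>

lemma conv_stepk_twice_ge: "f x \<le> ennreal (2 * real CARD('d)) * conv stepk (conv stepk f) (x::int^'d::finite)"
proof -
  define n where "n = ennreal (2 * real CARD('d))"
  have 1: "stepk v = ennreal (1 / (2 * real CARD('d)))" if "v \<in> nbrs" for v :: "int^'d"
    using that by (simp add: stepk_def step_pmf_def finite_nbrs nbrs_nonempty card_nbrs)
  have c1: "(\<Sum>v\<in>nbrs. stepk (v::int^'d) * stepk v) = ennreal (1 / (2 * real CARD('d)))"
  proof -
    have "(\<Sum>v\<in>nbrs. stepk (v::int^'d) * stepk v) = (\<Sum>v\<in>(nbrs::(int^'d) set). ennreal ((1 / (2 * real CARD('d))) * (1 / (2 * real CARD('d)))))"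
      using 1 by (intro sum.cong refl) (subst ennreal_mult, auto)
    also have "\<dots> = ennreal (\<Sum>v\<in>(nbrs::(int^'d) set). (1 / (2 * real CARD('d))) * (1 / (2 * real CARD('d))))"
      by (rule sum_ennreal) auto
    finally show ?thesis by (simp add: card_nbrs)
  qed
  have "conv stepk stepk (0::int^'d) = (\<integral>\<^sup>+ e. stepk (e::int^'d) * stepk e \<partial>count_space UNIV)"
    by (simp add: conv_def stepk_uminus)
  also have "\<dots> \<ge> (\<integral>\<^sup>+ e. stepk (e::int^'d) * stepk e * indicator nbrs e \<partial>count_space UNIV)"
    by (intro nn_integral_mono) (auto split: split_indicator)
  also have "(\<integral>\<^sup>+ e. stepk (e::int^'d) * stepk e * indicator nbrs e \<partial>count_space UNIV) = (\<Sum>v\<in>nbrs. stepk (v::int^'d) * stepk v)"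
    by (subst nn_integral_count_space_indicator[symmetric]) (auto simp: nn_integral_count_space_finite finite_nbrs)
  finally have p0: "ennreal (1 / (2 * real CARD('d))) \<le> conv stepk stepk (0::int^'d)" by (simp add: c1)
  have "ennreal (1 / (2 * real CARD('d))) * f x \<le> conv stepk stepk (x - x) * f x"
    using p0 by (intro mult_right_mono) auto
  also have "\<dots> = (\<integral>\<^sup>+ y. conv stepk stepk (x - y) * f y * indicator {x} y \<partial>count_space UNIV)"
    by (simp add: nn_integral_indicator_singleton)
  also have "\<dots> \<le> conv (conv stepk stepk) f x"
    unfolding conv_def[of "conv stepk stepk"] by (intro nn_integral_mono) (auto split: split_indicator)
  finally have "n * (ennreal (1 / (2 * real CARD('d))) * f x) \<le> n * conv stepk (conv stepk f) x"
    by (intro mult_left_mono) (auto simp: conv_assoc)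
  moreover have "n * ennreal (1 / (2 * real CARD('d))) = 1"
    unfolding n_def by (subst ennreal_mult''[symmetric]) auto
  ultimately show ?thesis by (simp add: mult.assoc[symmetric] n_def)
qed

definition green :: "(int ^ 'd::finite \<Rightarrow> ennreal) \<Rightarrow> int ^ 'd \<Rightarrow> ennreal" where
  "green f x = (\<Sum>n. (conv stepk ^^ n) f x)"

lemma conv_pow_commute: "(conv stepk ^^ n) (conv h f) = conv h ((conv stepk ^^ n) f)"
  by (induction n) (auto simp: conv_left_commute[of stepk h])

lemma green_conv: "green (conv h f) = conv h (green f)"
  unfolding green_def fun_eq_iff conv_suminf_right conv_pow_commute by (simp add: fun_eq_iff)

lemma conv_pow_mono: "(\<And>x. f x \<le> g x) \<Longrightarrow> (conv stepk ^^ n) f x \<le> (conv stepk ^^ n) g x"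
  by (induction n arbitrary: x) (auto intro!: conv_mono_right)

lemma conv_pow_add: "(conv stepk ^^ n) (\<lambda>x. f x + g x) x = (conv stepk ^^ n) f x + (conv stepk ^^ n) g x"
proof (induction n arbitrary: x)
  case (Suc n)
  then have "(conv stepk ^^ n) (\<lambda>x. f x + g x) = (\<lambda>x. (conv stepk ^^ n) f x + (conv stepk ^^ n) g x)" by (intro ext)
  then show ?case by (simp add: conv_add_right)
qed simp

lemma conv_pow_cmult: "(conv stepk ^^ n) (\<lambda>x. c * f x) x = c * (conv stepk ^^ n) f x"
proof (induction n arbitrary: x)
  case (Suc n)
  then have "(conv stepk ^^ n) (\<lambda>x. c * f x) = (\<lambda>x. c * (conv stepk ^^ n) f x)" by (intro ext)
  then show ?case by (simp add: conv_cmult_right)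
qed simp

lemma conv_pow_const: "(conv stepk ^^ n) (\<lambda>_. c) (x::int^'d::finite) = c"
proof (induction n arbitrary: x)
  case (Suc n)
  then have "(conv stepk ^^ n) (\<lambda>_::int^'d. c) = (\<lambda>_. c)" by (intro ext)
  then show ?case by (simp add: conv_stepk_const)
qed simp

section \<open>Summability over the lattice\<close>

lemma nn_integral_int_powr_finite:
  assumes "b > 1/2"
  shows "(\<integral>\<^sup>+ n. ennreal ((1 + (real_of_int n)\<^sup>2) powr (-b)) \<partial>count_space UNIV) < \<infinity>"
proof -
  define f where "f x = ennreal ((1 + x\<^sup>2) powr (-b))" for x :: real
  have summable: "summable (\<lambda>n. (1 + (real n)\<^sup>2) powr (-b))"
  proof (rule summable_comparison_test_ev)
    show "summable (\<lambda>n. real n powr (- 2 * b))" using assms by (simp add: summable_real_powr_iff)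
    show "\<forall>\<^sub>F n in sequentially. norm ((1 + (real n)\<^sup>2) powr (-b)) \<le> real n powr (-2 * b)"
    proof (rule eventually_sequentiallyI[of 1])
      fix n :: nat assume n: "n \<ge> 1"
      have "(1 + (real n)\<^sup>2) powr (-b) \<le> ((real n)\<^sup>2) powr (-b)"
        using assms n by (intro powr_mono2') auto
      also have "\<dots> = real n powr (-2 * b)"
        using n by (simp add: powr_realpow[symmetric] powr_powr del: powr_numeral)
      finally show "norm ((1 + (real n)\<^sup>2) powr (-b)) \<le> real n powr (-2 * b)" by simp
    qed
  qed
  have nat: "(\<integral>\<^sup>+ n. f (real n) \<partial>count_space UNIV) < \<infinity>"
    unfolding nn_integral_count_space_nat f_def
    using summable by (subst suminf_ennreal2) auto
  \<comment> \<open>The integers are covered by the natural numbers and their negatives; 0 is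
    counted twice, hence an inequality.\<close>
  have "(\<integral>\<^sup>+ n. f (real_of_int n) \<partial>count_space UNIV) \<le>
     (\<integral>\<^sup>+ n. f (real_of_int n) * indicator (range int) n + f (real_of_int n) * indicator (range (\<lambda>n. - int n)) n \<partial>count_space UNIV)"
  proof (intro nn_integral_mono)
    fix n :: int
    have "n \<in> range int \<or> n \<in> range (\<lambda>n. - int n)"
      by (cases n rule: int_cases2) auto
    then show "f (real_of_int n) \<le> f (real_of_int n) * indicator (range int) n + f (real_of_int n) * indicator (range (\<lambda>n. - int n)) n"
      by (auto split: split_indicator)
  qed
  also have "\<dots> = (\<integral>\<^sup>+ n. f (real_of_int n) \<partial>count_space (range int)) + (\<integral>\<^sup>+ n. f (real_of_int n) \<partial>count_space (range (\<lambda>n. - int n)))"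
    by (simp add: nn_integral_add nn_integral_count_space_indicator[symmetric])
  also have "(\<integral>\<^sup>+ n. f (real_of_int n) \<partial>count_space (range int)) = (\<integral>\<^sup>+ n. f (real n) \<partial>count_space UNIV)"
    by (subst nn_integral_bij_count_space[symmetric, of int UNIV]) (auto simp: bij_betw_def inj_on_def)
  also have "(\<integral>\<^sup>+ n. f (real_of_int n) \<partial>count_space (range (\<lambda>n. - int n))) = (\<integral>\<^sup>+ n. f (real n) \<partial>count_space UNIV)"
    by (subst nn_integral_bij_count_space[symmetric, of "\<lambda>n. - int n" UNIV]) (auto simp: bij_betw_def inj_on_def f_def)
  finally show ?thesis using nat by (auto simp: f_def ennreal_add_eq_top less_top[symmetric] top_unique)
qed

text \<open>Instead of iterating Fubini over the coordinates, \<open>f\<close> is normalised to a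
  probability law on the integers. The product law has total mass 1, so the integral is the d-th
  power of the one-dimensional one.\<close>

lemma nn_integral_vec_prod:
  fixes f :: "int \<Rightarrow> real"
  assumes f: "\<And>n. f n > 0" and fin: "(\<integral>\<^sup>+ n. ennreal (f n) \<partial>count_space UNIV) < \<infinity>"
  shows "(\<integral>\<^sup>+ x. ennreal (\<Prod>i\<in>UNIV. f (x $ i)) \<partial>count_space (UNIV::(int^'d::finite) set)) < \<infinity>"
proof -
  define S where "S = enn2real (\<integral>\<^sup>+ n. ennreal (f n) \<partial>count_space UNIV)"
  have S: "ennreal S = (\<integral>\<^sup>+ n. ennreal (f n) \<partial>count_space UNIV)"
    using fin by (simp add: S_def less_top)
  have "ennreal (f 0) = (\<integral>\<^sup>+ n. ennreal (f n) * indicator {0} n \<partial>count_space UNIV)"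
    by (simp add: nn_integral_indicator_singleton)
  also have "\<dots> \<le> ennreal S" unfolding S by (intro nn_integral_mono) (auto split: split_indicator)
  finally have "S > 0" using f[of 0] by (cases "S > 0") (auto simp: ennreal_neg not_less)
  define q where "q = embed_pmf (\<lambda>n. f n / S)"
  have q: "pmf q n = f n / S" for n
    unfolding q_def
  proof (rule pmf_embed_pmf)
    show "f n / S \<ge> 0" for n using f[of n] \<open>S > 0\<close> by simp
    have "(\<integral>\<^sup>+ n. ennreal (f n / S) \<partial>count_space UNIV) = (\<integral>\<^sup>+ n. ennreal (f n) * ennreal (1 / S) \<partial>count_space UNIV)"
      using \<open>S > 0\<close> f by (intro nn_integral_cong) (auto simp: ennreal_mult'[symmetric] less_imp_le)
    also have "\<dots> = ennreal S * ennreal (1 / S)" by (simp add: nn_integral_multc S)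
    also have "\<dots> = 1" using \<open>S > 0\<close> by (subst ennreal_mult[symmetric]) auto
    finally show "(\<integral>\<^sup>+ n. ennreal (f n / S) \<partial>count_space UNIV) = 1" .
  qed
  define Q where "Q = map_pmf (\<lambda>g. (\<chi> i. g i) :: int^'d) (Pi_pmf UNIV undefined (\<lambda>_. q))"
  have inj: "inj (\<lambda>g. (\<chi> i. g i) :: int^'d)" by (auto simp: inj_on_def vec_eq_iff)
  have Q: "pmf Q x = (\<Prod>i\<in>UNIV. f (x $ i)) / S ^ CARD('d)" for x
  proof -
    have "pmf Q x = pmf Q (\<chi> i. (\<lambda>i. x $ i) i)" by simp
    also have "\<dots> = pmf (Pi_pmf UNIV undefined (\<lambda>_. q)) (\<lambda>i. x $ i)"
      unfolding Q_def by (rule pmf_map_inj'[OF inj])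
    also have "\<dots> = (\<Prod>i\<in>UNIV. pmf q (x $ i))" by (subst pmf_Pi) auto
    finally show ?thesis by (simp add: q prod_dividef)
  qed
  have "(\<integral>\<^sup>+ x. ennreal (\<Prod>i\<in>UNIV. f (x $ i)) \<partial>count_space (UNIV::(int^'d) set)) =
     (\<integral>\<^sup>+ x. ennreal (S ^ CARD('d)) * ennreal (pmf Q x) \<partial>count_space UNIV)"
    using \<open>S > 0\<close> by (intro nn_integral_cong) (simp add: Q ennreal_mult'[symmetric])
  also have "\<dots> = ennreal (S ^ CARD('d))" by (simp add: nn_integral_cmult nn_integral_pmf measure_pmf.emeasure_space_1)
  finally show ?thesis by simp
qed

text \<open>The exponent d/2 + 1 is split evenly among the d coordinates. Each receives b = 1/2 +
  1/d, just above the threshold of summability, and the base is bounded below by 1 plus the square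
  of that coordinate alone.\<close>

lemma nn_integral_sqn_powr_finite:
  assumes c: "c \<ge> 1"
  shows "(\<integral>\<^sup>+ x. ennreal ((c + 1 + sqn x) powr (- decay TYPE('d) - 2)) \<partial>count_space (UNIV::(int^'d::finite) set)) < \<infinity>"
proof -
  define b where "b = (real CARD('d) + 2) / (2 * real CARD('d))"
  have "b > 1/2" by (simp add: b_def field_simps)
  have e: "- decay TYPE('d) - 2 = - (b * real CARD('d))" by (simp add: decay_def b_def field_simps)
  have "(\<integral>\<^sup>+ x. ennreal ((c + 1 + sqn x) powr (- decay TYPE('d) - 2)) \<partial>count_space (UNIV::(int^'d) set))
      \<le> (\<integral>\<^sup>+ x. ennreal (\<Prod>i\<in>UNIV. (1 + (real_of_int (x $ i))\<^sup>2) powr (-b)) \<partial>count_space (UNIV::(int^'d) set))"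
  proof (intro nn_integral_mono ennreal_leI)
    fix x :: "int^'d"
    have T: "c + 1 + sqn x > 0" using c sqn_nonneg[of x] by simp
    have "(c + 1 + sqn x) powr (- decay TYPE('d) - 2) = (\<Prod>i\<in>(UNIV::'d set). (c + 1 + sqn x) powr (-b))"
      using T unfolding e by (simp add: powr_realpow[symmetric] powr_powr)
    also have "\<dots> \<le> (\<Prod>i\<in>UNIV. (1 + (real_of_int (x $ i))\<^sup>2) powr (-b))"
    proof (intro prod_mono conjI powr_mono2')
      fix i
      show "1 + (real_of_int (x $ i))\<^sup>2 \<le> c + 1 + sqn x" using c component_le_sqn[of x i] by simp
      show "1 + (real_of_int (x $ i))\<^sup>2 > 0" by (simp add: add_pos_nonneg)
    qed (use \<open>b > 1/2\<close> in auto)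
    finally show "(c + 1 + sqn x) powr (- decay TYPE('d) - 2) \<le> (\<Prod>i\<in>UNIV. (1 + (real_of_int (x $ i))\<^sup>2) powr (-b))" .
  qed
  also have "\<dots> < \<infinity>"
    by (rule nn_integral_vec_prod[OF _ nn_integral_int_powr_finite[OF \<open>b > 1/2\<close>]])
      (simp add: add_pos_nonneg less_imp_neq[symmetric])
  finally show ?thesis .
qed

text \<open>Telescoping gives \<open>k = (\<Sum>n<N. P\<^sup>n m) + P\<^sup>N k\<close> with \<open>m = k - P k\<close>; the remainder vanishes
  because \<open>k\<close> is small outside a finite set, on which \<open>m\<close> is bounded below.\<close>
lemma le_green_of_vanishing:
  fixes k m :: "int^'d::finite \<Rightarrow> real"
  assumes m: "\<And>x. m x > 0" "\<And>x. m x = k x - step_avg k x"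
    and k: "\<And>x. k x > 0" "\<And>e. e > 0 \<Longrightarrow> finite {x. k x \<ge> e}"
  shows "ennreal (k x) \<le> green (\<lambda>x. ennreal (m x)) x"
proof -
  define k' where "k' x = ennreal (k x)" for x
  define m' where "m' x = ennreal (m x)" for x
  have step: "k' = (\<lambda>x. m' x + conv stepk k' x)"
  proof
    fix x
    have "conv stepk k' x = ennreal (step_avg k x)"
      unfolding k'_def by (rule conv_stepk_ennreal) (use k in \<open>auto intro: less_imp_le\<close>)
    moreover have "step_avg k x \<ge> 0" unfolding step_avg_def using k by (intro divide_nonneg_nonneg sum_nonneg add_nonneg_nonneg) (auto intro: less_imp_le)
    ultimately show "k' x = m' x + conv stepk k' x"
      using m(1)[of x] m(2)[of x] by (simp add: k'_def m'_def ennreal_plus[symmetric] del: ennreal_plus)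
  qed
  have tele: "k' x = (\<Sum>n<N. (conv stepk ^^ n) m' x) + (conv stepk ^^ N) k' x" for N x
  proof (induction N)
    case (Suc N)
    have "(conv stepk ^^ N) k' x = (conv stepk ^^ N) m' x + (conv stepk ^^ N) (conv stepk k') x"
      by (subst step) (simp add: conv_pow_add)
    then show ?case using Suc by (simp add: add.assoc funpow_swap1)
  qed simp
  have green_le: "green m' x \<le> k' x" for x
    unfolding green_def using tele by (intro suminf_le_const summableI) (metis le_iff_add)
  have "k' x \<le> green m' x + ennreal e" if e: "e > 0" for e
  proof -
    define B where "B = {x. k x \<ge> e}"
    \<comment> \<open>The inserted 1 keeps the maximum defined when \<open>B\<close> is empty and
      makes \<open>C\<close> positive.\<close>
    define C where "C = Max (insert 1 ((\<lambda>y. k y / m y) ` B))"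
    have finB: "finite B" unfolding B_def using k(2)[OF e] .
    have C1: "C \<ge> 1" unfolding C_def using finB by (intro Max_ge) auto
    have bd: "k' y \<le> ennreal e + ennreal C * m' y" for y
    proof (cases "y \<in> B")
      case True
      have "k y / m y \<le> C" unfolding C_def using finB True by (intro Max_ge) auto
      then have "k y \<le> e + C * m y" using m(1)[of y] e by (simp add: field_simps)
      then have "ennreal (k y) \<le> ennreal (e + C * m y)" by (rule ennreal_leI)
      also have "\<dots> = ennreal e + ennreal C * m' y"
        using e C1 m(1)[of y] by (simp add: m'_def ennreal_mult'[symmetric] less_imp_le)
      finally show ?thesis by (simp add: k'_def)
    next
      case False
      then have "k' y \<le> ennreal e" unfolding k'_def B_def by (intro ennreal_leI) auto
      then show ?thesis by (simp add: add_increasing2)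
    qed
    have "k' x \<le> green m' x + ennreal e + ennreal C * (conv stepk ^^ N) m' x" for N
    proof -
      have "(conv stepk ^^ N) k' x \<le> (conv stepk ^^ N) (\<lambda>y. ennreal e + ennreal C * m' y) x"
        by (rule conv_pow_mono[OF bd])
      also have "\<dots> = ennreal e + ennreal C * (conv stepk ^^ N) m' x"
        by (simp add: conv_pow_add conv_pow_const conv_pow_cmult)
      finally have "k' x \<le> (\<Sum>n<N. (conv stepk ^^ n) m' x) + (ennreal e + ennreal C * (conv stepk ^^ N) m' x)"
        using tele[of x N] by (metis add_left_mono)
      also have "(\<Sum>n<N. (conv stepk ^^ n) m' x) \<le> green m' x"
        unfolding green_def by (intro sum_le_suminf summableI) auto
      finally show ?thesis by (simp add: add.assoc)
    qed
    \<comment> \<open>The Green series is bounded by \<open>k' x\<close> and therefore converges, so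
      its general term tends to 0.\<close>
    moreover have "(\<lambda>N. green m' x + ennreal e + ennreal C * (conv stepk ^^ N) m' x) \<longlonglongrightarrow> green m' x + ennreal e + ennreal C * 0"
    proof (intro tendsto_add tendsto_const ennreal_tendsto_cmult)
      have fin: "(\<Sum>n. (conv stepk ^^ n) m' x) \<noteq> top"
        using green_le[of x] unfolding green_def k'_def by (metis ennreal_less_top leD top.not_eq_extremum)
      then have each: "(conv stepk ^^ n) m' x \<noteq> top" for n
        using ennreal_suminf_lessD[of "\<lambda>n. (conv stepk ^^ n) m' x" top n] by (auto simp: less_top)
      define r where "r n = enn2real ((conv stepk ^^ n) m' x)" for n
      have r: "(conv stepk ^^ n) m' x = ennreal (r n)" "r n \<ge> 0" for n using each by (simp_all add: r_def less_top)
      have "summable r" using fin r by (intro summable_suminf_not_top) auto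
      then have "r \<longlonglongrightarrow> 0" by (rule summable_LIMSEQ_zero)
      then show "(\<lambda>N. (conv stepk ^^ N) m' x) \<longlonglongrightarrow> 0" unfolding r(1) by (metis ennreal_0 tendsto_ennrealI)
    qed auto
    ultimately have "k' x \<le> green m' x + ennreal e + ennreal C * 0"
      by (intro LIMSEQ_le_const[where X = "\<lambda>N. green m' x + ennreal e + ennreal C * (conv stepk ^^ N) m' x"]) auto
    then show ?thesis by simp
  qed
  then have "k' x \<le> green m' x" by (rule ennreal_le_epsilon) auto
  then show ?thesis by (simp add: k'_def m'_def[abs_def])
qed

text \<open>The interface through which the kernel is used from here on. Superharmonicity is stated
  with a point mass at the origin only: convolved with \<open>h\<close> it leaves a source
  \<open>c1 * h\<close>, which is all that the supersolutions consume. \<open>m\<close> is the full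
  defect of superharmonicity, and its summability lets \<open>k\<close> be traded for the Green
  operator.\<close>

theorem kernel_exists:
  assumes d3: "CARD('d::finite) \<ge> 3"
  shows "\<exists>(k :: int^'d \<Rightarrow> ennreal) c1 C M m. c1 > 0 \<and> C \<ge> 0 \<and> M \<ge> 0 \<and>
    (\<forall>x. k x < \<infinity>) \<and> (\<forall>x. k (- x) = k x) \<and>
    (\<forall>x. ennreal c1 * indicator {0} x + conv stepk k x \<le> k x) \<and>
    (\<forall>a b. k a * k b \<le> ennreal C * (k (a + b) * (k a + k b))) \<and>
    (\<forall>x. k x \<le> green m x) \<and> (\<integral>\<^sup>+ x. m x \<partial>count_space UNIV) \<le> ennreal M"
proof -
  obtain c C where c: "c \<ge> 1" and C: "C \<ge> 0" and
    b: "\<And>x::int^'d. (c + 1 + sqn x) powr (- decay TYPE('d) - 2) \<le> kern c x - step_avg (kern c) x"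
       "\<And>x::int^'d. kern c x - step_avg (kern c) x \<le> C * (c + 1 + sqn x) powr (- decay TYPE('d) - 2)"
    using kern_superharmonic[OF d3] by blast
  define m where "m x = kern c x - step_avg (kern c) x" for x :: "int^'d"
  define c1 where "c1 = (c + 1) powr (- decay TYPE('d) - 2)"
  define I where "I = (\<integral>\<^sup>+ x. ennreal ((c + 1 + sqn x) powr (- decay TYPE('d) - 2)) \<partial>count_space (UNIV::(int^'d) set))"
  have I: "I < \<infinity>" unfolding I_def by (rule nn_integral_sqn_powr_finite[OF c])
  have kp: "kern c x > 0" for x :: "int^'d" by (rule kern_pos[OF c])
  have T: "c + 1 + sqn x > 0" for x :: "int^'d" using c sqn_nonneg[of x] by simp
  have mp: "m x > 0" for x
    using b(1)[of x] T[of x] unfolding m_def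
    by (metis less_le_trans powr_gt_zero less_irrefl)
  have avg0: "step_avg (kern c) x \<ge> 0" for x :: "int^'d"
    unfolding step_avg_def using kp by (intro divide_nonneg_nonneg sum_nonneg add_nonneg_nonneg) (auto intro: less_imp_le)
  have avg: "conv stepk (\<lambda>x. ennreal (kern c x)) x = ennreal (step_avg (kern c) x)" for x :: "int^'d"
    by (rule conv_stepk_ennreal) (use kp in \<open>auto intro: less_imp_le\<close>)
  have "c1 > 0" using c by (simp add: c1_def)
  moreover have "kern c (- x) = kern c x" for x :: "int^'d" by (simp add: kern_def sqn_def)
  moreover have "ennreal c1 * indicator {0} x + conv stepk (\<lambda>x. ennreal (kern c x)) x \<le> ennreal (kern c x)" for x :: "int^'d"
  proof -
    have "c1 * indicator {0} x + step_avg (kern c) x \<le> kern c x"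
      using b(1)[of x] mp[of x] by (auto simp: m_def c1_def sqn_def split: split_indicator)
    then have "ennreal (c1 * indicator {0} x + step_avg (kern c) x) \<le> ennreal (kern c x)" by (rule ennreal_leI)
    then show ?thesis using avg0[of x] \<open>c1 > 0\<close> by (simp add: avg ennreal_mult' ennreal_indicator)
  qed
  moreover have "ennreal (kern c a) * ennreal (kern c b) \<le>
      ennreal (4 powr decay TYPE('d)) * (ennreal (kern c (a + b)) * (ennreal (kern c a) + ennreal (kern c b)))" for a b :: "int^'d"
  proof -
    have "ennreal (kern c a * kern c b) \<le> ennreal (4 powr decay TYPE('d) * kern c (a + b) * (kern c a + kern c b))"
      by (intro ennreal_leI kern_three_point[OF d3 c])
    then show ?thesis using kp[of a] kp[of b] kp[of "a + b"]
      by (simp add: ennreal_mult less_imp_le mult.assoc)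
  qed
  moreover have "ennreal (kern c x) \<le> green (\<lambda>x. ennreal (m x)) x" for x :: "int^'d"
    by (rule le_green_of_vanishing[OF mp m_def kp finite_kern_ge[OF d3 c]])
  moreover have "(\<integral>\<^sup>+ x. ennreal (m x) \<partial>count_space UNIV) \<le> ennreal (C * enn2real I)"
  proof -
    have "(\<integral>\<^sup>+ x. ennreal (m x) \<partial>count_space UNIV) \<le>
      (\<integral>\<^sup>+ x. ennreal C * ennreal ((c + 1 + sqn x) powr (- decay TYPE('d) - 2)) \<partial>count_space (UNIV::(int^'d) set))"
      unfolding m_def using b(2) C by (intro nn_integral_mono) (simp add: ennreal_mult'[symmetric] ennreal_leI)
    also have "\<dots> = ennreal C * I" by (simp add: nn_integral_cmult I_def)
    also have "\<dots> = ennreal (C * enn2real I)" using C I by (simp add: ennreal_mult less_top)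
    finally show ?thesis .
  qed
  ultimately show ?thesis using C
    by (intro exI[of _ "\<lambda>x. ennreal (kern c x)"] exI[of _ c1] exI[of _ "4 powr decay TYPE('d)"]
       exI[of _ "C * enn2real I"] exI[of _ "\<lambda>x. ennreal (m x)"]) auto
qed

section \<open>Independence in the product space\<close>

text \<open>The data seen from child \<open>i\<close>. They form again a sample of the same product
  measure, which makes the tree self-similar.\<close>

definition descend :: "nat \<Rightarrow> (nat list \<Rightarrow> 'a) \<Rightarrow> nat list \<Rightarrow> 'a" where
  "descend i \<omega> = (\<lambda>v. \<omega> (i # v))"

lemma prob_space_Omega: "prob_space (Omega \<mu>)"
  unfolding Omega_def by (intro prob_space_PiM prob_space_measure_pmf)

lemma measurable_coord: "(\<lambda>\<omega>. \<omega> v) \<in> measurable (Omega \<mu>) (count_space UNIV)"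
proof -
  have "(\<lambda>\<omega>. \<omega> v) \<in> measurable (Omega \<mu>) (measure_pmf (vdata_pmf \<mu>))"
    unfolding Omega_def by (rule measurable_component_singleton) simp
  then show ?thesis by (simp cong: measurable_cong_sets)
qed

lemma measurable_descend: "descend i \<in> measurable (Omega \<mu>) (Omega \<mu>)"
  unfolding descend_def Omega_def
  by (rule measurable_PiM_single') (auto simp: space_PiM intro: measurable_component_singleton)

lemma distr_descend: "distr (Omega \<mu>) (Omega \<mu>) (descend i) = Omega \<mu>"
proof -
  have "distr (PiM UNIV (\<lambda>_. measure_pmf (vdata_pmf \<mu>))) (PiM UNIV (\<lambda>_. measure_pmf (vdata_pmf \<mu>)))
      (\<lambda>\<omega>. \<lambda>v\<in>UNIV. \<omega> (i # v)) = PiM UNIV (\<lambda>_. measure_pmf (vdata_pmf \<mu>))"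
    by (rule distr_PiM_reindex[where K=UNIV and I=UNIV and f="\<lambda>v. i # v" and M="\<lambda>_. measure_pmf (vdata_pmf \<mu>)"])
      (auto intro: prob_space_measure_pmf)
  then show ?thesis by (simp add: Omega_def descend_def[abs_def] restrict_def)
qed

lemma nn_integral_descend:
  "f \<in> borel_measurable (Omega \<mu>) \<Longrightarrow> (\<integral>\<^sup>+ \<omega>. f (descend i \<omega>) \<partial>Omega \<mu>) = (\<integral>\<^sup>+ \<omega>. f \<omega> \<partial>Omega \<mu>)"
  using nn_integral_distr[OF measurable_descend, of f \<mu> i] by (simp add: distr_descend)

lemma nn_integral_coord:
  fixes f :: "('d::finite) vdata \<Rightarrow> ennreal"
  shows "(\<integral>\<^sup>+ \<omega>. f (\<omega> v) \<partial>Omega \<mu>) = (\<integral>\<^sup>+ d. f d \<partial>measure_pmf (vdata_pmf \<mu>))"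
proof -
  have "distr (Omega \<mu> :: (nat list \<Rightarrow> 'd vdata) measure) (measure_pmf (vdata_pmf \<mu>)) (\<lambda>\<omega>. \<omega> v) = measure_pmf (vdata_pmf \<mu>)"
    unfolding Omega_def by (rule distr_PiM_component) (auto intro: prob_space_measure_pmf)
  moreover have "(\<integral>\<^sup>+ d. f d \<partial>distr (Omega \<mu>) (measure_pmf (vdata_pmf \<mu>)) (\<lambda>\<omega>. \<omega> v)) = (\<integral>\<^sup>+ \<omega>. f (\<omega> v) \<partial>Omega \<mu>)"
    by (rule nn_integral_distr) (use measurable_coord in \<open>simp_all cong: measurable_cong_sets\<close>)
  ultimately show ?thesis by simp
qed

text \<open>The labels split into the root and the cones of labels starting with \<open>i\<close>,
  and functions of disjoint blocks of coordinates are independent. The root value is frozen by an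
  indicator, so that afterwards the number of factors and the factors themselves may depend on
  it.\<close>

lemma Omega_indep_prod:
  fixes H :: "nat \<Rightarrow> (nat list \<Rightarrow> ('d::finite) vdata) \<Rightarrow> ennreal" and \<mu> :: "nat pmf"
  assumes H: "\<And>i. H i \<in> borel_measurable (Omega \<mu>)"
  shows "(\<integral>\<^sup>+ \<omega>. indicator {d} (\<omega> []) * (\<Prod>i<n. H i (descend i \<omega>)) \<partial>Omega \<mu>)
     = ennreal (pmf (vdata_pmf \<mu>) d) * (\<Prod>i<n. \<integral>\<^sup>+ \<omega>. H i \<omega> \<partial>Omega \<mu>)"
proof -
  let ?M = "measure_pmf (vdata_pmf \<mu> :: 'd vdata pmf)"
  let ?O = "Omega \<mu> :: (nat list \<Rightarrow> 'd vdata) measure"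
  interpret prob_space ?O by (rule prob_space_Omega)
  define K where "K j = (case j of 0 \<Rightarrow> {[]} | Suc i \<Rightarrow> {i # v |v. True})" for j
  define F where "F j g = (case j of 0 \<Rightarrow> indicator {d} (g []) | Suc i \<Rightarrow> H i (descend i g))" for j and g :: "nat list \<Rightarrow> 'd vdata"
  have coord: "indep_vars (\<lambda>_. ?M) (\<lambda>v \<omega>. \<omega> v) UNIV"
  proof (subst indep_vars_iff_distr_eq_PiM)
    show "random_variable ?M (\<lambda>\<omega>. \<omega> v)" for v
      using measurable_coord by (simp cong: measurable_cong_sets)
    have "distr ?O ?M (\<lambda>\<omega>. \<omega> v) = ?M" for v
      unfolding Omega_def by (rule distr_PiM_component) (auto intro: prob_space_measure_pmf)
    then show "distr ?O (PiM UNIV (\<lambda>_. ?M)) (\<lambda>\<omega>. \<lambda>v\<in>UNIV. \<omega> v) = PiM UNIV (\<lambda>v. distr ?O ?M (\<lambda>\<omega>. \<omega> v))"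
      by (simp add: Omega_def restrict_def distr_id[unfolded id_def])
  qed simp
  have disj: "disjoint_family_on K UNIV"
    by (auto simp: disjoint_family_on_def K_def split: nat.splits)
  have "indep_vars (\<lambda>j. PiM (K j) (\<lambda>_. ?M)) (\<lambda>j \<omega>. restrict (\<lambda>v. \<omega> v) (K j)) UNIV"
    by (rule indep_vars_restrict[OF coord]) (use disj in auto)
  then have "indep_vars (\<lambda>_. borel) (\<lambda>j \<omega>. F j (restrict \<omega> (K j))) UNIV"
  proof (rule indep_vars_compose2)
    fix j
    show "F j \<in> measurable (PiM (K j) (\<lambda>_. ?M)) borel"
    proof (cases j)
      case 0
      have "(\<lambda>g. g []) \<in> measurable (PiM {[]} (\<lambda>_. ?M)) ?M" by (rule measurable_component_singleton) simp
      then have "(\<lambda>g. indicator {d} (g []) :: ennreal) \<in> borel_measurable (PiM {[]} (\<lambda>_. ?M))"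
        by (rule measurable_compose) simp
      then show ?thesis by (simp add: F_def[abs_def] K_def 0)
    next
      case (Suc i)
      have "descend i \<in> measurable (PiM (K j) (\<lambda>_. ?M)) ?O"
        unfolding descend_def[abs_def] Omega_def K_def Suc
        by (rule measurable_PiM_single') (auto simp: space_PiM intro!: measurable_component_singleton)
      then have "(\<lambda>g. H i (descend i g)) \<in> borel_measurable (PiM (K j) (\<lambda>_. ?M))"
        using H by (rule measurable_compose)
      then show ?thesis by (simp add: F_def[abs_def] Suc)
    qed
  qed
  moreover have "F j (restrict \<omega> (K j)) = F j \<omega>" for j \<omega>
    by (auto simp: F_def K_def descend_def split: nat.splits)
  ultimately have indep: "indep_vars (\<lambda>_. borel) F UNIV" by simp
  have "(\<integral>\<^sup>+ \<omega>. (\<Prod>j<Suc n. F j \<omega>) \<partial>?O) = (\<Prod>j<Suc n. \<integral>\<^sup>+ \<omega>. F j \<omega> \<partial>?O)"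
    by (rule indep_vars_nn_integral) (auto intro: indep_vars_subset[OF indep])
  then have "(\<integral>\<^sup>+ \<omega>. F 0 \<omega> * (\<Prod>i<n. F (Suc i) \<omega>) \<partial>?O) = (\<integral>\<^sup>+ \<omega>. F 0 \<omega> \<partial>?O) * (\<Prod>i<n. \<integral>\<^sup>+ \<omega>. F (Suc i) \<omega> \<partial>?O)"
    unfolding prod.lessThan_Suc_shift .
  moreover have "(\<integral>\<^sup>+ \<omega>. F 0 \<omega> \<partial>?O) = ennreal (pmf (vdata_pmf \<mu>) d)"
    using nn_integral_coord[where f="indicator {d}" and v="[]" and \<mu>=\<mu>] by (simp add: F_def emeasure_pmf_single)
  moreover have "(\<integral>\<^sup>+ \<omega>. F (Suc i) \<omega> \<partial>?O) = (\<integral>\<^sup>+ \<omega>. H i \<omega> \<partial>?O)" for i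
    using nn_integral_descend[OF H, of i i] by (simp add: F_def)
  ultimately show ?thesis by (simp add: F_def)
qed

text \<open>The data at one vertex range over a countable type, so choosing a functional according
  to them keeps measurability.\<close>

lemma measurable_branch:
  fixes H :: "('d::finite) vdata \<Rightarrow> (nat list \<Rightarrow> 'd vdata) \<Rightarrow> 'b"
  assumes "\<And>d. H d \<in> measurable (Omega \<mu>) N"
  shows "(\<lambda>\<omega>. H (\<omega> v) \<omega>) \<in> measurable (Omega \<mu>) N"
  by (rule measurable_compose_countable[OF _ measurable_coord]) (rule assms)

lemma nn_integral_split_root:
  fixes H :: "('d::finite) vdata \<Rightarrow> (nat list \<Rightarrow> 'd vdata) \<Rightarrow> ennreal"
  assumes H: "\<And>d. H d \<in> borel_measurable (Omega \<mu>)"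
  shows "(\<integral>\<^sup>+ \<omega>. H (\<omega> []) \<omega> \<partial>Omega \<mu>) =
    (\<integral>\<^sup>+ d. (\<integral>\<^sup>+ \<omega>. indicator {d} (\<omega> []) * H d \<omega> \<partial>Omega \<mu>) \<partial>count_space UNIV)"
proof -
  have "(\<integral>\<^sup>+ d. (\<integral>\<^sup>+ \<omega>. indicator {d} (\<omega> []) * H d \<omega> \<partial>Omega \<mu>) \<partial>count_space UNIV) =
    (\<integral>\<^sup>+ \<omega>. (\<integral>\<^sup>+ d. indicator {d} (\<omega> []) * H d \<omega> \<partial>count_space UNIV) \<partial>Omega \<mu>)"
  proof (rule nn_integral_count_space_nn_integral[symmetric])
    fix d :: "'d vdata"
    have "(\<lambda>\<omega>. indicator {d} (\<omega> []) :: ennreal) \<in> borel_measurable (Omega \<mu>)"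
      by (rule measurable_compose[OF measurable_coord]) simp
    then show "(\<lambda>\<omega>. indicator {d} (\<omega> []) * H d \<omega>) \<in> borel_measurable (Omega \<mu>)"
      using H by (intro borel_measurable_times_ennreal)
  qed auto
  also have "\<dots> = (\<integral>\<^sup>+ \<omega>. H (\<omega> []) \<omega> \<partial>Omega \<mu>)"
  proof (rule nn_integral_cong)
    fix \<omega> :: "nat list \<Rightarrow> 'd vdata"
    have "(\<integral>\<^sup>+ d. indicator {d} (\<omega> []) * H d \<omega> \<partial>count_space UNIV) = (\<integral>\<^sup>+ d. H d \<omega> * indicator {\<omega> []} d \<partial>count_space UNIV)"
      by (intro nn_integral_cong) (auto split: split_indicator)
    then show "(\<integral>\<^sup>+ d. indicator {d} (\<omega> []) * H d \<omega> \<partial>count_space UNIV) = H (\<omega> []) \<omega>"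
      by (simp add: nn_integral_indicator_singleton)
  qed
  finally show ?thesis by simp
qed

text \<open>The branching property: given the root data, the subtrees are independent copies. The
  product form serves exponential moments; the sum form that follows serves mean numbers of
  visits.\<close>

lemma nn_integral_branch_prod:
  fixes H :: "('d::finite) vdata \<Rightarrow> nat \<Rightarrow> (nat list \<Rightarrow> 'd vdata) \<Rightarrow> ennreal"
  assumes H: "\<And>d i. H d i \<in> borel_measurable (Omega \<mu>)"
  shows "(\<integral>\<^sup>+ \<omega>. c (\<omega> []) * (\<Prod>i<k (\<omega> []). H (\<omega> []) i (descend i \<omega>)) \<partial>Omega \<mu>) =
    (\<integral>\<^sup>+ d. c d * (\<Prod>i<k d. \<integral>\<^sup>+ \<omega>. H d i \<omega> \<partial>Omega \<mu>) \<partial>measure_pmf (vdata_pmf \<mu>))"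
proof -
  have Hs: "(\<lambda>\<omega>. H d i (descend i \<omega>)) \<in> borel_measurable (Omega \<mu>)" for d i
    by (rule measurable_compose[OF measurable_descend H])
  have ind: "(\<lambda>\<omega>. indicator {d} (\<omega> []) :: ennreal) \<in> borel_measurable (Omega \<mu>)" for d :: "'d vdata"
    by (rule measurable_compose[OF measurable_coord]) simp
  have "(\<integral>\<^sup>+ \<omega>. c (\<omega> []) * (\<Prod>i<k (\<omega> []). H (\<omega> []) i (descend i \<omega>)) \<partial>Omega \<mu>) =
    (\<integral>\<^sup>+ d. (\<integral>\<^sup>+ \<omega>. indicator {d} (\<omega> []) * (c d * (\<Prod>i<k d. H d i (descend i \<omega>))) \<partial>Omega \<mu>) \<partial>count_space UNIV)"
    by (rule nn_integral_split_root[where H="\<lambda>d \<omega>. c d * (\<Prod>i<k d. H d i (descend i \<omega>))"])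
      (intro borel_measurable_times_ennreal borel_measurable_const borel_measurable_prod_ennreal Hs)
  also have "\<dots> = (\<integral>\<^sup>+ d. c d * (\<integral>\<^sup>+ \<omega>. indicator {d} (\<omega> []) * (\<Prod>i<k d. H d i (descend i \<omega>)) \<partial>Omega \<mu>) \<partial>count_space UNIV)"
  proof (rule nn_integral_cong)
    fix d
    have "(\<lambda>\<omega>. indicator {d} (\<omega> []) * (\<Prod>i<k d. H d i (descend i \<omega>))) \<in> borel_measurable (Omega \<mu>)"
      by (intro borel_measurable_times_ennreal borel_measurable_prod_ennreal Hs ind)
    from nn_integral_cmult[OF this, of "c d"]
    show "(\<integral>\<^sup>+ \<omega>. indicator {d} (\<omega> []) * (c d * (\<Prod>i<k d. H d i (descend i \<omega>))) \<partial>Omega \<mu>) =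
      c d * (\<integral>\<^sup>+ \<omega>. indicator {d} (\<omega> []) * (\<Prod>i<k d. H d i (descend i \<omega>)) \<partial>Omega \<mu>)"
      by (simp only: mult.left_commute)
  qed
  also have "\<dots> = (\<integral>\<^sup>+ d. ennreal (pmf (vdata_pmf \<mu>) d) * (c d * (\<Prod>i<k d. \<integral>\<^sup>+ \<omega>. H d i \<omega> \<partial>Omega \<mu>)) \<partial>count_space UNIV)"
    by (subst Omega_indep_prod[OF H]) (simp add: mult.left_commute)
  finally show ?thesis by (simp add: nn_integral_measure_pmf)
qed

lemma nn_integral_branch_sum:
  fixes H :: "('d::finite) vdata \<Rightarrow> nat \<Rightarrow> (nat list \<Rightarrow> 'd vdata) \<Rightarrow> ennreal"
  assumes H: "\<And>d i. H d i \<in> borel_measurable (Omega \<mu>)"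
  shows "(\<integral>\<^sup>+ \<omega>. c (\<omega> []) + (\<Sum>i<k (\<omega> []). H (\<omega> []) i (descend i \<omega>)) \<partial>Omega \<mu>) =
    (\<integral>\<^sup>+ d. c d + (\<Sum>i<k d. \<integral>\<^sup>+ \<omega>. H d i \<omega> \<partial>Omega \<mu>) \<partial>measure_pmf (vdata_pmf \<mu>))"
proof -
  have Hs: "(\<lambda>\<omega>. H d i (descend i \<omega>)) \<in> borel_measurable (Omega \<mu>)" for d i
    by (rule measurable_compose[OF measurable_descend H])
  have ind: "(\<lambda>\<omega>. indicator {d} (\<omega> []) :: ennreal) \<in> borel_measurable (Omega \<mu>)" for d :: "'d vdata"
    by (rule measurable_compose[OF measurable_coord]) simp
  have c0: "(\<integral>\<^sup>+ \<omega>. indicator {d} (\<omega> []) \<partial>Omega \<mu>) = ennreal (pmf (vdata_pmf \<mu>) d)" for d :: "'d vdata"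
    using Omega_indep_prod[of "\<lambda>_ _. 1" \<mu> d 0] by simp
  have one: "(\<integral>\<^sup>+ \<omega>. indicator {d} (\<omega> []) * H d i (descend i \<omega>) \<partial>Omega \<mu>) =
      ennreal (pmf (vdata_pmf \<mu>) d) * (\<integral>\<^sup>+ \<omega>. H d i \<omega> \<partial>Omega \<mu>)" for d i
  proof -
    \<comment> \<open>A single summand is a product whose other factors are 1, so the product
      formula applies.\<close>
    define G where "G j = (if j = i then H d i else (\<lambda>_. 1))" for j
    have G: "G j \<in> borel_measurable (Omega \<mu>)" for j
      using H by (auto simp: G_def)
    have "(\<Prod>j<Suc i. G j (descend j \<omega>)) = H d i (descend i \<omega>)" for \<omega>
      by (subst prod.remove[of _ i]) (auto intro!: prod.neutral simp: G_def)
    moreover have "(\<Prod>j<Suc i. \<integral>\<^sup>+ \<omega>. G j \<omega> \<partial>Omega \<mu>) = (\<integral>\<^sup>+ \<omega>. H d i \<omega> \<partial>Omega \<mu>)"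
      by (subst prod.remove[of _ i])
        (auto intro!: prod.neutral simp: G_def prob_space.emeasure_space_1[OF prob_space_Omega])
    ultimately show ?thesis using Omega_indep_prod[where H=G and n="Suc i" and d=d, OF G] by (simp only:)
  qed
  have "(\<integral>\<^sup>+ \<omega>. c (\<omega> []) + (\<Sum>i<k (\<omega> []). H (\<omega> []) i (descend i \<omega>)) \<partial>Omega \<mu>) =
    (\<integral>\<^sup>+ d. (\<integral>\<^sup>+ \<omega>. indicator {d} (\<omega> []) * (c d + (\<Sum>i<k d. H d i (descend i \<omega>))) \<partial>Omega \<mu>) \<partial>count_space UNIV)"
    by (rule nn_integral_split_root[where H="\<lambda>d \<omega>. c d + (\<Sum>i<k d. H d i (descend i \<omega>))"])
      (intro borel_measurable_add borel_measurable_const borel_measurable_sum Hs)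
  also have "\<dots> = (\<integral>\<^sup>+ d. ennreal (pmf (vdata_pmf \<mu>) d) * (c d + (\<Sum>i<k d. \<integral>\<^sup>+ \<omega>. H d i \<omega> \<partial>Omega \<mu>)) \<partial>count_space UNIV)"
  proof (rule nn_integral_cong)
    fix d :: "'d vdata"
    have "(\<integral>\<^sup>+ \<omega>. indicator {d} (\<omega> []) * (c d + (\<Sum>i<k d. H d i (descend i \<omega>))) \<partial>Omega \<mu>) =
      (\<integral>\<^sup>+ \<omega>. c d * indicator {d} (\<omega> []) + (\<Sum>i<k d. indicator {d} (\<omega> []) * H d i (descend i \<omega>)) \<partial>Omega \<mu>)"
      by (simp add: distrib_left sum_distrib_left mult.commute)
    also have "\<dots> = (\<integral>\<^sup>+ \<omega>. c d * indicator {d} (\<omega> []) \<partial>Omega \<mu>) + (\<integral>\<^sup>+ \<omega>. (\<Sum>i<k d. indicator {d} (\<omega> []) * H d i (descend i \<omega>)) \<partial>Omega \<mu>)"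
      by (rule nn_integral_add)
        (intro borel_measurable_times_ennreal borel_measurable_const borel_measurable_sum Hs ind)+
    also have "(\<integral>\<^sup>+ \<omega>. (\<Sum>i<k d. indicator {d} (\<omega> []) * H d i (descend i \<omega>)) \<partial>Omega \<mu>) = (\<Sum>i<k d. \<integral>\<^sup>+ \<omega>. indicator {d} (\<omega> []) * H d i (descend i \<omega>) \<partial>Omega \<mu>)"
      by (rule nn_integral_sum) (intro borel_measurable_times_ennreal Hs ind)
    also have "(\<integral>\<^sup>+ \<omega>. c d * indicator {d} (\<omega> []) \<partial>Omega \<mu>) = c d * ennreal (pmf (vdata_pmf \<mu>) d)"
      by (subst nn_integral_cmult) (use ind c0 in auto)
    finally show "(\<integral>\<^sup>+ \<omega>. indicator {d} (\<omega> []) * (c d + (\<Sum>i<k d. H d i (descend i \<omega>))) \<partial>Omega \<mu>) =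
      ennreal (pmf (vdata_pmf \<mu>) d) * (c d + (\<Sum>i<k d. \<integral>\<^sup>+ \<omega>. H d i \<omega> \<partial>Omega \<mu>))"
      unfolding one by (simp add: distrib_left sum_distrib_left mult.commute)
  qed
  finally show ?thesis by (simp add: nn_integral_measure_pmf)
qed

section \<open>Recursive structure of the tree\<close>

text \<open>The subtree below a vertex depends only on the data below it and on its kind.
  \<open>Left\<close> describes the part of a special subtree formed by the spine and the subtrees to its left.\<close>
datatype kind = Root | Normal | Special | Left

fun deg :: "kind \<Rightarrow> 'd vdata \<Rightarrow> nat" where
  "deg Root d = Suc (fst (fst d))"
| "deg Normal d = fst (fst d)"
| "deg Special d = fst (snd (fst d))"
| "deg Left d = fst (snd (fst d))"

text \<open>\<open>None\<close> removes the child, with everything below it, from the set being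
  described. This happens for \<open>Left\<close> only, at the children to the right of the
  spine.\<close>

fun child :: "kind \<Rightarrow> 'd vdata \<Rightarrow> nat \<Rightarrow> kind option" where
  "child Root d i = Some (if i = 0 then Special else Normal)"
| "child Normal d i = Some Normal"
| "child Special d i = Some (if i = snd (snd (fst d)) then Special else Normal)"
| "child Left d i = (if i < snd (snd (fst d)) then Some Normal
    else if i = snd (snd (fst d)) then Some Left else None)"

fun mem :: "kind \<Rightarrow> (nat list \<Rightarrow> 'd vdata) \<Rightarrow> nat list \<Rightarrow> bool" where
  "mem q \<omega> [] \<longleftrightarrow> True"
| "mem q \<omega> (i # u) \<longleftrightarrow> i < deg q (\<omega> []) \<and>
    (case child q (\<omega> []) i of None \<Rightarrow> False | Some q' \<Rightarrow> mem q' (descend i \<omega>) u)"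

text \<open>Numbers of children are ignored, as they are in \<open>special\<close>: a label has a
  kind whether or not it belongs to the tree.\<close>

fun kind_at :: "kind \<Rightarrow> (nat list \<Rightarrow> 'd vdata) \<Rightarrow> nat list \<Rightarrow> kind option" where
  "kind_at q \<omega> [] = Some q"
| "kind_at q \<omega> (i # u) = (case child q (\<omega> []) i of None \<Rightarrow> None | Some q' \<Rightarrow> kind_at q' (descend i \<omega>) u)"

text \<open>\<open>mem\<close> consumes a label from the root downwards, whereas \<open>tree\<close>
  grows at the last letter. This lemma translates between the two.\<close>

lemma mem_snoc:
  "mem q \<omega> (v @ [i]) \<longleftrightarrow> mem q \<omega> v \<and>
    (\<exists>q'. kind_at q \<omega> v = Some q' \<and> i < deg q' (\<omega> v) \<and> child q' (\<omega> v) i \<noteq> None)"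
  by (induction v arbitrary: q \<omega>) (auto simp: descend_def split: option.splits)

text \<open>The spine seen from its first special vertex. From there on each step is given by the
  drawn index, whereas \<open>spine\<close> has an exceptional step at the root, where the special
  child is always the first.\<close>

fun spine_from :: "(nat list \<Rightarrow> 'd vdata) \<Rightarrow> nat \<Rightarrow> nat list" where
  "spine_from \<omega> 0 = []"
| "spine_from \<omega> (Suc n) = spine_from \<omega> n @ [Jof \<omega> (spine_from \<omega> n)]"

lemma spine_eq: "spine \<omega> (Suc n) = 0 # spine_from (descend 0 \<omega>) n"
  by (induction n) (auto simp: descend_def Jof_def)

lemma spine_from_Suc_Cons: "spine_from \<omega> (Suc n) = Jof \<omega> [] # spine_from (descend (Jof \<omega> []) \<omega>) n"
  by (induction n) (auto simp: descend_def Jof_def)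

lemma Cons_eq_spine_from:
  "(\<exists>n. i # u = spine_from \<omega> n) \<longleftrightarrow> i = Jof \<omega> [] \<and> (\<exists>n. u = spine_from (descend i \<omega>) n)"
proof
  assume "\<exists>n. i # u = spine_from \<omega> n"
  then obtain n where n: "i # u = spine_from \<omega> n" by blast
  then obtain m where "n = Suc m" by (cases n) auto
  then show "i = Jof \<omega> [] \<and> (\<exists>n. u = spine_from (descend i \<omega>) n)"
    using n by (auto simp: spine_from_Suc_Cons simp del: spine_from.simps(2))
next
  assume "i = Jof \<omega> [] \<and> (\<exists>n. u = spine_from (descend i \<omega>) n)"
  then obtain n where "i # u = spine_from \<omega> (Suc n)" unfolding spine_from_Suc_Cons by blast
  then show "\<exists>n. i # u = spine_from \<omega> n" ..
qed

lemma special_Cons: "special \<omega> (i # u) \<longleftrightarrow> i = 0 \<and> (\<exists>n. u = spine_from (descend 0 \<omega>) n)"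
proof
  assume "special \<omega> (i # u)"
  then obtain n where "n \<ge> 1" "i # u = spine \<omega> n" by (auto simp: special_def)
  then show "i = 0 \<and> (\<exists>n. u = spine_from (descend 0 \<omega>) n)"
    by (cases n) (auto simp: spine_eq)
next
  assume "i = 0 \<and> (\<exists>n. u = spine_from (descend 0 \<omega>) n)"
  then obtain n where "i # u = spine \<omega> (Suc n)" by (auto simp: spine_eq)
  then show "special \<omega> (i # u)" unfolding special_def by (intro exI[of _ "Suc n"]) auto
qed

lemma kind_at_Normal: "kind_at Normal \<omega> v = Some Normal"
  by (induction v arbitrary: \<omega>) auto

lemma kind_at_Special:
  "kind_at Special \<omega> v = Some (if \<exists>n. v = spine_from \<omega> n then Special else Normal)"
proof (induction v arbitrary: \<omega>)
  case Nil
  have "\<exists>n. [] = spine_from \<omega> n" by (rule exI[of _ 0]) simp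
  then show ?case by simp
next
  case (Cons i u)
  show ?case
    using Cons[of "descend i \<omega>"] by (auto simp: Cons_eq_spine_from kind_at_Normal Jof_def)
qed

lemma kind_at_Root:
  "kind_at Root \<omega> v = Some (if v = [] then Root else if special \<omega> v then Special else Normal)"
  by (cases v) (simp_all add: special_Cons kind_at_Special kind_at_Normal)

lemma deg_kind_at_Root: "kind_at Root \<omega> v = Some q \<Longrightarrow> deg q (\<omega> v) = nch \<omega> v"
  by (auto simp: kind_at_Root nch_def Nof_def Kof_def split: if_splits)

lemma mem_Root_snoc: "mem Root \<omega> (v @ [i]) \<longleftrightarrow> mem Root \<omega> v \<and> i < nch \<omega> v"
  unfolding mem_snoc using deg_kind_at_Root[of \<omega> v] by (auto simp: kind_at_Root)

lemma tree_eq: "tree \<omega> = {u. mem Root \<omega> u}"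
proof -
  have "u \<in> tree \<omega> \<longleftrightarrow> mem Root \<omega> u" for u
  proof (induction u rule: rev_induct)
    case Nil
    show ?case by (simp add: tree.root)
  next
    case (snoc i u)
    have "u @ [i] \<in> tree \<omega> \<longleftrightarrow> u \<in> tree \<omega> \<and> i < nch \<omega> u"
    proof
      assume "u @ [i] \<in> tree \<omega>"
      then show "u \<in> tree \<omega> \<and> i < nch \<omega> u" by (cases rule: tree.cases) auto
    qed (simp add: tree.child)
    then show ?case using snoc by (simp add: mem_Root_snoc)
  qed
  then show ?thesis by auto
qed

lemma mem_Left_imp_Special: "mem Left \<omega> u \<Longrightarrow> mem Special \<omega> u"
  by (induction u arbitrary: \<omega>) (auto split: if_splits)

lemma mem_Left_cases:
  "mem Left \<omega> u \<Longrightarrow> (\<exists>n. u = spine_from \<omega> n) \<or>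
    (\<exists>n i w. i < Jof \<omega> (spine_from \<omega> n) \<and> u = spine_from \<omega> n @ [i] @ w)"
proof (induction u arbitrary: \<omega>)
  case Nil
  have "\<exists>n. [] = spine_from \<omega> n" by (rule exI[of _ 0]) simp
  then show ?case ..
next
  case (Cons i u)
  then consider "i < Jof \<omega> []" | "i = Jof \<omega> []" "mem Left (descend i \<omega>) u"
    by (auto simp: Jof_def split: if_splits)
  then show ?case
  proof cases
    case 1
    then show ?thesis by (intro disjI2 exI[of _ 0] exI[of _ i] exI[of _ u]) auto
  next
    case 2
    from Cons.IH[OF 2(2)] show ?thesis
    proof
      assume "\<exists>n. u = spine_from (descend i \<omega>) n"
      then show ?thesis using 2 Cons_eq_spine_from[of i u \<omega>] by blast
    next
      assume "\<exists>n j w. j < Jof (descend i \<omega>) (spine_from (descend i \<omega>) n) \<and> u = spine_from (descend i \<omega>) n @ [j] @ w"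
      then obtain n j w where j: "j < Jof (descend i \<omega>) (spine_from (descend i \<omega>) n)"
        and u: "u = spine_from (descend i \<omega>) n @ [j] @ w" by blast
      have "i # u = spine_from \<omega> (Suc n) @ [j] @ w" unfolding spine_from_Suc_Cons using 2 u by simp
      moreover have "Jof (descend i \<omega>) (spine_from (descend i \<omega>) n) = Jof \<omega> (spine_from \<omega> (Suc n))"
        unfolding spine_from_Suc_Cons using 2 by (simp add: Jof_def descend_def)
      ultimately show ?thesis using j by (intro disjI2 exI[of _ "Suc n"] exI[of _ j] exI[of _ w]) simp
    qed
  qed
qed

text \<open>An inclusion is what a lower bound on \<open>G\<close> asks for.\<close>

lemma mem_Left_in_Tminus:
  assumes "mem Left (descend 0 \<omega>) u"
  shows "0 # u \<in> Tminus \<omega>"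
proof -
  have "0 # u \<in> tree \<omega>" using mem_Left_imp_Special[OF assms] by (simp add: tree_eq)
  moreover have "special \<omega> (0 # u) \<or> (\<exists>n i w. i < sidx \<omega> (spine \<omega> n) \<and> 0 # u = spine \<omega> n @ [i] @ w)"
    using mem_Left_cases[OF assms]
  proof
    assume "\<exists>n i w. i < Jof (descend 0 \<omega>) (spine_from (descend 0 \<omega>) n) \<and> u = spine_from (descend 0 \<omega>) n @ [i] @ w"
    then obtain n i w where i: "i < Jof (descend 0 \<omega>) (spine_from (descend 0 \<omega>) n)"
      and u: "u = spine_from (descend 0 \<omega>) n @ [i] @ w" by blast
    have "i < sidx \<omega> (spine \<omega> (Suc n))" "0 # u = spine \<omega> (Suc n) @ [i] @ w"
      using i u by (simp_all add: spine_eq sidx_def Jof_def descend_def)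
    then show ?thesis by blast
  qed (simp add: special_Cons)
  ultimately show ?thesis by (auto simp: Tminus_def)
qed

section \<open>The walk along the tree and its visit sums\<close>

lemma S_Nil: "S \<omega> y [] = y"
  by (simp add: S_def)

text \<open>The increment into a vertex is stored at that vertex; passing to child \<open>i\<close>
  therefore adds the step at the root of the shifted data.\<close>

lemma S_Cons: "S \<omega> y (i # u) = S (descend i \<omega>) (y + snd (descend i \<omega> [])) u"
proof -
  have "(\<Sum>k\<in>{1..Suc (length u)}. Xof \<omega> (take k (i # u))) =
      Xof \<omega> [i] + (\<Sum>k\<in>{Suc 1..Suc (length u)}. Xof \<omega> (take k (i # u)))"
    by (subst sum.atLeast_Suc_atMost) auto
  also have "(\<Sum>k\<in>{Suc 1..Suc (length u)}. Xof \<omega> (take k (i # u))) = (\<Sum>k\<in>{1..length u}. Xof \<omega> (take (Suc k) (i # u)))"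
    by (rule sum.shift_bounds_cl_Suc_ivl)
  finally show ?thesis by (simp add: S_def Xof_def descend_def add.assoc)
qed

lemma nn_integral_list_split:
  fixes F :: "'a list \<Rightarrow> ennreal"
  shows "(\<integral>\<^sup>+ u. F u \<partial>count_space UNIV) = F [] + (\<integral>\<^sup>+ i. \<integral>\<^sup>+ u. F (i # u) \<partial>count_space UNIV \<partial>count_space UNIV)"
proof -
  define h where "h = (\<lambda>(i::'a, u). i # u)"
  have bij: "bij_betw h UNIV (range h)" by (auto simp: bij_betw_def inj_on_def h_def)
  have "(\<integral>\<^sup>+ u. F u \<partial>count_space UNIV) = (\<integral>\<^sup>+ u. F u * indicator {[]} u + F u * indicator (range h) u \<partial>count_space UNIV)"
  proof (rule nn_integral_cong)
    fix u
    have "u = [] \<or> u \<in> range h" by (cases u) (force simp: h_def)+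
    moreover have "[] \<notin> range h" by (auto simp: h_def)
    ultimately show "F u = F u * indicator {[]} u + F u * indicator (range h) u"
      by (auto split: split_indicator)
  qed
  also have "\<dots> = F [] + (\<integral>\<^sup>+ u. F u \<partial>count_space (range h))"
    by (simp add: nn_integral_add nn_integral_indicator_singleton nn_integral_count_space_indicator)
  also have "(\<integral>\<^sup>+ u. F u \<partial>count_space (range h)) = (\<integral>\<^sup>+ p. F (h p) \<partial>count_space UNIV)"
    by (rule nn_integral_bij_count_space[OF bij, symmetric])
  also have "\<dots> = (\<integral>\<^sup>+ i. \<integral>\<^sup>+ u. F (h (i, u)) \<partial>count_space UNIV \<partial>count_space UNIV)"
    by (rule nn_integral_fst_count_space[symmetric])
  finally show ?thesis by (simp add: h_def)
qed

lemma nn_integral_list_split_indicator: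
  fixes F :: "nat list \<Rightarrow> ennreal"
  assumes "[] \<in> A" and "\<And>i u. i # u \<in> A \<longleftrightarrow> i < m \<and> u \<in> B i"
  shows "(\<integral>\<^sup>+ u. indicator A u * F u \<partial>count_space UNIV) =
    F [] + (\<Sum>i<m. \<integral>\<^sup>+ u. indicator (B i) u * F (i # u) \<partial>count_space UNIV)"
proof -
  have "(\<integral>\<^sup>+ u. indicator A u * F u \<partial>count_space UNIV) =
     F [] + (\<integral>\<^sup>+ i. \<integral>\<^sup>+ u. indicator A (i # u) * F (i # u) \<partial>count_space UNIV \<partial>count_space UNIV)"
    by (subst nn_integral_list_split) (use assms(1) in simp)
  also have "(\<integral>\<^sup>+ i. \<integral>\<^sup>+ u. indicator A (i # u) * F (i # u) \<partial>count_space UNIV \<partial>count_space UNIV) =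
     (\<Sum>i<m. \<integral>\<^sup>+ u. indicator A (i # u) * F (i # u) \<partial>count_space UNIV)"
    by (rule nn_integral_count_space') (use assms(2) in auto)
  also have "\<dots> = (\<Sum>i<m. \<integral>\<^sup>+ u. indicator (B i) u * F (i # u) \<partial>count_space UNIV)"
    by (intro sum.cong nn_integral_cong refl) (use assms(2) in \<open>auto split: split_indicator\<close>)
  finally show ?thesis .
qed

definition visit_sum :: "kind \<Rightarrow> (int ^ 'd \<Rightarrow> ennreal) \<Rightarrow> int ^ 'd \<Rightarrow> (nat list \<Rightarrow> 'd vdata) \<Rightarrow> ennreal" where
  "visit_sum q f y \<omega> = (\<integral>\<^sup>+ u. indicator {u. mem q \<omega> u} u * f (S \<omega> y u) \<partial>count_space UNIV)"

text \<open>Only vertices of depth less than \<open>n\<close> count, so the value at 0 is 0.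
  Recursion on the depth gives measurability and a base for inductions; the full sum is the
  increasing limit.\<close>

fun visit_sum_upto :: "nat \<Rightarrow> kind \<Rightarrow> (int ^ 'd \<Rightarrow> ennreal) \<Rightarrow> int ^ 'd \<Rightarrow> (nat list \<Rightarrow> 'd vdata) \<Rightarrow> ennreal" where
  "visit_sum_upto 0 q f y \<omega> = 0"
| "visit_sum_upto (Suc n) q f y \<omega> = f y + (\<Sum>i<deg q (\<omega> []). case child q (\<omega> []) i of None \<Rightarrow> 0
     | Some q' \<Rightarrow> visit_sum_upto n q' f (y + snd (descend i \<omega> [])) (descend i \<omega>))"

lemma visit_sum_rec:
  "visit_sum q f y \<omega> = f y + (\<Sum>i<deg q (\<omega> []). case child q (\<omega> []) i of None \<Rightarrow> 0
     | Some q' \<Rightarrow> visit_sum q' f (y + snd (descend i \<omega> [])) (descend i \<omega>))"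
proof -
  define B where "B i = {u. case child q (\<omega> []) i of None \<Rightarrow> False | Some q' \<Rightarrow> mem q' (descend i \<omega>) u}" for i
  have "visit_sum q f y \<omega> = f (S \<omega> y []) + (\<Sum>i<deg q (\<omega> []). \<integral>\<^sup>+ u. indicator (B i) u * f (S \<omega> y (i # u)) \<partial>count_space UNIV)"
    unfolding visit_sum_def
    by (rule nn_integral_list_split_indicator[where F="\<lambda>u. f (S \<omega> y u)" and B=B]) (auto simp: B_def split: option.splits)
  also have "\<dots> = f y + (\<Sum>i<deg q (\<omega> []). case child q (\<omega> []) i of None \<Rightarrow> 0
     | Some q' \<Rightarrow> visit_sum q' f (y + snd (descend i \<omega> [])) (descend i \<omega>))"
    unfolding S_Nil S_Cons
    by (intro arg_cong2[where f="(+)"] refl sum.cong) (auto simp: B_def visit_sum_def split: option.split)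
  finally show ?thesis .
qed

lemma visit_sum_upto_eq:
  "visit_sum_upto n q f y \<omega> = (\<integral>\<^sup>+ u. indicator {u. mem q \<omega> u \<and> length u < n} u * f (S \<omega> y u) \<partial>count_space UNIV)"
proof (induction n arbitrary: q y \<omega>)
  case (Suc n)
  define B where "B i = {u. length u < n \<and> (case child q (\<omega> []) i of None \<Rightarrow> False | Some q' \<Rightarrow> mem q' (descend i \<omega>) u)}" for i
  have "(\<integral>\<^sup>+ u. indicator {u. mem q \<omega> u \<and> length u < Suc n} u * f (S \<omega> y u) \<partial>count_space UNIV)
     = f (S \<omega> y []) + (\<Sum>i<deg q (\<omega> []). \<integral>\<^sup>+ u. indicator (B i) u * f (S \<omega> y (i # u)) \<partial>count_space UNIV)"
    by (rule nn_integral_list_split_indicator[where F="\<lambda>u. f (S \<omega> y u)" and B=B]) (auto simp: B_def split: option.splits)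
  also have "\<dots> = visit_sum_upto (Suc n) q f y \<omega>"
    unfolding S_Nil S_Cons visit_sum_upto.simps
    by (intro arg_cong2[where f="(+)"] refl sum.cong) (auto simp: B_def Suc conj_commute split: option.split)
  finally show ?case by simp
qed simp

lemma incseq_visit_sum_upto: "incseq (\<lambda>n. visit_sum_upto n q f y \<omega>)"
  unfolding incseq_def visit_sum_upto_eq by (auto intro!: nn_integral_mono split: split_indicator)

lemma visit_sum_eq_SUP: "visit_sum q f y \<omega> = (SUP n. visit_sum_upto n q f y \<omega>)"
proof -
  have "visit_sum q f y \<omega> = (\<integral>\<^sup>+ u. (SUP n. indicator {u. mem q \<omega> u \<and> length u < n} u * f (S \<omega> y u)) \<partial>count_space UNIV)"
    unfolding visit_sum_def
  proof (rule nn_integral_cong)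
    fix u
    show "indicator {u. mem q \<omega> u} u * f (S \<omega> y u) = (SUP n. indicator {u. mem q \<omega> u \<and> length u < n} u * f (S \<omega> y u))"
    proof (rule antisym)
      show "indicator {u. mem q \<omega> u} u * f (S \<omega> y u) \<le> (SUP n. indicator {u. mem q \<omega> u \<and> length u < n} u * f (S \<omega> y u))"
        by (rule SUP_upper2[of "Suc (length u)"]) (auto split: split_indicator)
    qed (auto intro!: SUP_least split: split_indicator)
  qed
  also have "\<dots> = (SUP n. visit_sum_upto n q f y \<omega>)"
    unfolding visit_sum_upto_eq
    by (rule nn_integral_monotone_convergence_SUP) (auto simp: incseq_def le_fun_def split: split_indicator)
  finally show ?thesis .
qed

lemma measurable_visit_sum_upto: "visit_sum_upto n q f y \<in> borel_measurable (Omega \<mu>)"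
proof (induction n arbitrary: q y)
  case 0
  have "visit_sum_upto 0 q f y = (\<lambda>_. 0)" by (rule ext) simp
  then show ?case by simp
next
  case (Suc n)
  have step: "(\<lambda>\<omega>. visit_sum_upto n q' f (y + snd (descend i \<omega> [])) (descend i \<omega>)) \<in> borel_measurable (Omega \<mu>)" for q' i
  proof (rule measurable_compose[OF measurable_descend])
    show "(\<lambda>\<omega>. visit_sum_upto n q' f (y + snd (\<omega> [])) \<omega>) \<in> borel_measurable (Omega \<mu>)"
      by (rule measurable_branch[where H="\<lambda>d. visit_sum_upto n q' f (y + snd d)" and v="[]"]) (rule Suc)
  qed
  have "(\<lambda>\<omega>. case child q d i of None \<Rightarrow> 0
     | Some q' \<Rightarrow> visit_sum_upto n q' f (y + snd (descend i \<omega> [])) (descend i \<omega>)) \<in> borel_measurable (Omega \<mu>)" for d i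
    using step by (cases "child q d i") auto
  then have "(\<lambda>\<omega>. f y + (\<Sum>i<deg q d. case child q d i of None \<Rightarrow> 0
     | Some q' \<Rightarrow> visit_sum_upto n q' f (y + snd (descend i \<omega> [])) (descend i \<omega>))) \<in> borel_measurable (Omega \<mu>)" for d
    by (intro borel_measurable_add borel_measurable_const borel_measurable_sum)
  from measurable_branch[where v="[]" and H="\<lambda>d \<omega>. f y + (\<Sum>i<deg q d. case child q d i of None \<Rightarrow> 0
     | Some q' \<Rightarrow> visit_sum_upto n q' f (y + snd (descend i \<omega> [])) (descend i \<omega>))", OF this]
  show ?case by (simp only: visit_sum_upto.simps(2)[abs_def])
qed

lemma measurable_visit_sum: "visit_sum q f y \<in> borel_measurable (Omega \<mu>)"
  unfolding visit_sum_eq_SUP[abs_def] by (intro borel_measurable_SUP measurable_visit_sum_upto) auto 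

section \<open>Offspring laws and the lower bound on \<open>G\<close>\<close>

lemma nn_integral_measure_pmf_swap:
  "(\<integral>\<^sup>+ x. \<integral>\<^sup>+ y. F x y \<partial>measure_pmf q \<partial>measure_pmf p) = (\<integral>\<^sup>+ y. \<integral>\<^sup>+ x. F x y \<partial>measure_pmf p \<partial>measure_pmf q)"
proof -
  have "(\<integral>\<^sup>+ x. \<integral>\<^sup>+ y. F x y \<partial>measure_pmf q \<partial>measure_pmf p) = (\<integral>\<^sup>+ z. case_prod F z \<partial>measure_pmf (pair_pmf p q))"
    by (simp add: nn_integral_pair_pmf')
  also have "\<dots> = (\<integral>\<^sup>+ z. case_prod F (case z of (y, x) \<Rightarrow> (x, y)) \<partial>measure_pmf (pair_pmf q p))"
    by (subst pair_commute_pmf) simp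
  also have "\<dots> = (\<integral>\<^sup>+ y. \<integral>\<^sup>+ x. F x y \<partial>measure_pmf p \<partial>measure_pmf q)"
    by (simp add: nn_integral_pair_pmf')
  finally show ?thesis .
qed

text \<open>The step is integrated last, so that the inner integrals concern offspring at a fixed
  site and the outer one is the step operator.\<close>

lemma nn_integral_vdata:
  "(\<integral>\<^sup>+ d. F d \<partial>measure_pmf (vdata_pmf \<mu> :: ('d::finite) vdata pmf)) =
   (\<integral>\<^sup>+ x. \<integral>\<^sup>+ n. \<integral>\<^sup>+ s. F ((n, s), x) \<partial>measure_pmf (spec_pmf \<mu>) \<partial>measure_pmf \<mu> \<partial>measure_pmf step_pmf)"
proof -
  have "(\<integral>\<^sup>+ d. F d \<partial>measure_pmf (vdata_pmf \<mu> :: 'd vdata pmf)) =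
    (\<integral>\<^sup>+ z. \<integral>\<^sup>+ x. F (z, x) \<partial>measure_pmf step_pmf \<partial>measure_pmf (pair_pmf \<mu> (spec_pmf \<mu>)))"
    by (simp add: vdata_pmf_def nn_integral_pair_pmf')
  also have "\<dots> = (\<integral>\<^sup>+ x. \<integral>\<^sup>+ z. F (z, x) \<partial>measure_pmf (pair_pmf \<mu> (spec_pmf \<mu>)) \<partial>measure_pmf step_pmf)"
    by (rule nn_integral_measure_pmf_swap)
  finally show ?thesis by (simp add: nn_integral_pair_pmf')
qed

lemma nn_integral_pmf_const: "(\<integral>\<^sup>+ x. c \<partial>measure_pmf p) = c"
  by (simp add: measure_pmf.emeasure_space_1)

locale critical_offspring =
  fixes \<mu> :: "nat pmf"
  assumes mean: "measure_pmf.expectation \<mu> real = 1"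
    and var_pos: "measure_pmf.variance \<mu> real > 0"
begin

text \<open>The Bochner integral of a nonintegrable function is 0 by convention, so a mean of 1
  implies integrability.\<close>

lemma integrable_offspring: "integrable (measure_pmf \<mu>) real"
  using mean not_integrable_integral_eq by fastforce

lemma nn_mean: "(\<integral>\<^sup>+ n. of_nat n \<partial>measure_pmf \<mu>) = 1"
proof -
  have "(\<integral>\<^sup>+ n. of_nat n \<partial>measure_pmf \<mu>) = (\<integral>\<^sup>+ n. ennreal (real n) \<partial>measure_pmf \<mu>)"
    by (simp add: ennreal_of_nat_eq_real_of_nat)
  also have "\<dots> = ennreal (measure_pmf.expectation \<mu> real)"
    by (rule nn_integral_eq_integral[OF integrable_offspring]) simp
  finally show ?thesis by (simp add: mean)
qed

lemma pmf_size_biased: "pmf (size_biased \<mu>) i = real i * pmf \<mu> i"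
  unfolding size_biased_def
proof (rule pmf_embed_pmf)
  have "(\<integral>\<^sup>+ i. ennreal (real i * pmf \<mu> i) \<partial>count_space UNIV) = (\<integral>\<^sup>+ n. of_nat n \<partial>measure_pmf \<mu>)"
    unfolding nn_integral_measure_pmf
    by (intro nn_integral_cong) (simp add: ennreal_of_nat_eq_real_of_nat ennreal_mult'[symmetric] mult.commute)
  then show "(\<integral>\<^sup>+ i. ennreal (real i * pmf \<mu> i) \<partial>count_space UNIV) = 1" by (simp add: nn_mean)
qed simp

lemma nn_integral_size_biased:
  "(\<integral>\<^sup>+ k. F k \<partial>measure_pmf (size_biased \<mu>)) = (\<integral>\<^sup>+ k. of_nat k * F k \<partial>measure_pmf \<mu>)"
  unfolding nn_integral_measure_pmf
  by (intro nn_integral_cong)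
    (simp add: pmf_size_biased ennreal_of_nat_eq_real_of_nat ennreal_mult' mult_ac)

text \<open>A size-biased number is never 0, so the index is drawn from a nonempty set.\<close>

lemma spec_index_less: "s \<in> set_pmf (spec_pmf \<mu>) \<Longrightarrow> snd s < fst s"
proof -
  assume "s \<in> set_pmf (spec_pmf \<mu>)"
  then obtain k where k: "k \<in> set_pmf (size_biased \<mu>)" and s: "s \<in> (\<lambda>j. (k, j)) ` set_pmf (pmf_of_set {..<k})"
    by (auto simp: spec_pmf_def)
  have "k > 0" using k by (cases k) (auto simp: set_pmf_iff pmf_size_biased)
  then have set: "set_pmf (pmf_of_set {..<k}) = {..<k}" by (intro set_pmf_of_set) auto
  show ?thesis using s unfolding set by auto
qed

text \<open>A law on 0 and 1 with mean 1 is the point mass at 1, which has variance 0.\<close>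

lemma exists_two_children: "\<exists>k\<ge>2. k \<in> set_pmf \<mu>"
proof (rule ccontr)
  assume "\<not> (\<exists>k\<ge>2. k \<in> set_pmf \<mu>)"
  then have le1: "k \<le> 1" if "k \<in> set_pmf \<mu>" for k
    using that by (metis not_less_eq_eq numeral_2_eq_2 One_nat_def)
  have sub: "set_pmf \<mu> \<subseteq> {0, 1}"
  proof
    fix k assume "k \<in> set_pmf \<mu>"
    then show "k \<in> {0, 1}" using le1[of k] by (cases k) auto
  qed
  have "measure_pmf.expectation \<mu> real = (\<Sum>k\<in>{0,1}. real k * pmf \<mu> k)"
    by (subst integral_measure_pmf_real[where A="{0, 1}"]) (use sub in auto)
  then have p1: "pmf \<mu> 1 = 1" using mean by simp
  have "measure_pmf.variance \<mu> real = (\<Sum>k\<in>{0,1}. (real k - 1)\<^sup>2 * pmf \<mu> k)"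
    unfolding mean by (subst integral_measure_pmf_real[where A="{0, 1}"]) (use sub in auto)
  then have "pmf \<mu> 0 > 0" using var_pos by simp
  moreover have "(\<Sum>k\<in>{0,1}. pmf \<mu> k) = 1" by (rule sum_pmf_eq_1) (use sub in auto)
  ultimately show False using p1 by simp
qed

text \<open>\<open>e\<close> is the probability that a special vertex has a given number
  \<open>k \<ge> 2\<close> of children and the special one has index 1, so that one sibling lies to
  its left. Without such siblings the negative side would be the bare spine and would carry a single
  Green operator.\<close>

lemma exists_left_sibling_bound:
  "\<exists>e>0. ennreal e \<le> (\<integral>\<^sup>+ s. of_nat (snd s) \<partial>measure_pmf (spec_pmf \<mu>))"
proof -
  obtain k where k: "k \<ge> 2" "k \<in> set_pmf \<mu>" using exists_two_children by blast
  define e where "e = pmf (spec_pmf \<mu>) (k, 1)"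
  have "k \<in> set_pmf (size_biased \<mu>)" using k by (simp add: set_pmf_iff pmf_size_biased)
  moreover have "set_pmf (pmf_of_set {..<k}) = {..<k}" using k by (intro set_pmf_of_set) (auto simp: lessThan_empty_iff)
  ultimately have "(k, 1) \<in> set_pmf (spec_pmf \<mu>)" using k by (auto simp: spec_pmf_def intro!: bexI[of _ k])
  then have "e > 0" by (simp add: e_def set_pmf_iff pmf_positive_iff)
  moreover have "ennreal e = (\<integral>\<^sup>+ s. indicator {(k, 1)} s \<partial>measure_pmf (spec_pmf \<mu>))"
    by (simp add: e_def emeasure_pmf_single)
  then have "ennreal e \<le> (\<integral>\<^sup>+ s. of_nat (snd s) \<partial>measure_pmf (spec_pmf \<mu>))"
    by (simp only:) (intro nn_integral_mono, auto split: split_indicator)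
  ultimately show ?thesis by blast
qed

text \<open>\<open>y\<close> is the site of the parent: the step into the top vertex belongs to the
  data of that vertex.\<close>

definition mean_visits :: "kind \<Rightarrow> (int ^ 'd::finite \<Rightarrow> ennreal) \<Rightarrow> int ^ 'd \<Rightarrow> ennreal" where
  "mean_visits q f y = (\<integral>\<^sup>+ \<omega>. visit_sum q f (y + snd (\<omega> [])) \<omega> \<partial>Omega \<mu>)"

lemma measurable_visit_sum_step:
  "(\<lambda>\<omega>. visit_sum q f (y + snd (\<omega> [])) \<omega>) \<in> borel_measurable (Omega \<mu>)"
  by (rule measurable_branch[where H="\<lambda>d. visit_sum q f (y + snd d)" and v="[]"]) (rule measurable_visit_sum)

lemma mean_visits_rec:
  "mean_visits q f y = (\<integral>\<^sup>+ d. f (y + snd d) + (\<Sum>i<deg q d. case child q d i of None \<Rightarrow> 0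
      | Some q' \<Rightarrow> mean_visits q' f (y + snd d)) \<partial>measure_pmf (vdata_pmf \<mu>))"
proof -
  define H where "H d i = (case child q d i of None \<Rightarrow> (\<lambda>_. 0)
      | Some q' \<Rightarrow> (\<lambda>\<omega>. visit_sum q' f (y + snd d + snd (\<omega> [])) \<omega>))" for d :: "'a vdata" and i
  have H: "H d i \<in> borel_measurable (Omega \<mu>)" for d i
    by (cases "child q d i") (simp_all add: H_def measurable_visit_sum_step)
  have "mean_visits q f y = (\<integral>\<^sup>+ \<omega>. f (y + snd (\<omega> [])) +
      (\<Sum>i<deg q (\<omega> []). H (\<omega> []) i (descend i \<omega>)) \<partial>Omega \<mu>)"
    unfolding mean_visits_def
    by (intro nn_integral_cong, subst visit_sum_rec)
      (auto intro!: sum.cong simp: H_def split: option.split)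
  also have "\<dots> = (\<integral>\<^sup>+ d. f (y + snd d) + (\<Sum>i<deg q d. \<integral>\<^sup>+ \<omega>. H d i \<omega> \<partial>Omega \<mu>) \<partial>measure_pmf (vdata_pmf \<mu>))"
    by (rule nn_integral_branch_sum[where c="\<lambda>d. f (y + snd d)" and k="deg q" and H=H, OF H])
  also have "\<dots> = (\<integral>\<^sup>+ d. f (y + snd d) + (\<Sum>i<deg q d. case child q d i of None \<Rightarrow> 0
      | Some q' \<Rightarrow> mean_visits q' f (y + snd d)) \<partial>measure_pmf (vdata_pmf \<mu>))"
    by (intro nn_integral_cong arg_cong2[where f="(+)"] refl sum.cong)
      (auto simp: H_def mean_visits_def split: option.split)
  finally show ?thesis .
qed

text \<open>Criticality enters through \<open>nn_mean\<close>: with one child on average, all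
  generations have the same expected weight, as the steps of a single walk do.\<close>

lemma mean_visits_Normal:
  "mean_visits Normal f y = conv stepk f y + conv stepk (mean_visits Normal f) y"
proof -
  have "mean_visits Normal f y =
    (\<integral>\<^sup>+ x. \<integral>\<^sup>+ n. f (y + x) + of_nat n * mean_visits Normal f (y + x) \<partial>measure_pmf \<mu> \<partial>measure_pmf step_pmf)"
    by (subst mean_visits_rec) (simp add: nn_integral_vdata nn_integral_pmf_const)
  also have "\<dots> = (\<integral>\<^sup>+ x. f (y + x) + mean_visits Normal f (y + x) \<partial>measure_pmf step_pmf)"
    by (simp add: nn_integral_add nn_integral_multc nn_mean nn_integral_pmf_const)
  finally show ?thesis by (simp add: conv_stepk nn_integral_add)
qed

text \<open>Only the normal trees to the left and the continuation of the spine are kept; the visit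
  of the spine vertex itself is dropped, hence an inequality.\<close>

lemma mean_visits_Left:
  "(\<integral>\<^sup>+ s. of_nat (snd s) \<partial>measure_pmf (spec_pmf \<mu>)) * conv stepk (mean_visits Normal f) y
    + conv stepk (mean_visits Left f) y \<le> mean_visits Left f y"
proof -
  let ?N = "mean_visits Normal f" and ?L = "mean_visits Left f"
  have "(\<integral>\<^sup>+ s. of_nat (snd s) \<partial>measure_pmf (spec_pmf \<mu>)) * conv stepk ?N y + conv stepk ?L y =
    (\<integral>\<^sup>+ x. (\<integral>\<^sup>+ s. of_nat (snd s) \<partial>measure_pmf (spec_pmf \<mu>)) * ?N (y + x) + ?L (y + x) \<partial>measure_pmf step_pmf)"
    by (simp add: conv_stepk nn_integral_add nn_integral_cmult)
  also have "\<dots> = (\<integral>\<^sup>+ x. \<integral>\<^sup>+ n. \<integral>\<^sup>+ s. of_nat (snd s) * ?N (y + x) + ?L (y + x)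
      \<partial>measure_pmf (spec_pmf \<mu>) \<partial>measure_pmf \<mu> \<partial>measure_pmf step_pmf)"
    by (simp add: nn_integral_add nn_integral_multc nn_integral_pmf_const)
  also have "\<dots> \<le> (\<integral>\<^sup>+ x. \<integral>\<^sup>+ n. \<integral>\<^sup>+ s. f (y + x) + (\<Sum>i<fst s. case child Left ((n, s), x) i of None \<Rightarrow> 0
      | Some q' \<Rightarrow> mean_visits q' f (y + x)) \<partial>measure_pmf (spec_pmf \<mu>) \<partial>measure_pmf \<mu> \<partial>measure_pmf step_pmf)"
  proof (rule nn_integral_mono, rule nn_integral_mono, rule nn_integral_mono_AE, rule AE_pmfI)
    fix x n s assume "s \<in> set_pmf (spec_pmf \<mu>)"
    then have lt: "snd s < fst s" by (rule spec_index_less)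
    \<comment> \<open>The indices below \<open>snd s\<close> are the left siblings and
      \<open>snd s\<close> itself is the spine child. All of them exist because
      \<open>snd s < fst s\<close>.\<close>
    have "of_nat (snd s) * ?N (y + x) + ?L (y + x) = (\<Sum>i<Suc (snd s). case child Left ((n, s), x) i of None \<Rightarrow> 0
      | Some q' \<Rightarrow> mean_visits q' f (y + x))"
      by simp
    also have "\<dots> \<le> (\<Sum>i<fst s. case child Left ((n, s), x) i of None \<Rightarrow> 0
      | Some q' \<Rightarrow> mean_visits q' f (y + x))"
      using lt by (intro sum_mono2) auto
    also have "\<dots> \<le> f (y + x) + \<dots>" by simp
    finally show "of_nat (snd s) * ?N (y + x) + ?L (y + x) \<le> f (y + x) + (\<Sum>i<fst s. case child Left ((n, s), x) i of None \<Rightarrow> 0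
      | Some q' \<Rightarrow> mean_visits q' f (y + x))" .
  qed
  also have "\<dots> = mean_visits Left f y"
    unfolding mean_visits_rec[of Left f y] nn_integral_vdata fst_conv snd_conv deg.simps by simp
  finally show ?thesis .
qed

text \<open>Minimality of the Green potential: by induction every partial sum of the series lies
  below any supersolution with source \<open>A\<close>. Possibly infinite values of \<open>H\<close>
  do no harm.\<close>

lemma green_le_supersolution:
  assumes "\<And>y. A y + conv stepk H y \<le> H y"
  shows "green A y \<le> H y"
proof -
  have "(\<Sum>i<n. (conv stepk ^^ i) A y) \<le> H y" for n y
  proof (induction n arbitrary: y)
    case (Suc n)
    have sum: "(\<Sum>i<n. (conv stepk ^^ Suc i) A y) = conv stepk (\<lambda>z. \<Sum>i<n. (conv stepk ^^ i) A z) y"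
      by (simp add: conv_stepk nn_integral_sum)
    have "(\<Sum>i<Suc n. (conv stepk ^^ i) A y) = A y + conv stepk (\<lambda>z. \<Sum>i<n. (conv stepk ^^ i) A z) y"
      unfolding sum[symmetric] by (simp add: sum.lessThan_Suc_shift del: sum.lessThan_Suc)
    also have "\<dots> \<le> A y + conv stepk H y" by (intro add_left_mono conv_mono_right Suc)
    also have "\<dots> \<le> H y" by (rule assms)
    finally show ?case .
  qed simp
  then show ?thesis unfolding green_def by (intro suminf_le_const summableI) auto
qed

lemma green_cmult: "green (\<lambda>y. c * A y) y = c * green A y"
  unfolding green_def by (simp add: conv_pow_cmult)

text \<open>Minimality is applied inside the normal trees and then along the spine. The Green
  operator commutes with the step operator, which collects both steps in front.\<close>

lemma mean_visits_Left_ge: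
  assumes "ennreal e \<le> (\<integral>\<^sup>+ s. of_nat (snd s) \<partial>measure_pmf (spec_pmf \<mu>))"
  shows "ennreal e * conv stepk (conv stepk (green (green f))) y \<le> mean_visits Left f y"
proof -
  have N: "green (conv stepk f) y \<le> mean_visits Normal f y" for y
    by (rule green_le_supersolution) (subst (2) mean_visits_Normal, simp)
  have "green (\<lambda>y. ennreal e * conv stepk (green (conv stepk f)) y) y \<le> mean_visits Left f y"
  proof (rule green_le_supersolution)
    fix y
    have "ennreal e * conv stepk (green (conv stepk f)) y \<le>
      (\<integral>\<^sup>+ s. of_nat (snd s) \<partial>measure_pmf (spec_pmf \<mu>)) * conv stepk (mean_visits Normal f) y"
      by (intro mult_mono assms conv_mono_right N) auto
    then show "ennreal e * conv stepk (green (conv stepk f)) y + conv stepk (mean_visits Left f) y \<le> mean_visits Left f y"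
      using mean_visits_Left[of f y] by (meson add_right_mono order_trans)
  qed
  then show ?thesis by (simp add: green_cmult green_conv)
qed

text \<open>The first child of the root starts the special part, and the data below it are again a
  sample of the product measure.\<close>

lemma G_ge_mean_visits_Left: "mean_visits Left (indicator {y}) x \<le> G \<mu> x y"
proof -
  let ?V = "\<lambda>\<omega>. visit_sum Left (indicator {y}) (x + snd (\<omega> [])) \<omega>"
  have "mean_visits Left (indicator {y}) x = (\<integral>\<^sup>+ \<omega>. ?V (descend 0 \<omega>) \<partial>Omega \<mu>)"
    unfolding mean_visits_def by (rule nn_integral_descend[OF measurable_visit_sum_step, symmetric])
  also have "\<dots> \<le> G \<mu> x y"
    unfolding G_def
  proof (rule nn_integral_mono)
    fix \<omega>
    let ?F = "\<lambda>u. indicator (Tminus \<omega>) u * indicator {y} (S \<omega> x u) :: ennreal"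
    have "?V (descend 0 \<omega>) \<le> (\<integral>\<^sup>+ u. ?F (0 # u) \<partial>count_space UNIV)"
      unfolding visit_sum_def S_Cons using mem_Left_in_Tminus[of \<omega>]
      by (intro nn_integral_mono mult_right_mono) (auto split: split_indicator)
    also have "\<dots> = (\<integral>\<^sup>+ i. (\<integral>\<^sup>+ u. ?F (i # u) \<partial>count_space UNIV) * indicator {0} i \<partial>count_space UNIV)"
      by (simp add: nn_integral_indicator_singleton)
    also have "\<dots> \<le> (\<integral>\<^sup>+ i. (\<integral>\<^sup>+ u. ?F (i # u) \<partial>count_space UNIV) \<partial>count_space UNIV)"
      by (intro nn_integral_mono) (auto split: split_indicator)
    also have "\<dots> \<le> (\<integral>\<^sup>+ u. ?F u \<partial>count_space UNIV)"
      using nn_integral_list_split[of ?F] by (simp only: le_iff_add add.commute) blast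
    finally show "?V (descend 0 \<omega>) \<le> (\<integral>\<^sup>+ u. ?F u \<partial>count_space UNIV)" .
  qed
  finally show ?thesis .
qed

lemma visit_sum_superposition:
  "(\<integral>\<^sup>+ z. visit_sum q (indicator {z}) y \<omega> * f z \<partial>count_space UNIV) = visit_sum q f y \<omega>"
proof -
  have "(\<integral>\<^sup>+ z. visit_sum q (indicator {z}) y \<omega> * f z \<partial>count_space UNIV) =
    (\<integral>\<^sup>+ z. \<integral>\<^sup>+ u. indicator {u. mem q \<omega> u} u * indicator {z} (S \<omega> y u) * f z \<partial>count_space UNIV \<partial>count_space UNIV)"
    by (simp add: visit_sum_def nn_integral_multc)
  also have "\<dots> = (\<integral>\<^sup>+ u. \<integral>\<^sup>+ z. indicator {u. mem q \<omega> u} u * indicator {z} (S \<omega> y u) * f z \<partial>count_space UNIV \<partial>count_space UNIV)"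
    by (rule nn_integral_count_space_swap)
  also have "\<dots> = visit_sum q f y \<omega>"
    unfolding visit_sum_def
  proof (rule nn_integral_cong)
    fix u
    have "(\<integral>\<^sup>+ z. indicator {u. mem q \<omega> u} u * indicator {z} (S \<omega> y u) * f z \<partial>count_space UNIV) =
      (\<integral>\<^sup>+ z. (indicator {u. mem q \<omega> u} u * f z) * indicator {S \<omega> y u} z \<partial>count_space UNIV)"
      by (intro nn_integral_cong) (auto split: split_indicator)
    then show "(\<integral>\<^sup>+ z. indicator {u. mem q \<omega> u} u * indicator {z} (S \<omega> y u) * f z \<partial>count_space UNIV) =
      indicator {u. mem q \<omega> u} u * f (S \<omega> y u)"
      by (simp add: nn_integral_indicator_singleton)
  qed
  finally show ?thesis .
qed

lemma mean_visits_Left_le_G: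
  "mean_visits Left f x \<le> (\<integral>\<^sup>+ z. G \<mu> x z * f z \<partial>count_space UNIV)"
proof -
  let ?V = "\<lambda>f \<omega>. visit_sum Left f (x + snd (\<omega> [])) \<omega>"
  have "mean_visits Left f x = (\<integral>\<^sup>+ \<omega>. \<integral>\<^sup>+ z. ?V (indicator {z}) \<omega> * f z \<partial>count_space UNIV \<partial>Omega \<mu>)"
    by (simp add: mean_visits_def visit_sum_superposition)
  also have "\<dots> = (\<integral>\<^sup>+ z. \<integral>\<^sup>+ \<omega>. ?V (indicator {z}) \<omega> * f z \<partial>Omega \<mu> \<partial>count_space UNIV)"
    by (rule nn_integral_count_space_nn_integral)
      (auto intro!: borel_measurable_times_ennreal measurable_visit_sum_step)
  also have "\<dots> = (\<integral>\<^sup>+ z. mean_visits Left (indicator {z}) x * f z \<partial>count_space UNIV)"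
    by (simp add: mean_visits_def nn_integral_multc measurable_visit_sum_step)
  also have "\<dots> \<le> (\<integral>\<^sup>+ z. G \<mu> x z * f z \<partial>count_space UNIV)"
    by (intro nn_integral_mono mult_right_mono G_ge_mean_visits_Left) auto
  finally show ?thesis .
qed

text \<open>The two steps in front of the double Green potential cost the factor 2d, the left
  siblings the factor 1/e.\<close>

theorem green_green_le_G:
  "\<exists>C\<ge>0. \<forall>(f :: int^'d::finite \<Rightarrow> ennreal) B. (\<forall>x. (\<integral>\<^sup>+ z. G \<mu> x z * f z \<partial>count_space UNIV) \<le> B)
    \<longrightarrow> (\<forall>x. green (green f) x \<le> ennreal C * B)"
proof -
  obtain e where e: "e > 0" "ennreal e \<le> (\<integral>\<^sup>+ s. of_nat (snd s) \<partial>measure_pmf (spec_pmf \<mu>))"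
    using exists_left_sibling_bound by (elim exE conjE)
  define C where "C = 2 * real CARD('d) / e"
  have "green (green f) x \<le> ennreal C * B"
    if "\<And>x. (\<integral>\<^sup>+ z. G \<mu> x z * f z \<partial>count_space UNIV) \<le> B" for f :: "int^'d \<Rightarrow> ennreal" and B x
  proof -
    have "green (green f) x \<le> ennreal (2 * real CARD('d)) * conv stepk (conv stepk (green (green f))) x"
      by (rule conv_stepk_twice_ge)
    also have "\<dots> = ennreal C * (ennreal e * conv stepk (conv stepk (green (green f))) x)"
      using e by (simp add: C_def mult.assoc[symmetric] ennreal_mult'[symmetric])
    also have "\<dots> \<le> ennreal C * B"
      using mean_visits_Left_ge[OF e(2), of f x] mean_visits_Left_le_G[of f x] that[of x]
      by (intro mult_left_mono) auto
    finally show ?thesis .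
  qed
  moreover have "C \<ge> 0" using e by (simp add: C_def)
  ultimately show ?thesis by blast
qed

end

section \<open>Exponential moments\<close>

lemma exp_ennreal_ennreal: "r \<ge> 0 \<Longrightarrow> exp_ennreal (ennreal r) = ennreal (exp r)"
  by (simp add: exp_ennreal_def)

lemma exp_ennreal_0: "exp_ennreal 0 = 1"
  by (simp add: exp_ennreal_def)

lemma exp_ennreal_top: "exp_ennreal \<infinity> = \<infinity>"
  by (simp add: exp_ennreal_def)

lemma exp_ennreal_ge: "exp_ennreal a \<ge> 1 + a"
proof (cases a)
  case (real r)
  have "ennreal (1 + r) \<le> ennreal (exp r)" by (rule ennreal_leI) simp
  then show ?thesis using real by (simp add: exp_ennreal_ennreal)
next
  case top
  then show ?thesis using exp_ennreal_top by simp
qed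

text \<open>Needed for multiplicativity at infinity, since 0 times infinity is 0 in
  \<open>ennreal\<close>.\<close>

lemma exp_ennreal_nonzero: "exp_ennreal a \<noteq> 0"
  using exp_ennreal_ge[of a] by auto

lemma exp_ennreal_add: "exp_ennreal (a + b) = exp_ennreal a * exp_ennreal b"
proof (cases "a = \<infinity> \<or> b = \<infinity>")
  case True
  then show ?thesis
    using exp_ennreal_nonzero[of a] exp_ennreal_nonzero[of b] exp_ennreal_top
    by (auto simp: ennreal_mult_top ennreal_top_mult)
next
  case False
  then obtain r s where "a = ennreal r" "b = ennreal s" "r \<ge> 0" "s \<ge> 0"
    by (cases a; cases b) auto
  then show ?thesis
    by (simp add: exp_ennreal_ennreal exp_add ennreal_mult ennreal_plus[symmetric] del: ennreal_plus)
qed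

lemma exp_ennreal_sum: "exp_ennreal (\<Sum>i\<in>A. f i) = (\<Prod>i\<in>A. exp_ennreal (f i))"
  by (induction A rule: infinite_finite_induct) (auto simp: exp_ennreal_0 exp_ennreal_add)

lemma exp_ennreal_mono: "a \<le> b \<Longrightarrow> exp_ennreal a \<le> exp_ennreal b"
proof -
  assume "a \<le> b"
  then obtain c where "b = a + c" by (auto simp: le_iff_add)
  then have "exp_ennreal b = exp_ennreal a * exp_ennreal c" by (simp add: exp_ennreal_add)
  also have "\<dots> \<ge> exp_ennreal a * 1"
    using exp_ennreal_ge[of c] by (intro mult_left_mono) (auto intro: order_trans[rotated])
  finally show ?thesis by simp
qed

text \<open>For a finite supremum this is continuity of the real exponential; for an infinite one
  the inequality exp t >= t suffices.\<close>

lemma exp_ennreal_SUP: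
  assumes "incseq Z"
  shows "exp_ennreal (SUP n. Z n) = (SUP n. exp_ennreal (Z n))"
proof (rule antisym)
  show "exp_ennreal (SUP n. Z n) \<le> (SUP n. exp_ennreal (Z n))"
  proof (cases "SUP n. Z n")
    case top
    have "(SUP n. Z n) \<le> (SUP n. exp_ennreal (Z n))"
      by (intro SUP_subset_mono order_refl order_trans[OF _ exp_ennreal_ge]) auto
    then have "(SUP n. exp_ennreal (Z n)) = top" unfolding top by (simp only: top_unique)
    then show ?thesis by (simp only: top_greatest)
  next
    case (real r)
    have le: "Z n \<le> ennreal r" for n unfolding real(2)[symmetric] by (rule SUP_upper) simp
    define z where "z n = enn2real (Z n)" for n
    have z: "Z n = ennreal (z n)" "z n \<ge> 0" for n
      using le[of n] by (auto simp: z_def intro!: ennreal_enn2real[symmetric] le_less_trans[OF le[of n]])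
    have "(\<lambda>n. Z n) \<longlonglongrightarrow> ennreal r" using LIMSEQ_SUP[OF assms] real by simp
    then have "(\<lambda>n. ennreal (z n)) \<longlonglongrightarrow> ennreal r" by (simp add: z(1))
    then have "z \<longlonglongrightarrow> r" using real(1) z(2) by (intro tendsto_ennrealD) auto
    then have "(\<lambda>n. ennreal (exp (z n))) \<longlonglongrightarrow> ennreal (exp r)"
      by (intro tendsto_ennrealI tendsto_exp)
    then have "ennreal (exp r) \<le> (SUP n. exp_ennreal (Z n))"
    proof (rule LIMSEQ_le_const2)
      have "ennreal (exp (z n)) \<le> (SUP n. exp_ennreal (Z n))" for n
        using SUP_upper[of n UNIV "\<lambda>n. exp_ennreal (Z n)"] z(2)[of n] by (simp add: z(1) exp_ennreal_ennreal)
      then show "\<exists>N. \<forall>n\<ge>N. ennreal (exp (z n)) \<le> (SUP n. exp_ennreal (Z n))" by blast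
    qed
    then show ?thesis using real by (simp add: exp_ennreal_ennreal)
  qed
  show "(SUP n. exp_ennreal (Z n)) \<le> exp_ennreal (SUP n. Z n)"
    by (intro SUP_least exp_ennreal_mono SUP_upper) simp
qed

lemma measurable_exp_ennreal:
  assumes [measurable]: "f \<in> borel_measurable M"
  shows "(\<lambda>x. exp_ennreal (f x)) \<in> borel_measurable M"
  unfolding exp_ennreal_def by measurable

lemma exp_le_linear: "exp x \<le> 1 + x * exp (x::real)"
proof -
  have "1 - x \<le> exp (- x)" using exp_ge_add_one_self[of "-x"] by simp
  then have "exp x * (1 - x) \<le> exp x * exp (- x)" by (intro mult_left_mono) auto
  then show ?thesis by (simp add: exp_minus algebra_simps)
qed

text \<open>The linear bound is inserted into itself. The factor \<open>exp x\<close> in the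
  remainder is harmless, since an exponential moment will absorb it.\<close>

lemma exp_le_quadratic: "x \<ge> 0 \<Longrightarrow> exp x \<le> 1 + x + x\<^sup>2 * exp (x::real)"
proof -
  assume x: "x \<ge> 0"
  have "x * exp x \<le> x * (1 + x * exp x)" using x exp_le_linear by (intro mult_left_mono)
  then show ?thesis using exp_le_linear[of x] by (simp add: algebra_simps power2_eq_square)
qed

lemma one_plus_power_le_exp: "s \<ge> 0 \<Longrightarrow> (1 + s) ^ n \<le> exp (s * real n)"
proof -
  assume "s \<ge> 0"
  then have "(1 + s) ^ n \<le> exp s ^ n" by (intro power_mono) auto
  then show ?thesis by (simp add: exp_of_nat_mult[symmetric] mult.commute)
qed

lemma prod_mono_ennreal:
  fixes f g :: "'a \<Rightarrow> ennreal"
  shows "(\<And>i. i \<in> A \<Longrightarrow> f i \<le> g i) \<Longrightarrow> (\<Prod>i\<in>A. f i) \<le> (\<Prod>i\<in>A. g i)"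
  by (induction A rule: infinite_finite_induct) (auto intro!: mult_mono)

section \<open>Exponential moments of the offspring laws\<close>

locale exp_critical_offspring = critical_offspring +
  assumes expmom: "\<exists>l>0. summable (\<lambda>i. exp (l * real i) * pmf \<mu> i)"
begin

text \<open>Half of the exponential rate is spent on the square: the quadratic Taylor term of exp (l
  n / 2) gives n^2 <= (8 / l^2) exp (l n / 2).\<close>

lemma exists_exp_second_moment:
  "\<exists>r>0. \<exists>M\<ge>0. (\<integral>\<^sup>+ n. ennreal ((real n)\<^sup>2 * exp (r * real n)) \<partial>measure_pmf \<mu>) \<le> ennreal M"
proof -
  obtain l where l: "l > 0" and sm: "summable (\<lambda>i. exp (l * real i) * pmf \<mu> i)" using expmom by blast
  define E where "E = (\<Sum>i. exp (l * real i) * pmf \<mu> i)"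
  have E0: "E \<ge> 0" unfolding E_def by (rule suminf_nonneg[OF sm]) simp
  have "(\<integral>\<^sup>+ n. ennreal (exp (l * real n)) \<partial>measure_pmf \<mu>) = (\<Sum>i. ennreal (exp (l * real i) * pmf \<mu> i))"
    unfolding nn_integral_measure_pmf nn_integral_count_space_nat
    by (intro suminf_cong) (simp add: ennreal_mult'[symmetric] mult.commute)
  also have "\<dots> = ennreal E" unfolding E_def by (rule suminf_ennreal2[OF _ sm]) simp
  finally have E: "(\<integral>\<^sup>+ n. ennreal (exp (l * real n)) \<partial>measure_pmf \<mu>) = ennreal E" .
  define M where "M = 8 / l\<^sup>2 * E"
  have "(real n)\<^sup>2 * exp (l / 2 * real n) \<le> 8 / l\<^sup>2 * exp (l * real n)" for n
  proof -
    have "1 + l / 2 * real n + (l / 2 * real n)\<^sup>2 / 2 \<le> exp (l / 2 * real n)"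
      using l by (intro exp_lower_Taylor_quadratic) simp
    then have "(l / 2 * real n)\<^sup>2 / 2 \<le> exp (l / 2 * real n)"
      using l by (smt (verit) divide_nonneg_nonneg mult_nonneg_nonneg of_nat_0_le_iff)
    then have "(real n)\<^sup>2 \<le> 8 / l\<^sup>2 * exp (l / 2 * real n)"
      using l by (simp add: field_simps power2_eq_square)
    then have "(real n)\<^sup>2 * exp (l / 2 * real n) \<le> 8 / l\<^sup>2 * exp (l / 2 * real n) * exp (l / 2 * real n)"
      by (intro mult_right_mono) auto
    then show ?thesis by (simp add: mult.assoc exp_add[symmetric])
  qed
  then have "(\<integral>\<^sup>+ n. ennreal ((real n)\<^sup>2 * exp (l / 2 * real n)) \<partial>measure_pmf \<mu>) \<le>
     (\<integral>\<^sup>+ n. ennreal (8 / l\<^sup>2) * ennreal (exp (l * real n)) \<partial>measure_pmf \<mu>)"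
    by (intro nn_integral_mono) (simp add: ennreal_mult'[symmetric] ennreal_leI)
  also have "\<dots> = ennreal (8 / l\<^sup>2) * ennreal E" by (simp add: nn_integral_cmult E)
  also have "\<dots> = ennreal M" unfolding M_def by (rule ennreal_mult[symmetric]) (use E0 in auto)
  finally show ?thesis using l E0 by (intro exI[of _ "l/2"] conjI exI[of _ M]) (auto simp: M_def)
qed

lemma nn_integral_spec_fst:
  "(\<integral>\<^sup>+ s. F (fst s) \<partial>measure_pmf (spec_pmf \<mu>)) = (\<integral>\<^sup>+ k. of_nat k * F k \<partial>measure_pmf \<mu>)"
  unfolding nn_integral_size_biased[symmetric] spec_pmf_def by (simp add: nn_integral_pmf_const)

text \<open>Expansion of the two generating functions at 1. For the offspring law the linear
  coefficient is exactly the mean 1, so the error must be of second order. For the size-biased law a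
  first-order error is enough, as it is charged once per spine vertex.\<close>

lemma exp_moment_bounds:
  "\<exists>r>0. \<exists>M\<ge>0. \<forall>s\<ge>0. s \<le> r \<longrightarrow>
    (\<integral>\<^sup>+ n. (1 + ennreal s) ^ n \<partial>measure_pmf \<mu>) \<le> ennreal (1 + s + M * s\<^sup>2) \<and>
    (\<integral>\<^sup>+ z. (1 + ennreal s) ^ fst z \<partial>measure_pmf (spec_pmf \<mu>)) \<le> ennreal (1 + M * s)"
proof -
  obtain r M where r: "r > 0" and M: "M \<ge> 0"
    and bd: "(\<integral>\<^sup>+ n. ennreal ((real n)\<^sup>2 * exp (r * real n)) \<partial>measure_pmf \<mu>) \<le> ennreal M"
    using exists_exp_second_moment by blast
  let ?q = "\<lambda>n. ennreal ((real n)\<^sup>2 * exp (r * real n))"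
  have mean': "(\<integral>\<^sup>+ n. ennreal (real n) \<partial>measure_pmf \<mu>) = 1"
    using nn_mean by (simp add: ennreal_of_nat_eq_real_of_nat)
  have "(\<integral>\<^sup>+ n. (1 + ennreal s) ^ n \<partial>measure_pmf \<mu>) \<le> ennreal (1 + s + M * s\<^sup>2) \<and>
    (\<integral>\<^sup>+ z. (1 + ennreal s) ^ fst z \<partial>measure_pmf (spec_pmf \<mu>)) \<le> ennreal (1 + M * s)"
    if s: "s \<ge> 0" "s \<le> r" for s
  proof
    have pow: "(1 + ennreal s) ^ n = ennreal ((1 + s) ^ n)" for n
      using s by (simp add: ennreal_power[symmetric])
    have exp_mono: "exp (s * real n) \<le> exp (r * real n)" for n
      using s by (simp add: mult_right_mono)
    have p1: "(1 + s) ^ n \<le> 1 + s * real n + s\<^sup>2 * ((real n)\<^sup>2 * exp (r * real n))" for n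
    proof -
      have "(1 + s) ^ n \<le> exp (s * real n)" by (rule one_plus_power_le_exp[OF s(1)])
      also have "\<dots> \<le> 1 + s * real n + (s * real n)\<^sup>2 * exp (s * real n)"
        using s by (intro exp_le_quadratic) simp
      also have "(s * real n)\<^sup>2 * exp (s * real n) \<le> (s * real n)\<^sup>2 * exp (r * real n)"
        using exp_mono by (intro mult_left_mono) auto
      finally show ?thesis by (simp add: power_mult_distrib mult.assoc)
    qed
    have p2: "real n * (1 + s) ^ n \<le> real n + s * ((real n)\<^sup>2 * exp (r * real n))" for n
    proof -
      have "(1 + s) ^ n \<le> exp (s * real n)" by (rule one_plus_power_le_exp[OF s(1)])
      also have "\<dots> \<le> 1 + s * real n * exp (s * real n)" by (rule exp_le_linear)
      also have "s * real n * exp (s * real n) \<le> s * real n * exp (r * real n)"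
        using exp_mono s by (intro mult_left_mono) auto
      finally have "real n * (1 + s) ^ n \<le> real n * (1 + s * real n * exp (r * real n))"
        by (intro mult_left_mono) auto
      then show ?thesis by (simp add: algebra_simps power2_eq_square)
    qed
    have "(\<integral>\<^sup>+ n. (1 + ennreal s) ^ n \<partial>measure_pmf \<mu>) \<le>
      (\<integral>\<^sup>+ n. 1 + ennreal s * ennreal (real n) + ennreal (s\<^sup>2) * ?q n \<partial>measure_pmf \<mu>)"
      unfolding pow
    proof (rule nn_integral_mono)
      fix n
      have "ennreal ((1 + s) ^ n) \<le> ennreal (1 + s * real n + s\<^sup>2 * ((real n)\<^sup>2 * exp (r * real n)))"
        by (rule ennreal_leI[OF p1])
      also have "\<dots> = 1 + ennreal s * ennreal (real n) + ennreal (s\<^sup>2) * ?q n"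
        using s by (simp add: ennreal_mult[symmetric])
      finally show "ennreal ((1 + s) ^ n) \<le> 1 + ennreal s * ennreal (real n) + ennreal (s\<^sup>2) * ?q n" .
    qed
    also have "\<dots> = 1 + ennreal s + ennreal (s\<^sup>2) * (\<integral>\<^sup>+ n. ?q n \<partial>measure_pmf \<mu>)"
      by (simp add: nn_integral_add nn_integral_cmult nn_integral_pmf_const mean')
    also have "\<dots> \<le> 1 + ennreal s + ennreal (s\<^sup>2) * ennreal M"
      using bd by (intro add_left_mono mult_left_mono) auto
    also have "\<dots> = ennreal (1 + s + M * s\<^sup>2)" using s M by (simp add: ennreal_mult mult.commute)
    finally show "(\<integral>\<^sup>+ n. (1 + ennreal s) ^ n \<partial>measure_pmf \<mu>) \<le> ennreal (1 + s + M * s\<^sup>2)" .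
    have "(\<integral>\<^sup>+ z. (1 + ennreal s) ^ fst z \<partial>measure_pmf (spec_pmf \<mu>)) =
      (\<integral>\<^sup>+ n. ennreal (real n * (1 + s) ^ n) \<partial>measure_pmf \<mu>)"
      unfolding pow nn_integral_spec_fst[where F="\<lambda>n. ennreal ((1 + s) ^ n)"]
      by (simp add: ennreal_of_nat_eq_real_of_nat ennreal_mult')
    also have "\<dots> \<le> (\<integral>\<^sup>+ n. ennreal (real n) + ennreal s * ?q n \<partial>measure_pmf \<mu>)"
    proof (rule nn_integral_mono)
      fix n
      have "ennreal (real n * (1 + s) ^ n) \<le> ennreal (real n + s * ((real n)\<^sup>2 * exp (r * real n)))"
        by (rule ennreal_leI[OF p2])
      then show "ennreal (real n * (1 + s) ^ n) \<le> ennreal (real n) + ennreal s * ?q n"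
        using s by (simp add: ennreal_mult[symmetric])
    qed
    also have "\<dots> = 1 + ennreal s * (\<integral>\<^sup>+ n. ?q n \<partial>measure_pmf \<mu>)"
      by (simp add: nn_integral_add nn_integral_cmult mean')
    also have "\<dots> \<le> 1 + ennreal s * ennreal M"
      using bd by (intro add_left_mono mult_left_mono) auto
    also have "\<dots> = ennreal (1 + M * s)" using s M by (simp add: ennreal_mult mult.commute)
    finally show "(\<integral>\<^sup>+ z. (1 + ennreal s) ^ fst z \<partial>measure_pmf (spec_pmf \<mu>)) \<le> ennreal (1 + M * s)" .
  qed
  then show ?thesis using r M by blast
qed

section \<open>Comparison of the exponential recursions with supersolutions\<close>

definition mean_exp :: "nat \<Rightarrow> kind \<Rightarrow> (int ^ 'd::finite \<Rightarrow> ennreal) \<Rightarrow> int ^ 'd \<Rightarrow> ennreal" where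
  "mean_exp n q f y = (\<integral>\<^sup>+ \<omega>. exp_ennreal (visit_sum_upto n q f (y + snd (\<omega> [])) \<omega>) \<partial>Omega \<mu>)"

lemma measurable_exp_visit_sum_upto:
  "(\<lambda>\<omega>. exp_ennreal (visit_sum_upto n q f (y + snd (\<omega> [])) \<omega>)) \<in> borel_measurable (Omega \<mu>)"
  by (intro measurable_exp_ennreal measurable_branch[where H="\<lambda>d. visit_sum_upto n q f (y + snd d)" and v="[]"])
    (rule measurable_visit_sum_upto)

text \<open>\<open>\<tau>\<close> is the site of the top vertex as a function of its data. One
  identity thus covers vertices entered by a step and the root of the tree, whose site is
  fixed.\<close>

lemma nn_integral_exp_visit_sum_upto_Suc:
  fixes \<tau> :: "('d::finite) vdata \<Rightarrow> int^'d"
  shows "(\<integral>\<^sup>+ \<omega>. exp_ennreal (visit_sum_upto (Suc n) q f (\<tau> (\<omega> [])) \<omega>) \<partial>Omega \<mu>) =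
    (\<integral>\<^sup>+ d. exp_ennreal (f (\<tau> d)) * (\<Prod>i<deg q d. case child q d i of None \<Rightarrow> 1
      | Some q' \<Rightarrow> mean_exp n q' f (\<tau> d)) \<partial>measure_pmf (vdata_pmf \<mu>))"
proof -
  define H where "H d i = (case child q d i of None \<Rightarrow> (\<lambda>_. 1)
      | Some q' \<Rightarrow> (\<lambda>\<omega>. exp_ennreal (visit_sum_upto n q' f (\<tau> d + snd (\<omega> [])) \<omega>)))" for d :: "'d vdata" and i
  have H: "H d i \<in> borel_measurable (Omega \<mu>)" for d i
    by (cases "child q d i") (simp_all add: H_def measurable_exp_visit_sum_upto)
  have "(\<integral>\<^sup>+ \<omega>. exp_ennreal (visit_sum_upto (Suc n) q f (\<tau> (\<omega> [])) \<omega>) \<partial>Omega \<mu>) =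
     (\<integral>\<^sup>+ \<omega>. exp_ennreal (f (\<tau> (\<omega> []))) * (\<Prod>i<deg q (\<omega> []). H (\<omega> []) i (descend i \<omega>)) \<partial>Omega \<mu>)"
    by (intro nn_integral_cong)
      (auto simp: exp_ennreal_add exp_ennreal_sum H_def exp_ennreal_0 split: option.split
        intro!: arg_cong2[where f="(*)"] prod.cong)
  also have "\<dots> = (\<integral>\<^sup>+ d. exp_ennreal (f (\<tau> d)) * (\<Prod>i<deg q d. \<integral>\<^sup>+ \<omega>. H d i \<omega> \<partial>Omega \<mu>) \<partial>measure_pmf (vdata_pmf \<mu>))"
    by (rule nn_integral_branch_prod[where c="\<lambda>d. exp_ennreal (f (\<tau> d))" and k="deg q" and H=H, OF H])
  also have "\<dots> = (\<integral>\<^sup>+ d. exp_ennreal (f (\<tau> d)) * (\<Prod>i<deg q d. case child q d i of None \<Rightarrow> 1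
      | Some q' \<Rightarrow> mean_exp n q' f (\<tau> d)) \<partial>measure_pmf (vdata_pmf \<mu>))"
    by (intro nn_integral_cong arg_cong2[where f="(*)"] refl prod.cong)
      (auto simp: H_def mean_exp_def prob_space.emeasure_space_1[OF prob_space_Omega] split: option.split)
  finally show ?thesis .
qed

lemma mean_exp_0: "mean_exp 0 q f y = 1"
  by (simp add: mean_exp_def exp_ennreal_0 prob_space.emeasure_space_1[OF prob_space_Omega])

text \<open>The recursion is monotone and starts from 1, so a supersolution dominates every
  truncation. The hypothesis concerns a vertex at \<open>x\<close>, the conclusion a vertex whose
  parent is at \<open>y\<close>; one step operator separates them.\<close>

lemma mean_exp_Normal_le:
  assumes "\<And>x. exp_ennreal (f x) * (\<integral>\<^sup>+ n. (1 + conv stepk w x) ^ n \<partial>measure_pmf \<mu>) \<le> 1 + w x"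
  shows "mean_exp n Normal f y \<le> 1 + conv stepk w y"
proof (induction n arbitrary: y)
  case 0
  show ?case by (simp add: mean_exp_0)
next
  case (Suc n)
  have "mean_exp (Suc n) Normal f y = (\<integral>\<^sup>+ x. exp_ennreal (f (y + x)) *
      (\<integral>\<^sup>+ k. mean_exp n Normal f (y + x) ^ k \<partial>measure_pmf \<mu>) \<partial>measure_pmf step_pmf)"
    unfolding mean_exp_def[of "Suc n"]
    by (subst nn_integral_exp_visit_sum_upto_Suc)
      (simp add: nn_integral_vdata nn_integral_pmf_const nn_integral_cmult)
  also have "\<dots> \<le> (\<integral>\<^sup>+ x. exp_ennreal (f (y + x)) *
      (\<integral>\<^sup>+ k. (1 + conv stepk w (y + x)) ^ k \<partial>measure_pmf \<mu>) \<partial>measure_pmf step_pmf)"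
    by (intro nn_integral_mono mult_left_mono power_mono Suc) auto
  also have "\<dots> \<le> (\<integral>\<^sup>+ x. 1 + w (y + x) \<partial>measure_pmf step_pmf)"
    by (intro nn_integral_mono assms)
  also have "\<dots> = 1 + conv stepk w y" using conv_stepk_one_plus[of w y] by (simp add: conv_stepk)
  finally show ?case .
qed

text \<open>The special child is charged a normal factor in addition to its own. This overestimate
  removes the dependence on its index and leaves only the generating function of the size-biased
  law.\<close>

lemma mean_exp_Special_le:
  assumes N: "\<And>x. exp_ennreal (f x) * (\<integral>\<^sup>+ n. (1 + conv stepk w x) ^ n \<partial>measure_pmf \<mu>) \<le> 1 + w x"
    and S: "\<And>x. exp_ennreal (f x) * ((\<integral>\<^sup>+ s. (1 + conv stepk w x) ^ fst s \<partial>measure_pmf (spec_pmf \<mu>)) * (1 + conv stepk v x)) \<le> 1 + v x"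
  shows "mean_exp n Special f y \<le> 1 + conv stepk v y"
proof (induction n arbitrary: y)
  case 0
  show ?case by (simp add: mean_exp_0)
next
  case (Suc n)
  let ?W = "\<lambda>x. 1 + conv stepk w x" and ?V = "\<lambda>x. 1 + conv stepk v x"
  have prod: "(\<Prod>i<k. if i = j then a else b) \<le> b ^ k * a" if "1 \<le> a" "1 \<le> b" for a b :: ennreal and j k :: nat
  proof -
    have "(\<Prod>i<k. if i = j then a else b) \<le> (\<Prod>i<k. b * (if i = j then a else 1))"
      using that by (intro prod_mono_ennreal) (auto intro: order_trans[OF _ mult_right_mono[of 1 b a]])
    also have "\<dots> = b ^ k * (\<Prod>i<k. if i = j then a else 1)" by (simp add: prod.distrib)
    also have "(\<Prod>i<k. if i = j then a else 1) \<le> a" using that by (simp add: prod.delta)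
    finally show ?thesis by (meson mult_left_mono order_trans zero_le)
  qed
  have "mean_exp (Suc n) Special f y = (\<integral>\<^sup>+ x. \<integral>\<^sup>+ s. exp_ennreal (f (y + x)) *
      (\<Prod>i<fst s. if i = snd s then mean_exp n Special f (y + x) else mean_exp n Normal f (y + x))
      \<partial>measure_pmf (spec_pmf \<mu>) \<partial>measure_pmf step_pmf)"
    unfolding mean_exp_def[of "Suc n"]
    by (subst nn_integral_exp_visit_sum_upto_Suc)
      (simp add: nn_integral_vdata nn_integral_pmf_const if_distrib[where f="\<lambda>q. mean_exp n q f z" for z] cong: if_cong)
  also have "\<dots> \<le> (\<integral>\<^sup>+ x. \<integral>\<^sup>+ s. exp_ennreal (f (y + x)) *
      (\<Prod>i<fst s. if i = snd s then ?V (y + x) else ?W (y + x)) \<partial>measure_pmf (spec_pmf \<mu>) \<partial>measure_pmf step_pmf)"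
    by (intro nn_integral_mono mult_left_mono prod_mono_ennreal) (auto intro: Suc mean_exp_Normal_le[OF N])
  also have "\<dots> \<le> (\<integral>\<^sup>+ x. \<integral>\<^sup>+ s. exp_ennreal (f (y + x)) * (?W (y + x) ^ fst s * ?V (y + x))
      \<partial>measure_pmf (spec_pmf \<mu>) \<partial>measure_pmf step_pmf)"
    by (intro nn_integral_mono mult_left_mono prod) auto
  also have "\<dots> = (\<integral>\<^sup>+ x. exp_ennreal (f (y + x)) * ((\<integral>\<^sup>+ s. ?W (y + x) ^ fst s \<partial>measure_pmf (spec_pmf \<mu>)) * ?V (y + x))
      \<partial>measure_pmf step_pmf)"
    by (simp add: nn_integral_cmult nn_integral_multc)
  also have "\<dots> \<le> (\<integral>\<^sup>+ x. 1 + v (y + x) \<partial>measure_pmf step_pmf)"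
    by (intro nn_integral_mono S)
  also have "\<dots> = 1 + conv stepk v y" using conv_stepk_one_plus[of v y] by (simp add: conv_stepk)
  finally show ?case .
qed

text \<open>Apart from its special child the root behaves as a normal vertex, so the cost
  factorises: \<open>1 + w y\<close> for the normal part and \<open>1 + conv stepk v y\<close> for
  the spine. Monotone convergence removes the truncation.\<close>

lemma nn_integral_exp_visit_sum_Root_le:
  fixes f :: "int^'d::finite \<Rightarrow> ennreal"
  assumes N: "\<And>x. exp_ennreal (f x) * (\<integral>\<^sup>+ n. (1 + conv stepk w x) ^ n \<partial>measure_pmf \<mu>) \<le> 1 + w x"
    and S: "\<And>x. exp_ennreal (f x) * ((\<integral>\<^sup>+ s. (1 + conv stepk w x) ^ fst s \<partial>measure_pmf (spec_pmf \<mu>)) * (1 + conv stepk v x)) \<le> 1 + v x"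
  shows "(\<integral>\<^sup>+ \<omega>. exp_ennreal (visit_sum Root f y \<omega>) \<partial>Omega \<mu>) \<le> (1 + w y) * (1 + conv stepk v y)"
proof -
  have step: "(\<integral>\<^sup>+ \<omega>. exp_ennreal (visit_sum_upto (Suc n) Root f y \<omega>) \<partial>Omega \<mu>) \<le> (1 + w y) * (1 + conv stepk v y)" for n
  proof -
    have "(\<integral>\<^sup>+ \<omega>. exp_ennreal (visit_sum_upto (Suc n) Root f y \<omega>) \<partial>Omega \<mu>) =
      (\<integral>\<^sup>+ d. exp_ennreal (f y) * (\<Prod>i<deg Root d. case child Root d i of None \<Rightarrow> 1
      | Some q' \<Rightarrow> mean_exp n q' f y) \<partial>measure_pmf (vdata_pmf \<mu> :: 'd vdata pmf))"
      by (rule nn_integral_exp_visit_sum_upto_Suc[where \<tau>="\<lambda>_. y"])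
    also have "\<dots> = (\<integral>\<^sup>+ d. exp_ennreal (f y) * (mean_exp n Special f y * mean_exp n Normal f y ^ fst (fst d)) \<partial>measure_pmf (vdata_pmf \<mu> :: 'd vdata pmf))"
      by (intro nn_integral_cong) (simp add: prod.lessThan_Suc_shift del: prod.lessThan_Suc)
    also have "\<dots> \<le> (\<integral>\<^sup>+ d. exp_ennreal (f y) * ((1 + conv stepk v y) * (1 + conv stepk w y) ^ fst (fst d)) \<partial>measure_pmf (vdata_pmf \<mu> :: 'd vdata pmf))"
      by (intro nn_integral_mono mult_mono power_mono mean_exp_Normal_le[OF N] mean_exp_Special_le[OF N S]) auto
    also have "\<dots> = exp_ennreal (f y) * (\<integral>\<^sup>+ n. (1 + conv stepk w y) ^ n \<partial>measure_pmf \<mu>) * (1 + conv stepk v y)"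
      by (simp add: nn_integral_vdata nn_integral_pmf_const nn_integral_cmult mult_ac)
    also have "\<dots> \<le> (1 + w y) * (1 + conv stepk v y)" by (intro mult_right_mono N) auto
    finally show ?thesis .
  qed
  have "(\<integral>\<^sup>+ \<omega>. exp_ennreal (visit_sum Root f y \<omega>) \<partial>Omega \<mu>) =
    (\<integral>\<^sup>+ \<omega>. (SUP n. exp_ennreal (visit_sum_upto n Root f y \<omega>)) \<partial>Omega \<mu>)"
    by (simp add: visit_sum_eq_SUP exp_ennreal_SUP[OF incseq_visit_sum_upto])
  also have "\<dots> = (SUP n. \<integral>\<^sup>+ \<omega>. exp_ennreal (visit_sum_upto n Root f y \<omega>) \<partial>Omega \<mu>)"
    by (rule nn_integral_monotone_convergence_SUP)
      (auto simp: incseq_def le_fun_def intro!: exp_ennreal_mono measurable_exp_ennreal measurable_visit_sum_upto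
        incseqD[OF incseq_visit_sum_upto])
  also have "\<dots> \<le> (1 + w y) * (1 + conv stepk v y)"
  proof (rule SUP_least)
    fix n
    have "(\<integral>\<^sup>+ \<omega>. exp_ennreal (visit_sum_upto n Root f y \<omega>) \<partial>Omega \<mu>) \<le> (\<integral>\<^sup>+ \<omega>. exp_ennreal (visit_sum_upto (Suc n) Root f y \<omega>) \<partial>Omega \<mu>)"
      by (intro nn_integral_mono exp_ennreal_mono incseqD[OF incseq_visit_sum_upto]) auto
    also note step
    finally show "(\<integral>\<^sup>+ \<omega>. exp_ennreal (visit_sum_upto n Root f y \<omega>) \<partial>Omega \<mu>) \<le> (1 + w y) * (1 + conv stepk v y)" .
  qed
  finally show ?thesis .
qed

end

section \<open>Supersolutions\<close>

lemma exp_le_one_plus_twice: "0 \<le> p \<Longrightarrow> p \<le> 1 \<Longrightarrow> exp p \<le> 1 + 2 * (p::real)"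
proof -
  assume p: "0 \<le> p" "p \<le> 1"
  have "exp p \<le> 1 + p + p\<^sup>2" using p by (rule exp_bound)
  moreover have "p\<^sup>2 \<le> p" using p by (simp add: power2_eq_square mult_left_le)
  ultimately show ?thesis by simp
qed

text \<open>The coefficient 4: \<open>exp p\<close> costs \<open>2 * p\<close>, and the cross term
  with a quantity of at most 1 costs the same again.\<close>

lemma normal_recursion_bound:
  assumes "0 \<le> p" "p \<le> 1" "0 \<le> s" "0 \<le> M" "s + M * s\<^sup>2 \<le> 1" "4 * p + M * s\<^sup>2 + s \<le> (w::real)"
  shows "exp p * (1 + s + M * s\<^sup>2) \<le> 1 + w"
proof -
  define e where "e = s + M * s\<^sup>2"
  have e: "0 \<le> e" "e \<le> 1" "4 * p + e \<le> w" using assms by (auto simp: e_def)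
  have "exp p * (1 + e) \<le> (1 + 2 * p) * (1 + e)"
    using exp_le_one_plus_twice[OF assms(1,2)] e by (intro mult_right_mono) auto
  also have "\<dots> = 1 + e + 2 * p + 2 * (p * e)" by (simp add: algebra_simps)
  also have "p * e \<le> p * 1" using e assms by (intro mult_left_mono) auto
  finally show ?thesis using e by (simp add: e_def add.assoc)
qed

text \<open>The coefficient 3 of \<open>M * s\<close> consists of the term itself and twice the
  cross term with \<open>p \<le> 1\<close>. The outer factor 2 absorbs the cross term with
  \<open>t \<le> 1\<close>.\<close>

lemma special_recursion_bound:
  assumes "0 \<le> p" "p \<le> 1" "0 \<le> s" "0 \<le> M" "0 \<le> t" "t \<le> 1" "2 * (2 * p + 3 * (M * s)) + t \<le> (v::real)"
  shows "exp p * ((1 + M * s) * (1 + t)) \<le> 1 + v"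
proof -
  define e where "e = 2 * p + 3 * (M * s)"
  have Ms: "M * s \<ge> 0" using assms by simp
  have e: "0 \<le> e" "2 * e + t \<le> v" using assms Ms by (auto simp: e_def)
  have "exp p * (1 + M * s) \<le> (1 + 2 * p) * (1 + M * s)"
    using exp_le_one_plus_twice[OF assms(1,2)] Ms by (intro mult_right_mono) auto
  also have "\<dots> = 1 + 2 * p + M * s + 2 * (p * (M * s))" by (simp add: algebra_simps)
  also have "p * (M * s) \<le> 1 * (M * s)" using Ms assms by (intro mult_right_mono) auto
  finally have "exp p * (1 + M * s) \<le> 1 + e" by (simp add: e_def)
  then have "exp p * (1 + M * s) * (1 + t) \<le> (1 + e) * (1 + t)" using assms by (intro mult_right_mono) auto
  also have "\<dots> = 1 + t + e + e * t" by (simp add: algebra_simps)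
  also have "e * t \<le> e * 1" using e assms by (intro mult_left_mono) auto
  finally show ?thesis using e by (simp add: mult.assoc)
qed

text \<open>One of the two factors is expanded as a sum over \<open>y\<close>. The three-point
  inequality pulls \<open>k (x - y)\<close> out of the sum over \<open>z\<close>, and what is left
  there is twice a double potential, each bounded by \<open>B\<close>.\<close>

lemma conv_square_le:
  fixes k f :: "int^'d::finite \<Rightarrow> ennreal"
  assumes sym: "\<And>x. k (- x) = k x"
    and three: "\<And>a b. k a * k b \<le> C * (k (a + b) * (k a + k b))"
    and small: "\<And>x. conv k (conv k f) x \<le> B"
  shows "conv k (\<lambda>z. conv k f z * conv k f z) x \<le> 2 * C * B * conv k f x"
proof -
  let ?g = "conv k f"
  have "conv k (\<lambda>z. ?g z * ?g z) x = (\<integral>\<^sup>+ z. \<integral>\<^sup>+ y. (k (x - z) * k (z - y)) * (f y * ?g z) \<partial>count_space UNIV \<partial>count_space UNIV)"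
    unfolding conv_def[of k "\<lambda>z. ?g z * ?g z"]
    by (subst (2) conv_def) (simp add: nn_integral_cmult[symmetric] nn_integral_multc[symmetric] mult_ac)
  also have "\<dots> \<le> (\<integral>\<^sup>+ z. \<integral>\<^sup>+ y. (C * (k (x - y) * (k (x - z) + k (z - y)))) * (f y * ?g z) \<partial>count_space UNIV \<partial>count_space UNIV)"
  proof (intro nn_integral_mono mult_right_mono)
    fix z y
    show "k (x - z) * k (z - y) \<le> C * (k (x - y) * (k (x - z) + k (z - y)))"
      using three[of "x - z" "z - y"] by simp
  qed simp
  also have "\<dots> = (\<integral>\<^sup>+ y. \<integral>\<^sup>+ z. (C * (k (x - y) * (k (x - z) + k (z - y)))) * (f y * ?g z) \<partial>count_space UNIV \<partial>count_space UNIV)"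
    by (rule nn_integral_count_space_swap)
  also have "\<dots> = (\<integral>\<^sup>+ y. C * (k (x - y) * f y) * (conv k ?g x + conv k ?g y) \<partial>count_space UNIV)"
  proof (rule nn_integral_cong)
    fix y
    have "conv k ?g x + conv k ?g y = (\<integral>\<^sup>+ z. k (x - z) * ?g z + k (z - y) * ?g z \<partial>count_space UNIV)"
      unfolding conv_def[of k "conv k f"] using sym[of "y - z" for z] by (simp add: nn_integral_add)
    then have eq: "C * (k (x - y) * f y) * (conv k ?g x + conv k ?g y) =
      (\<integral>\<^sup>+ z. C * (k (x - y) * f y) * (k (x - z) * ?g z + k (z - y) * ?g z) \<partial>count_space UNIV)"
      by (simp only:) (rule nn_integral_cmult[symmetric], simp)
    show "(\<integral>\<^sup>+ z. (C * (k (x - y) * (k (x - z) + k (z - y)))) * (f y * ?g z) \<partial>count_space UNIV) =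
       C * (k (x - y) * f y) * (conv k ?g x + conv k ?g y)"
      unfolding eq by (intro nn_integral_cong) (simp only: distrib_left distrib_right mult_ac)
  qed
  also have "\<dots> \<le> (\<integral>\<^sup>+ y. C * (k (x - y) * f y) * (B + B) \<partial>count_space UNIV)"
    by (intro nn_integral_mono mult_left_mono add_mono small) auto
  also have "\<dots> = 2 * C * B * (\<integral>\<^sup>+ y. k (x - y) * f y \<partial>count_space UNIV)"
    by (simp add: nn_integral_cmult[symmetric] mult_2[symmetric] mult_ac)
  finally show ?thesis by (simp add: conv_def)
qed

text \<open>By translation invariance the property of the kernel passes to its potentials:
  \<open>conv k h\<close> pays for a source \<open>c * h\<close> at every site.\<close>

lemma conv_supersolution:
  fixes k :: "int^'d::finite \<Rightarrow> ennreal"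
  assumes "\<And>x. c * indicator {0} x + conv stepk k x \<le> k x"
  shows "c * h x + conv stepk (conv k h) x \<le> conv k h x"
proof -
  have "c * h x + conv stepk (conv k h) x = conv (\<lambda>x. c * indicator {0} x + conv stepk k x) h x"
    by (simp add: conv_add_left conv_cmult_left conv_delta conv_assoc)
  also have "\<dots> \<le> conv k h x" by (rule conv_mono_left[OF assms])
  finally show ?thesis .
qed

text \<open>Both kernels are replaced by Green potentials, and commutation moves the two Green
  operators onto \<open>f\<close>. What remains is convolution with the summable
  \<open>m\<close>.\<close>

lemma conv_conv_le_green:
  fixes k m f :: "int^'d::finite \<Rightarrow> ennreal"
  assumes k: "\<And>x. k x \<le> green m x" and m: "(\<integral>\<^sup>+ x. m x \<partial>count_space UNIV) \<le> c"
    and B: "\<And>x. green (green f) x \<le> B"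
  shows "conv k (conv k f) x \<le> c * (c * B)"
proof -
  have g: "conv (green m) h = conv m (green h)" for h :: "int^'d \<Rightarrow> ennreal"
    by (metis conv_commute green_conv)
  have "conv k (conv k f) x \<le> conv (green m) (conv (green m) f) x"
    by (rule conv_mono[OF k conv_mono_left[OF k]])
  also have "\<dots> = conv m (conv m (green (green f))) x" by (simp add: g green_conv)
  also have "\<dots> \<le> (\<integral>\<^sup>+ x. m x \<partial>count_space UNIV) * ((\<integral>\<^sup>+ x. m x \<partial>count_space UNIV) * B)"
    by (intro conv_le_const B)
  also have "\<dots> \<le> c * (c * B)" using m by (intro mult_mono) auto
  finally show ?thesis .
qed

context exp_critical_offspring
begin

text \<open>With \<open>\<psi> = k * f\<close>, the second-order term of the offspring law turns the linear bound \<open>a \<psi>\<close> into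
  \<open>w = a \<psi> + b k * \<psi>\<^sup>2\<close>; the three-point inequality keeps \<open>k * \<psi>\<^sup>2\<close> below a small multiple of \<open>\<psi>\<close>.
  Along the spine the cost per vertex is of order \<open>\<psi>\<close>, which is paid for by \<open>v = A k * \<psi>\<close>.\<close>
lemma supersolutions_exist:
  fixes k :: "int^'d::finite \<Rightarrow> ennreal"
  assumes c1: "c1 > 0" and C: "C \<ge> 0"
    and sym: "\<And>x. k (- x) = k x"
    and super: "\<And>x. ennreal c1 * indicator {0} x + conv stepk k x \<le> k x"
    and three: "\<And>a b. k a * k b \<le> ennreal C * (k (a + b) * (k a + k b))"
  shows "\<exists>\<delta>>0. \<forall>f. (\<forall>x. conv k (conv k f) x \<le> ennreal \<delta>) \<longrightarrow>
    (\<exists>w v. (\<forall>x. exp_ennreal (f x) * (\<integral>\<^sup>+ n. (1 + conv stepk w x) ^ n \<partial>measure_pmf \<mu>) \<le> 1 + w x) \<and>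
      (\<forall>x. exp_ennreal (f x) * ((\<integral>\<^sup>+ s. (1 + conv stepk w x) ^ fst s \<partial>measure_pmf (spec_pmf \<mu>)) * (1 + conv stepk v x)) \<le> 1 + v x) \<and>
      (\<forall>x. w x \<le> ennreal (2/5)) \<and> (\<forall>x. v x \<le> ennreal (2/5)))"
proof -
  obtain r M where r: "r > 0" and M: "M \<ge> 0"
    and mom1: "\<And>s. s \<ge> 0 \<Longrightarrow> s \<le> r \<Longrightarrow> (\<integral>\<^sup>+ n. (1 + ennreal s) ^ n \<partial>measure_pmf \<mu>) \<le> ennreal (1 + s + M * s\<^sup>2)"
    and mom2: "\<And>s. s \<ge> 0 \<Longrightarrow> s \<le> r \<Longrightarrow> (\<integral>\<^sup>+ z. (1 + ennreal s) ^ fst z \<partial>measure_pmf (spec_pmf \<mu>)) \<le> ennreal (1 + M * s)"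
    using exp_moment_bounds by blast
  \<comment> \<open>The constants are matched to the two recursion bounds. \<open>a * c1\<close> is
    the coefficient of \<open>p\<close> in the normal one; \<open>b * c1\<close> pays for
    \<open>M * s^2\<close> with \<open>s \<le> 2 * a * \<psi>\<close>; \<open>D * \<psi>\<close>
    dominates the cost of a spine vertex, as \<open>p \<le> \<psi> / c1\<close>; and
    \<open>A * c1\<close> is twice \<open>D\<close>, as the special bound requires.\<close>
  define a where "a = 4 / c1"
  define b where "b = 4 * M * a\<^sup>2 / c1"
  define D where "D = 2 / c1 + 6 * M * a"
  define A where "A = 2 * D / c1"
  have a: "a > 0" "a * c1 = 4" using c1 by (auto simp: a_def)
  have b: "b \<ge> 0" "b * c1 = 4 * M * a\<^sup>2" using c1 M by (auto simp: b_def)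
  have D: "D \<ge> 0" using c1 M a by (auto simp: D_def)
  have A: "A \<ge> 0" "A * c1 = 2 * D" using c1 D by (auto simp: A_def)
  \<comment> \<open>In order, the entries ensure: the quadratic correction stays below the linear
    part, so that \<open>w \<le> 2 * a * \<psi>\<close>; \<open>s\<close> lies in the range of the
    moment bounds; \<open>p \<le> 1\<close>; \<open>w * (1 + M) \<le> 2/5\<close>; and
    \<open>v \<le> 2/5\<close>. The added 1 in the first and last denominators keeps them
    positive.\<close>
  define \<delta> where "\<delta> = min (a / (2 * b * C + 1)) (min (r * c1 / (2 * a)) (min (c1 * c1)
     (min (c1 / (5 * a * (1 + M))) (2 / (5 * (A + 1))))))"
  have "2 * b * C + 1 > 0" using b C by (simp add: add_nonneg_pos)
  then have \<delta>: "\<delta> > 0" using a r c1 M A by (simp add: \<delta>_def)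
  have \<delta>_le: "\<delta> \<le> a / (2 * b * C + 1)" "\<delta> \<le> r * c1 / (2 * a)" "\<delta> \<le> c1 * c1"
    "\<delta> \<le> c1 / (5 * a * (1 + M))" "\<delta> \<le> 2 / (5 * (A + 1))" by (auto simp: \<delta>_def)
  have d1: "b * (2 * C * \<delta>) \<le> a"
  proof -
    have "(2 * b * C + 1) * \<delta> \<le> a" using \<delta>_le(1) \<open>2 * b * C + 1 > 0\<close> by (simp add: pos_le_divide_eq mult.commute)
    then show ?thesis using \<delta> by (simp add: algebra_simps)
  qed
  have d2: "2 * a * \<delta> \<le> r * c1" using \<delta>_le(2) a by (simp add: pos_le_divide_eq mult.commute)
  have d4: "2 * a * \<delta> * (1 + M) \<le> 2 / 5 * c1"
  proof -
    have "\<delta> * (5 * a * (1 + M)) \<le> c1" using \<delta>_le(4) a M by (simp add: pos_le_divide_eq)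
    then show ?thesis by (simp add: algebra_simps)
  qed
  have d5: "A * \<delta> \<le> 2 / 5"
  proof -
    have "\<delta> * (5 * (A + 1)) \<le> 2" using \<delta>_le(5) A by (simp add: pos_le_divide_eq)
    then show ?thesis using \<delta> by (simp add: algebra_simps)
  qed
  have main: "\<exists>w v. (\<forall>x. exp_ennreal (f x) * (\<integral>\<^sup>+ n. (1 + conv stepk w x) ^ n \<partial>measure_pmf \<mu>) \<le> 1 + w x) \<and>
      (\<forall>x. exp_ennreal (f x) * ((\<integral>\<^sup>+ s. (1 + conv stepk w x) ^ fst s \<partial>measure_pmf (spec_pmf \<mu>)) * (1 + conv stepk v x)) \<le> 1 + v x) \<and>
      (\<forall>x. w x \<le> ennreal (2/5)) \<and> (\<forall>x. v x \<le> ennreal (2/5))"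
    if small: "\<And>x. conv k (conv k f) x \<le> ennreal \<delta>" for f
  proof -
    define \<psi> where "\<psi> = conv k f"
    define u where "u = conv k (\<lambda>z. \<psi> z * \<psi> z)"
    define \<eta> where "\<eta> = conv k \<psi>"
    define w where "w x = ennreal a * \<psi> x + ennreal b * u x" for x
    define v where "v x = ennreal A * \<eta> x" for x
    have Pw: "conv stepk w x = ennreal a * conv stepk \<psi> x + ennreal b * conv stepk u x" for x
      unfolding w_def by (simp add: conv_add_right conv_cmult_right)
    have Pv: "conv stepk v x = ennreal A * conv stepk \<eta> x" for x
      unfolding v_def by (simp add: conv_cmult_right)
    have \<psi>: "ennreal c1 * f x + conv stepk \<psi> x \<le> \<psi> x" for x
      unfolding \<psi>_def by (rule conv_supersolution[OF super])
    have u: "ennreal c1 * (\<psi> x * \<psi> x) + conv stepk u x \<le> u x" for x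
      unfolding u_def by (rule conv_supersolution[OF super])
    have \<eta>: "ennreal c1 * \<psi> x + conv stepk \<eta> x \<le> \<eta> x" for x
      unfolding \<eta>_def by (rule conv_supersolution[OF super])
    have \<eta>_le: "\<eta> x \<le> ennreal \<delta>" for x using small by (simp add: \<eta>_def \<psi>_def)
    have u_le: "u x \<le> ennreal (2 * C * \<delta>) * \<psi> x" for x
      using conv_square_le[OF sym three small, of x] C \<delta>
      by (simp add: u_def \<psi>_def ennreal_mult)
    have w_step: "ennreal 4 * f x + ennreal (4 * M * a\<^sup>2) * (\<psi> x * \<psi> x) + conv stepk w x \<le> w x" for x
    proof -
      have "ennreal a * (ennreal c1 * f x + conv stepk \<psi> x) + ennreal b * (ennreal c1 * (\<psi> x * \<psi> x) + conv stepk u x) \<le> w x"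
        unfolding w_def by (intro add_mono mult_left_mono \<psi> u) auto
      moreover have "ennreal a * ennreal c1 = ennreal 4" "ennreal b * ennreal c1 = ennreal (4 * M * a\<^sup>2)"
        using a b c1 by (simp_all add: ennreal_mult[symmetric] less_imp_le del: ennreal_numeral)
      ultimately show ?thesis by (simp add: Pw distrib_left mult.assoc[symmetric] add_ac)
    qed
    have w_le: "w x \<le> ennreal (2 * a) * \<psi> x" for x
    proof -
      have "w x \<le> ennreal a * \<psi> x + ennreal b * (ennreal (2 * C * \<delta>) * \<psi> x)"
        unfolding w_def by (intro add_left_mono mult_left_mono u_le) auto
      also have "ennreal b * (ennreal (2 * C * \<delta>) * \<psi> x) = ennreal (b * (2 * C * \<delta>)) * \<psi> x"
        using b C \<delta> by (simp add: ennreal_mult mult.assoc)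
      also have "\<dots> \<le> ennreal a * \<psi> x" using d1 by (intro mult_right_mono ennreal_leI) auto
      finally have "w x \<le> ennreal a * \<psi> x + ennreal a * \<psi> x" by simp
      also have "\<dots> = ennreal (2 * a) * \<psi> x" using a by (simp add: distrib_right[symmetric] ennreal_plus[symmetric] del: ennreal_plus)
      finally show ?thesis .
    qed
    have v_step: "ennreal (2 * D) * \<psi> x + conv stepk v x \<le> v x" for x
    proof -
      have "ennreal A * (ennreal c1 * \<psi> x + conv stepk \<eta> x) \<le> v x"
        unfolding v_def by (intro mult_left_mono \<eta>) auto
      moreover have "ennreal A * ennreal c1 = ennreal (2 * D)"
        using A c1 by (simp add: ennreal_mult[symmetric] less_imp_le)
      ultimately show ?thesis by (simp add: Pv distrib_left mult.assoc[symmetric])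
    qed
    have v_le: "v x \<le> ennreal (2/5)" for x
    proof -
      have "v x \<le> ennreal A * ennreal \<delta>" unfolding v_def by (intro mult_left_mono \<eta>_le) auto
      also have "\<dots> = ennreal (A * \<delta>)" using A \<delta> by (simp add: ennreal_mult)
      also have "\<dots> \<le> ennreal (2/5)" using d5 by (rule ennreal_leI)
      finally show ?thesis .
    qed
    \<comment> \<open>The source terms turn the bound on the double potential into pointwise bounds,
      for \<open>\<psi>\<close> and then for \<open>f\<close>.\<close>
    have c1\<psi>: "ennreal c1 * \<psi> x \<le> ennreal \<delta>" for x
      using \<eta>[of x] \<eta>_le[of x] by (meson add_increasing2 order_trans zero_le order_refl)
    have c1f: "ennreal c1 * f x \<le> \<psi> x" for x
      using \<psi>[of x] by (meson add_increasing2 order_trans zero_le order_refl)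
    have pointwise: "exp_ennreal (f x) * (\<integral>\<^sup>+ n. (1 + conv stepk w x) ^ n \<partial>measure_pmf \<mu>) \<le> 1 + w x \<and>
      exp_ennreal (f x) * ((\<integral>\<^sup>+ s. (1 + conv stepk w x) ^ fst s \<partial>measure_pmf (spec_pmf \<mu>)) * (1 + conv stepk v x)) \<le> 1 + v x \<and>
      w x \<le> ennreal (2/5)" for x
    proof -
      \<comment> \<open>Every quantity at \<open>x\<close> is shown to be finite, so that the
        remaining estimates are real arithmetic.\<close>
      have "\<psi> x \<noteq> top" using c1\<psi>[of x] c1 by (auto simp: ennreal_mult_top top_unique)
      then obtain q where q: "\<psi> x = ennreal q" "q \<ge> 0" by (cases "\<psi> x") auto
      have "f x \<noteq> top" using c1f[of x] c1 q by (auto simp: ennreal_mult_top top_unique)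
      then obtain p where p: "f x = ennreal p" "p \<ge> 0" by (cases "f x") auto
      have "w x \<noteq> top" using w_le[of x] q a by (auto simp: top_unique ennreal_mult[symmetric])
      then obtain ww where ww: "w x = ennreal ww" "ww \<ge> 0" by (cases "w x") auto
      have "conv stepk w x \<le> w x" using w_step[of x] by (meson add_increasing order_trans zero_le order_refl)
      then have "conv stepk w x \<noteq> top" using ww by (auto simp: top_unique)
      then obtain s where s: "conv stepk w x = ennreal s" "s \<ge> 0" by (cases "conv stepk w x") auto
      have "v x \<noteq> top" using v_le[of x] by (auto simp: top_unique)
      then obtain vv where vv: "v x = ennreal vv" "vv \<ge> 0" by (cases "v x") auto
      have "conv stepk v x \<le> v x" using v_step[of x] by (meson add_increasing order_trans zero_le order_refl)
      then have "conv stepk v x \<noteq> top" using vv by (auto simp: top_unique)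
      then obtain t where t: "conv stepk v x = ennreal t" "t \<ge> 0" by (cases "conv stepk v x") auto
      have 1: "4 * p + 4 * M * a\<^sup>2 * (q * q) + s \<le> ww"
      proof -
        have "ennreal (4 * p + 4 * M * a\<^sup>2 * (q * q) + s) \<le> ennreal ww"
          using w_step[of x] p q s M unfolding ww(1)[symmetric]
          by (simp add: ennreal_mult del: ennreal_numeral)
        then show ?thesis using ww by simp
      qed
      have 2: "ww \<le> 2 * a * q"
        using w_le[of x] ww q a by (simp add: ennreal_mult[symmetric] del: ennreal_numeral)
      have 3: "2 * D * q + t \<le> vv"
      proof -
        have "ennreal (2 * D * q + t) \<le> ennreal vv"
          using v_step[of x] q t D unfolding vv(1)[symmetric] by (simp add: ennreal_mult del: ennreal_numeral)
        then show ?thesis using vv by simp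
      qed
      have 4: "vv \<le> 2/5" using v_le[of x] vv by simp
      have 5: "c1 * q \<le> \<delta>" using c1\<psi>[of x] q \<delta> c1 by (simp add: ennreal_mult[symmetric])
      have 6: "c1 * p \<le> q" using c1f[of x] p q c1 by (simp add: ennreal_mult[symmetric])
      have s_ww: "s \<le> ww" using 1 p q M a by (smt (verit) mult_nonneg_nonneg zero_le_power2)
      have ww_d: "c1 * ww \<le> 2 * a * \<delta>"
      proof -
        have "c1 * ww \<le> c1 * (2 * a * q)" using 2 c1 by (intro mult_left_mono) auto
        also have "\<dots> = 2 * a * (c1 * q)" by simp
        also have "\<dots> \<le> 2 * a * \<delta>" using 5 a by (intro mult_left_mono) auto
        finally show ?thesis .
      qed
      have "c1 * (ww * (1 + M)) \<le> c1 * (2 / 5)"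
      proof -
        have "c1 * ww * (1 + M) \<le> 2 * a * \<delta> * (1 + M)" using ww_d M by (intro mult_right_mono) auto
        from order.trans[OF this d4] show ?thesis by (simp only: mult.assoc mult.commute[of "2 / 5" c1])
      qed
      then have wwM: "ww * (1 + M) \<le> 2 / 5" using c1 by (rule mult_left_le_imp_le)
      then have ww25: "ww + ww * M \<le> 2/5" "ww \<le> 2/5" using ww M by (simp_all add: distrib_left) (smt (verit) mult_nonneg_nonneg)
      have sr: "s \<le> r"
      proof -
        have "c1 * s \<le> c1 * ww" using s_ww c1 by simp
        also have "\<dots> \<le> r * c1" using ww_d d2 by simp
        finally show ?thesis using c1 by (simp add: mult.commute[of r])
      qed
      have p1: "p \<le> 1"
      proof -
        have "c1 * (c1 * p) \<le> c1 * q" using 6 c1 by (intro mult_left_mono) auto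
        also have "\<dots> \<le> c1 * c1" using 5 \<delta>_le(3) by simp
        finally show ?thesis using c1 by simp
      qed
      have Mss: "M * s\<^sup>2 \<le> ww * M"
      proof -
        have "s * s \<le> ww * 1" using s s_ww ww25 by (intro mult_mono) auto
        then have "M * (s * s) \<le> M * ww" using M by (intro mult_left_mono) auto
        then show ?thesis by (simp add: power2_eq_square mult.commute)
      qed
      \<comment> \<open>The quadratic error of the offspring law is paid for by the source
        \<open>\<psi>^2\<close> of \<open>u\<close>.\<close>
      have Ms2: "M * s\<^sup>2 \<le> 4 * M * a\<^sup>2 * (q * q)"
      proof -
        have "s\<^sup>2 \<le> (2 * a * q)\<^sup>2" using s s_ww 2 by (intro power_mono) auto
        then have "M * s\<^sup>2 \<le> M * (2 * a * q)\<^sup>2" using M by (intro mult_left_mono) auto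
        then show ?thesis by (simp add: power2_eq_square mult_ac)
      qed
      have N: "exp p * (1 + s + M * s\<^sup>2) \<le> 1 + ww"
        by (rule normal_recursion_bound) (use p p1 s M Mss ww25 s_ww Ms2 1 in auto)
      have pq: "2 * p + 3 * (M * s) \<le> D * q"
      proof -
        have "p \<le> q / c1" using 6 c1 by (simp add: pos_le_divide_eq mult.commute)
        moreover have "M * s \<le> M * (2 * a * q)" using s_ww 2 M by (intro mult_left_mono) auto
        ultimately have "2 * p + 3 * (M * s) \<le> 2 * (q / c1) + 3 * (M * (2 * a * q))" by linarith
        also have "\<dots> = D * q" by (simp add: D_def algebra_simps)
        finally show ?thesis .
      qed
      have S: "exp p * ((1 + M * s) * (1 + t)) \<le> 1 + vv"
      proof (rule special_recursion_bound[OF p(2) p1 s(2) M t(2)])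
        have "0 \<le> 2 * D * q" using D q by simp
        then show "t \<le> 1" using 3 4 by linarith
        show "2 * (2 * p + 3 * (M * s)) + t \<le> vv" using pq 3 by simp
      qed
      have "exp_ennreal (f x) * (\<integral>\<^sup>+ n. (1 + conv stepk w x) ^ n \<partial>measure_pmf \<mu>) \<le> ennreal (exp p) * ennreal (1 + s + M * s\<^sup>2)"
        unfolding p(1) s(1) exp_ennreal_ennreal[OF p(2)] by (intro mult_left_mono mom1 s sr) auto
      also have "\<dots> = ennreal (exp p * (1 + s + M * s\<^sup>2))" using s M by (simp add: ennreal_mult'')
      also have "\<dots> \<le> ennreal (1 + ww)" by (rule ennreal_leI[OF N])
      also have "\<dots> = 1 + w x" using ww by simp
      finally have I: "exp_ennreal (f x) * (\<integral>\<^sup>+ n. (1 + conv stepk w x) ^ n \<partial>measure_pmf \<mu>) \<le> 1 + w x" .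
      have "exp_ennreal (f x) * ((\<integral>\<^sup>+ s. (1 + conv stepk w x) ^ fst s \<partial>measure_pmf (spec_pmf \<mu>)) * (1 + conv stepk v x))
         \<le> ennreal (exp p) * (ennreal (1 + M * s) * (1 + ennreal t))"
        unfolding p(1) s(1) t(1) exp_ennreal_ennreal[OF p(2)] by (intro mult_left_mono mult_right_mono mom2 s sr) auto
      also have "\<dots> = ennreal (exp p * ((1 + M * s) * (1 + t)))"
      proof -
        have "1 + ennreal t = ennreal (1 + t)" using t by simp
        then show ?thesis using s M t by (simp only: ennreal_mult'' mult_nonneg_nonneg add_nonneg_nonneg zero_le_one)
      qed
      also have "\<dots> \<le> ennreal (1 + vv)" by (rule ennreal_leI[OF S])
      also have "\<dots> = 1 + v x" using vv by simp
      finally have II: "exp_ennreal (f x) * ((\<integral>\<^sup>+ s. (1 + conv stepk w x) ^ fst s \<partial>measure_pmf (spec_pmf \<mu>)) * (1 + conv stepk v x)) \<le> 1 + v x" .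
      have "w x \<le> ennreal (2/5)" unfolding ww(1) using ww25(2) by (rule ennreal_leI)
      with I II show ?thesis by blast
    qed
    show ?thesis
      by (intro exI[of _ w] exI[of _ v] conjI allI v_le) (use pointwise in blast)+
  qed
  show ?thesis by (intro exI[of _ \<delta>] conjI \<delta> allI impI main) blast
qed

theorem exp_visit_sum_Root_le_two:
  assumes "CARD('d::finite) \<ge> 3"
  shows "\<exists>\<kappa>>0. \<forall>f :: int^'d \<Rightarrow> ennreal. (\<forall>x. (\<integral>\<^sup>+ y. G \<mu> x y * f y \<partial>count_space UNIV) \<le> ennreal \<kappa>) \<longrightarrow>
    (\<forall>x. (\<integral>\<^sup>+ \<omega>. exp_ennreal (visit_sum Root f x \<omega>) \<partial>Omega \<mu>) \<le> 2)"
proof -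
  obtain k :: "int^'d \<Rightarrow> ennreal" and c1 C c m where kern: "c1 > 0" "C \<ge> 0" "c \<ge> 0" "\<And>x. k (- x) = k x"
    "\<And>x. ennreal c1 * indicator {0} x + conv stepk k x \<le> k x"
    "\<And>a b. k a * k b \<le> ennreal C * (k (a + b) * (k a + k b))"
    "\<And>x. k x \<le> green m x" "(\<integral>\<^sup>+ x. m x \<partial>count_space UNIV) \<le> ennreal c"
    using kernel_exists[OF assms] by blast
  obtain Cg where Cg: "Cg \<ge> 0" "\<And>(f :: int^'d \<Rightarrow> ennreal) B x. (\<And>x. (\<integral>\<^sup>+ z. G \<mu> x z * f z \<partial>count_space UNIV) \<le> B)
    \<Longrightarrow> green (green f) x \<le> ennreal Cg * B"
    using green_green_le_G[where 'd='d] by blast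
  obtain \<delta> where \<delta>: "\<delta> > 0" and super: "\<And>f. (\<And>x. conv k (conv k f) x \<le> ennreal \<delta>) \<Longrightarrow>
    \<exists>w v. (\<forall>x. exp_ennreal (f x) * (\<integral>\<^sup>+ n. (1 + conv stepk w x) ^ n \<partial>measure_pmf \<mu>) \<le> 1 + w x) \<and>
      (\<forall>x. exp_ennreal (f x) * ((\<integral>\<^sup>+ s. (1 + conv stepk w x) ^ fst s \<partial>measure_pmf (spec_pmf \<mu>)) * (1 + conv stepk v x)) \<le> 1 + v x) \<and>
      (\<forall>x. w x \<le> ennreal (2/5)) \<and> (\<forall>x. v x \<le> ennreal (2/5))"
    using supersolutions_exist[OF kern(1,2,4,5,6)] by blast
  \<comment> \<open>Each exchange of a kernel for a Green operator costs \<open>c\<close>, the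
    passage from \<open>G\<close> costs \<open>Cg\<close>; the added 1 keeps the denominator
    positive.\<close>
  define \<kappa> where "\<kappa> = \<delta> / (c * (c * Cg) + 1)"
  have den: "c * (c * Cg) + 1 > 0" using kern Cg by (simp add: add_nonneg_pos)
  then have \<kappa>: "\<kappa> > 0" using \<delta> by (simp add: \<kappa>_def)
  have \<kappa>\<delta>: "c * (c * (Cg * \<kappa>)) \<le> \<delta>"
  proof -
    have "(c * (c * Cg) + 1) * \<kappa> = \<delta>" using den by (simp add: \<kappa>_def)
    then show ?thesis using \<kappa> by (simp add: algebra_simps)
  qed
  have "(\<integral>\<^sup>+ \<omega>. exp_ennreal (visit_sum Root f x \<omega>) \<partial>Omega \<mu>) \<le> 2"
    if hyp: "\<And>x. (\<integral>\<^sup>+ y. G \<mu> x y * f y \<partial>count_space UNIV) \<le> ennreal \<kappa>" for f :: "int^'d \<Rightarrow> ennreal" and x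
  proof -
    have "conv k (conv k f) x \<le> ennreal \<delta>" for x
    proof -
      have "conv k (conv k f) x \<le> ennreal c * (ennreal c * (ennreal Cg * ennreal \<kappa>))"
        by (rule conv_conv_le_green[OF kern(7,8)]) (rule Cg(2)[OF hyp])
      also have "\<dots> = ennreal (c * (c * (Cg * \<kappa>)))" using kern(3) Cg(1) \<kappa> by (simp add: ennreal_mult)
      also have "\<dots> \<le> ennreal \<delta>" using \<kappa>\<delta> by (rule ennreal_leI)
      finally show ?thesis .
    qed
    from super[OF this] obtain w v where
      N: "\<And>x. exp_ennreal (f x) * (\<integral>\<^sup>+ n. (1 + conv stepk w x) ^ n \<partial>measure_pmf \<mu>) \<le> 1 + w x" and
      S: "\<And>x. exp_ennreal (f x) * ((\<integral>\<^sup>+ s. (1 + conv stepk w x) ^ fst s \<partial>measure_pmf (spec_pmf \<mu>)) * (1 + conv stepk v x)) \<le> 1 + v x" and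
      w: "\<And>x. w x \<le> ennreal (2/5)" and v: "\<And>x. v x \<le> ennreal (2/5)"
      by blast
    have "conv stepk v x \<le> conv stepk (\<lambda>_. ennreal (2/5)) x" by (rule conv_mono_right[OF v])
    then have Pv: "conv stepk v x \<le> ennreal (2/5)" by (simp only: conv_stepk_const)
    have "(\<integral>\<^sup>+ \<omega>. exp_ennreal (visit_sum Root f x \<omega>) \<partial>Omega \<mu>) \<le> (1 + w x) * (1 + conv stepk v x)"
      by (rule nn_integral_exp_visit_sum_Root_le[OF N S])
    \<comment> \<open>The threshold 2/5 is chosen for this line, since (7/5)^2 = 49/25 is below
      2.\<close>
    also have "\<dots> \<le> (1 + ennreal (2/5)) * (1 + ennreal (2/5))"
      by (intro mult_mono add_left_mono w Pv) auto
    also have "\<dots> = ennreal (49/25)"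
    proof -
      have "1 + ennreal (2/5) = ennreal (7/5)" by (subst ennreal_1[symmetric], subst ennreal_plus[symmetric]) auto
      then show ?thesis by (simp only: ennreal_mult[symmetric]) simp
    qed
    also have "\<dots> \<le> ennreal 2" by (rule ennreal_leI) simp
    finally show ?thesis by simp
  qed
  then show ?thesis using \<kappa> by blast
qed

end

theorem theorem1p3:
  fixes \<mu> :: "nat pmf"
  assumes d5: "CARD('d::finite) \<ge> 5"
    and mean: "measure_pmf.expectation \<mu> real = 1"
    and var_fin: "integrable (measure_pmf \<mu>) (\<lambda>i. (real i)^2)"
    and var_pos: "measure_pmf.variance \<mu> real > 0"
    and expmom: "\<exists>l>0. summable (\<lambda>i. exp (l * real i) * pmf \<mu> i)"
  shows "\<exists>\<kappa>>0. \<forall>\<phi> :: int ^ 'd \<Rightarrow> real. (\<forall>x. \<phi> x \<ge> 0) \<longrightarrow>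
     (\<forall>x. (\<integral>\<^sup>+ y. G \<mu> x y * ennreal (\<phi> y) \<partial>count_space UNIV) \<le> ennreal \<kappa>) \<longrightarrow>
     (\<integral>\<^sup>+ \<omega>. exp_ennreal (\<integral>\<^sup>+ u. indicator (tree \<omega>) u * ennreal (\<phi> (S \<omega> 0 u))
        \<partial>count_space UNIV) \<partial>Omega \<mu>) \<le> 2"
proof -
  interpret exp_critical_offspring \<mu> by unfold_locales (fact mean var_pos expmom)+
  have "CARD('d) \<ge> 3" using d5 by simp
  from exp_visit_sum_Root_le_two[OF this] obtain \<kappa> where "\<kappa> > 0" and
    bound: "\<And>(f :: int^'d \<Rightarrow> ennreal) x. (\<And>x. (\<integral>\<^sup>+ y. G \<mu> x y * f y \<partial>count_space UNIV) \<le> ennreal \<kappa>) \<Longrightarrow>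
      (\<integral>\<^sup>+ \<omega>. exp_ennreal (visit_sum Root f x \<omega>) \<partial>Omega \<mu>) \<le> 2"
    by blast
  have "(\<integral>\<^sup>+ \<omega>. exp_ennreal (\<integral>\<^sup>+ u. indicator (tree \<omega>) u * ennreal (\<phi> (S \<omega> 0 u))
        \<partial>count_space UNIV) \<partial>Omega \<mu>) \<le> 2"
    if "\<forall>x. (\<integral>\<^sup>+ y. G \<mu> x y * ennreal (\<phi> y) \<partial>count_space UNIV) \<le> ennreal \<kappa>" for \<phi> :: "int^'d \<Rightarrow> real"
    using bound[of "\<lambda>x. ennreal (\<phi> x)" 0] that by (simp add: visit_sum_def tree_eq)
  then show ?thesis using \<open>\<kappa> > 0\<close> by blast
qed

end
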